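(* For each binary matrix $M$, the following assertions are equivalent: (i) $M$ has the $D$-circular property; (ii) $M$ has the circular-ones property (for rows) and $M$ contains no matrix in $\mathcal F_{\mathrm{Dcirc}}$ as a configuration; (iii) $M$ contains no matrix in $\mathcal F_{\mathrm{Dcirc}}^\infty$ as a configuration.
   Context: All matrices are binary. Each row of a matrix is identified with the set of columns where it has a $1$. $M$ contains $M'$ as a configuration if some submatrix of $M$ equals $M'$ up to permutations of rows and of columns. $N^{t}$ is the transpose, $\overline N$ is the entrywise complement ($0\leftrightarrow1$), and $N^*$ is $N$ with one extra last column of $0$'s. For a linear order $\preccurlyeq$ on a finite set $X$ and $a,b\in X$, the circular interval $[a,b]_{\preccurlyeq}$ is $\{x: a\preccurlyeq x\preccurlyeq b\}$ if $a\preccurlyeq b$, and $\{x: x\preccurlyeq b\text{ or }a\preccurlyeq x\}$ if $b\prec a$; a circular interval of $\preccurlyeq$ is $\emptyset$ or some $[a,b]_{\preccurlyeq}$. $M$ has the circular-ones property if there is a linear order of its columns such that each row is a circular interval of it. $M$ has the $D$-circular property if there is a linear order $\preccurlyeq_{\mathrm c}$ of its columns such that each row is a circular interval of $\preccurlyeq_{\mathrm c}$ and, for any two rows $r,s$, the set difference $s-r$ is a circular interval of $\preccurlyeq_{\mathrm c}$. Matrices (rows listed top to bottom as $0/1$ strings): $Z_1$: 111, 100, 010, 001. $Z_2$: 100, 110, 111, 010. $Z_3$: 100, 110, 111, 101. $Z_4$: 1110, 0111, 0010. $Z_5$: 1001, 1100, 1110, 0100. $Z_6$: 1110, 1001, 0100,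 0010. $Z_7$: 1110, 1001, 0101, 0010. $Z_8$: 11101, 01111, 00100, 00001. For $k\ge3$, $M_I(k)$ is the $k\times k$ matrix whose row $i$ has $1$'s exactly in columns $i$ and $i+1$ for $1\le i\le k-1$, and whose row $k$ has $1$'s exactly in columns $1$ and $k$; $M_I^*(k)=(M_I(k))^*$. $\mathcal F_{\mathrm{Dcirc}}=\{Z_1^*,Z_2^*,Z_3^*,Z_4^*,Z_5,Z_5^{t},Z_6,Z_7,Z_8,\overline{Z_1^*},\overline{Z_2^*},\overline{Z_4^*},\overline{Z_6}\}$ and $\mathcal F_{\mathrm{Dcirc}}^\infty=\mathcal F_{\mathrm{Dcirc}}\cup\bigcup_{k=3}^\infty\{M_I^*(k),\overline{M_I^*(k)}\}$. *)

theory Defs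
  imports
    "Jordan_Normal_Form.Matrix"
    "Jordan_Normal_Form.DL_Submatrix"
    "HOL-Combinatorics.Permutations"
begin

text \<open>
  A binary matrix is a \<^typ>\<open>bool mat\<close>, with \<^const>\<open>True\<close> for $1$ and \<^const>\<open>False\<close> for $0$.
  Rows and columns are indexed from $0$; matrices without rows or without columns are allowed.
\<close>

definition bin_mat :: "nat \<Rightarrow> nat list list \<Rightarrow> bool mat" where
  "bin_mat nc rs = map_mat (\<lambda>x. x = 1) (mat_of_rows_list nc rs)"

definition row_set :: "bool mat \<Rightarrow> nat \<Rightarrow> nat set" where
  "row_set M i = {j. j < dim_col M \<and> M $$ (i, j)}"

definition complement_mat :: "bool mat \<Rightarrow> bool mat" where
  "complement_mat M = map_mat Not M"

text \<open>Appends a last column of zeros.\<close>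

definition star_mat :: "bool mat \<Rightarrow> bool mat" where
  "star_mat M = mat (dim_row M) (dim_col M + 1) (\<lambda>(i, j). j < dim_col M \<and> M $$ (i, j))"

definition equal_up_to_permutations :: "bool mat \<Rightarrow> bool mat \<Rightarrow> bool" where
  "equal_up_to_permutations A B \<longleftrightarrow>
     (\<exists>p q. p permutes {..<dim_row A} \<and> q permutes {..<dim_col A} \<and>
        B = mat (dim_row A) (dim_col A) (\<lambda>(i, j). A $$ (p i, q j)))"

definition contains_configuration :: "bool mat \<Rightarrow> bool mat \<Rightarrow> bool" where
  "contains_configuration M N \<longleftrightarrow> (\<exists>I J. equal_up_to_permutations (submatrix M I J) N)"

text \<open>A linear order on a set is a relation \<open>R\<close> with \<^prop>\<open>linear_order_on X R\<close>;
  \<^prop>\<open>(a, b) \<in> R\<close> means that $a$ precedes or equals $b$.\<close>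

definition circ_between :: "'a set \<Rightarrow> 'a rel \<Rightarrow> 'a \<Rightarrow> 'a \<Rightarrow> 'a set" where
  "circ_between X R a b =
     (if (a, b) \<in> R then {x \<in> X. (a, x) \<in> R \<and> (x, b) \<in> R}
      else {x \<in> X. (x, b) \<in> R \<or> (a, x) \<in> R})"

definition circular_interval :: "'a set \<Rightarrow> 'a rel \<Rightarrow> 'a set \<Rightarrow> bool" where
  "circular_interval X R S \<longleftrightarrow> S = {} \<or> (\<exists>a\<in>X. \<exists>b\<in>X. S = circ_between X R a b)"

definition circular_ones_property :: "bool mat \<Rightarrow> bool" where
  "circular_ones_property M \<longleftrightarrow>
     (\<exists>R. linear_order_on {..<dim_col M} R \<and>
        (\<forall>i<dim_row M. circular_interval {..<dim_col M} R (row_set M i)))"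

definition D_circular_property :: "bool mat \<Rightarrow> bool" where
  "D_circular_property M \<longleftrightarrow>
     (\<exists>R. linear_order_on {..<dim_col M} R \<and>
        (\<forall>i<dim_row M. circular_interval {..<dim_col M} R (row_set M i)) \<and>
        (\<forall>i<dim_row M. \<forall>j<dim_row M.
           circular_interval {..<dim_col M} R (row_set M j - row_set M i)))"

definition Z1 :: "bool mat" where
  "Z1 = bin_mat 3 [[1,1,1], [1,0,0], [0,1,0], [0,0,1]]"

definition Z2 :: "bool mat" where
  "Z2 = bin_mat 3 [[1,0,0], [1,1,0], [1,1,1], [0,1,0]]"

definition Z3 :: "bool mat" where
  "Z3 = bin_mat 3 [[1,0,0], [1,1,0], [1,1,1], [1,0,1]]"

definition Z4 :: "bool mat" where
  "Z4 = bin_mat 4 [[1,1,1,0], [0,1,1,1], [0,0,1,0]]"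

definition Z5 :: "bool mat" where
  "Z5 = bin_mat 4 [[1,0,0,1], [1,1,0,0], [1,1,1,0], [0,1,0,0]]"

definition Z6 :: "bool mat" where
  "Z6 = bin_mat 4 [[1,1,1,0], [1,0,0,1], [0,1,0,0], [0,0,1,0]]"

definition Z7 :: "bool mat" where
  "Z7 = bin_mat 4 [[1,1,1,0], [1,0,0,1], [0,1,0,1], [0,0,1,0]]"

definition Z8 :: "bool mat" where
  "Z8 = bin_mat 5 [[1,1,1,0,1], [0,1,1,1,1], [0,0,1,0,0], [0,0,0,0,1]]"

text \<open>With $0$-based indices, the last row \<open>k - 1\<close> has its ones in columns \<open>0\<close> and \<open>k - 1\<close>.\<close>

definition M_I :: "nat \<Rightarrow> bool mat" where
  "M_I k = mat k k (\<lambda>(i, j). if i + 1 < k then j = i \<or> j = i + 1 else j = 0 \<or> j = k - 1)"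

definition F_Dcirc :: "bool mat set" where
  "F_Dcirc =
     {star_mat Z1, star_mat Z2, star_mat Z3, star_mat Z4,
      Z5, transpose_mat Z5, Z6, Z7, Z8,
      complement_mat (star_mat Z1), complement_mat (star_mat Z2),
      complement_mat (star_mat Z4), complement_mat Z6}"

definition F_Dcirc_inf :: "bool mat set" where
  "F_Dcirc_inf =
     F_Dcirc \<union> (\<Union>k\<in>{3..}. {star_mat (M_I k), complement_mat (star_mat (M_I k))})"

end

theory Submission
  imports Defs
begin

text \<open>
  Rows, differences of rows and their complements form a family of sets closed under complement, and the
  \<open>D\<close>-circular property says that some circular order of the columns makes every member of the family an arc.
  Take a minimal set \<open>X\<close> of columns without such an order, a column \<open>c\<close> in \<open>X\<close> and a circular order of
  \<open>X - {c}\<close>. As \<open>c\<close> fits into no gap, the members avoiding \<open>c\<close> cover all gaps. A shortest cyclic cover of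
  length at least three is a cycle of pairs avoiding \<open>c\<close>, which by minimality spans \<open>X - {c}\<close>. A cover by two
  arcs splits \<open>X - {c}\<close> into two sides and a rest; unless both sides are singletons, orders of the three parts
  can be glued to an order of \<open>X\<close>, up to a single obstruction with six columns. If both sides are singletons
  for every \<open>c\<close>, then \<open>c\<close> lies in two pairs of the family, and the graph of pairs contains a cycle.
  Hence \<open>X\<close> carries a cycle of pairs around a centre or the six-column obstruction, and it remains to see how
  rows can realize these: the latter is impossible, and a cycle gives one of the listed configurations.
\<close>

section \<open>Circular orders\<close>

text \<open>An arc and its complement are arcs together, so fixing a column \<open>c\<close> turns
  the circular question into a linear one about the members avoiding \<open>c\<close>. Minimality
  provides orders of proper subsets only. Each part of a corner is therefore ordered together with
  single representatives of the other parts, and something must be left out: this is why the rest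
  has to contain two columns, and why two singleton sides resist gluing. The six-column obstruction
  is what can prevent a representative of the rest from being chosen.

  The cases by length of the cycle have different causes. On three vertices the edges are the three
  splits of four columns into pairs, which produces the small matrices. On four vertices the
  complement of an edge in the cycle is again an edge and opposite edges are close to each other;
  this leaves room for \<open>Z4\<close>, its complement and \<open>Z8\<close>. From five vertices
  on, only two uniform patterns survive: all edges are rows, or all edges are complements of
  rows.\<close>

definition cyc :: "('a \<Rightarrow> int) \<Rightarrow> 'a \<Rightarrow> 'a \<Rightarrow> 'a \<Rightarrow> bool" where
  "cyc p x y z \<longleftrightarrow> p x < p y \<and> p y < p z \<or> p y < p z \<and> p z < p x \<or> p z < p x \<and> p x < p y"

text \<open>Positions are integers up to rotation. A set is an arc of \<open>S\<close> iff no two of its members are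
  separated by members of \<open>S\<close> outside it in both directions; empty, full and complementary sets need no
  case distinction.\<close>

definition circ_order :: "'a set set \<Rightarrow> 'a set \<Rightarrow> ('a \<Rightarrow> int) \<Rightarrow> bool" where
  "circ_order G S p \<longleftrightarrow> inj_on p S \<and>
     (\<forall>g\<in>G. \<forall>x\<in>S \<inter> g. \<forall>y\<in>S \<inter> g. \<forall>z\<in>S - g. \<forall>w\<in>S - g. cyc p x z y = cyc p x w y)"

definition circular :: "'a set set \<Rightarrow> 'a set \<Rightarrow> bool" where
  "circular G S \<longleftrightarrow> (\<exists>p. circ_order G S p)"

lemma circ_orderD:
  assumes "circ_order G S p" "g \<in> G" "x \<in> S" "x \<in> g" "y \<in> S" "y \<in> g" "z \<in> S" "z \<notin> g" "w \<in> S" "w \<notin> g"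
  shows "cyc p x z y = cyc p x w y"
  using assms unfolding circ_order_def by blast

lemma circ_orderI:
  assumes "inj_on p S"
    "\<And>g x y z w. \<lbrakk>g \<in> G; x \<in> S; x \<in> g; y \<in> S; y \<in> g; z \<in> S; z \<notin> g; w \<in> S; w \<notin> g\<rbrakk>
       \<Longrightarrow> cyc p x z y = cyc p x w y"
  shows "circ_order G S p"
  unfolding circ_order_def using assms by blast

lemma circ_order_inj: "circ_order G S p \<Longrightarrow> inj_on p S"
  unfolding circ_order_def by blast

lemma circ_order_subset:
  assumes "circ_order G S p" "T \<subseteq> S"
  shows "circ_order G T p"
proof (rule circ_orderI)
  show "inj_on p T" using circ_order_inj[OF assms(1)] assms(2) by (rule inj_on_subset)
qed (use circ_orderD[OF assms(1)] assms(2) in blast)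

lemma circular_subset: "circular G S \<Longrightarrow> T \<subseteq> S \<Longrightarrow> circular G T"
  unfolding circular_def using circ_order_subset by blast

lemma finite_int_bound:
  fixes p :: "'a \<Rightarrow> int"
  assumes "finite S"
  obtains K where "K > 0" "\<And>x. x \<in> S \<Longrightarrow> - K < p x \<and> p x < K"
proof -
  define K where "K = 1 + (\<Sum>x\<in>S. \<bar>p x\<bar>)"
  have "\<bar>p x\<bar> \<le> (\<Sum>x\<in>S. \<bar>p x\<bar>)" if "x \<in> S" for x
    using that assms member_le_sum[of x S "\<lambda>x. \<bar>p x\<bar>"] by auto
  then show thesis using that[of K] unfolding K_def
    by (smt (verit) sum_nonneg)
qed

text \<open>\<open>cyc\<close> does not change when the circle is cut elsewhere. Raising the
  positions up to \<open>p x\<close> by \<open>2 * K\<close>, more than the spread of all positions,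
  moves them past the others and makes \<open>x\<close> the last one.\<close>

lemma circ_order_rotate:
  assumes S: "finite S" and p: "circ_order G S p" and x: "x \<in> S"
  obtains q where "circ_order G S q" "\<And>y. y \<in> S \<Longrightarrow> q y \<le> q x"
    "\<And>a b d. a \<in> S \<Longrightarrow> b \<in> S \<Longrightarrow> d \<in> S \<Longrightarrow> cyc q a b d = cyc p a b d"
proof -
  obtain K where K: "K > 0" "\<And>x. x \<in> S \<Longrightarrow> - K < p x \<and> p x < K"
    using finite_int_bound[OF S] by metis
  define q where "q y = (if p y \<le> p x then p y + 2 * K else p y)" for y
  have c: "cyc q a b d = cyc p a b d" if "a \<in> S" "b \<in> S" "d \<in> S" for a b d
    using K(2)[OF that(1)] K(2)[OF that(2)] K(2)[OF that(3)] unfolding cyc_def q_def by auto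
  have "inj_on p S" using p by (rule circ_order_inj)
  have "inj_on q S"
  proof (rule inj_onI)
    fix a b assume ab: "a \<in> S" "b \<in> S" "q a = q b"
    then have "p a = p b" using K(2)[OF ab(1)] K(2)[OF ab(2)] unfolding q_def by (auto split: if_splits)
    then show "a = b" using ab \<open>inj_on p S\<close> by (auto dest: inj_onD)
  qed
  then have "circ_order G S q"
    by (rule circ_orderI) (use circ_orderD[OF p] c in blast)
  moreover have "q y \<le> q x" if "y \<in> S" for y
    using K(2)[OF that] K(2)[OF x] unfolding q_def by auto
  ultimately show thesis using c that by blast
qed

text \<open>With \<open>c\<close> last, the circle is cut open at \<open>c\<close>, and an arc
  avoiding \<open>c\<close> cannot run across the cut.\<close>

lemma circ_order_convex:
  assumes p: "circ_order G S p" and c: "c \<in> S" "\<And>y. y \<in> S \<Longrightarrow> p y \<le> p c"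
    and g: "g \<in> G" "c \<notin> g" and xyz: "x \<in> S" "x \<in> g" "y \<in> S" "y \<in> g" "z \<in> S" "p x < p z" "p z < p y"
  shows "z \<in> g"
proof (rule ccontr)
  assume "z \<notin> g"
  then have "cyc p x z y = cyc p x c y" using circ_orderD[OF p g(1)] xyz c g by blast
  then show False using xyz c(2)[of y] c(2)[of x] unfolding cyc_def by auto
qed

text \<open>Of a member and its complement one avoids \<open>c\<close>, and both are arcs as soon as
  one is convex. The position of \<open>c\<close> is left free: later uses place it last as well as
  first.\<close>

lemma circ_orderI_convex:
  assumes G: "\<And>g. g \<in> G \<Longrightarrow> - g \<in> G" and inj: "inj_on p S" and c: "c \<in> S"
    and conv: "\<And>g x y z. \<lbrakk>g \<in> G; c \<notin> g; x \<in> S; x \<in> g; y \<in> S; y \<in> g; z \<in> S; p x < p z; p z < p y\<rbrakk> \<Longrightarrow> z \<in> g"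
  shows "circ_order G S p"
proof (rule circ_orderI, fact inj)
  fix g x y z w
  assume g: "g \<in> G" and *: "x \<in> S" "x \<in> g" "y \<in> S" "y \<in> g" "z \<in> S" "z \<notin> g" "w \<in> S" "w \<notin> g"
  have neq: "p x \<noteq> p z" "p x \<noteq> p w" "p y \<noteq> p z" "p y \<noteq> p w"
    using * inj by (auto dest: inj_onD)
  show "cyc p x z y = cyc p x w y"
  proof (cases "c \<in> g")
    case False
    then show ?thesis using neq * conv[OF g] unfolding cyc_def
      by (smt (verit))
  next
    case True
    then show ?thesis using neq * conv[OF G[OF g]] unfolding cyc_def
      by (smt (verit) ComplD ComplI)
  qed
qed

section \<open>Cycles of pairs\<close>

text \<open>A cycle of pairs alone is harmless, since neighbours on a circle form one. The centre
  \<open>c\<close>, avoided by all the pairs, is what makes it an obstruction.\<close>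

definition cyc_obs :: "'a set set \<Rightarrow> 'a \<Rightarrow> 'a list \<Rightarrow> bool" where
  "cyc_obs G c ts \<longleftrightarrow> distinct ts \<and> 3 \<le> length ts \<and> c \<notin> set ts \<and>
     (\<forall>i<length ts. \<exists>g\<in>G. g \<inter> insert c (set ts) = {ts ! i, ts ! (Suc i mod length ts)})"

text \<open>Cut at \<open>c\<close>, each pair consists of neighbours on the line, as far as the
  vertices of the cycle are concerned. The leftmost vertex would need two different right
  neighbours.\<close>

lemma cyc_obs_not_circular:
  assumes "cyc_obs G c ts"
  shows "\<not> circular G (insert c (set ts))"
proof
  let ?n = "length ts" and ?S = "insert c (set ts)"
  note ts = assms[unfolded cyc_obs_def]
  assume "circular G ?S"
  then obtain p where p: "circ_order G ?S p" and max: "\<And>y. y \<in> ?S \<Longrightarrow> p y \<le> p c"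
    unfolding circular_def using circ_order_rotate[of ?S G _ c] by (metis List.finite_set finite_insert insertI1)
  have gap: "p a < p b \<Longrightarrow> p b < p d \<Longrightarrow> b \<in> set ts \<Longrightarrow> False"
    if i: "i < ?n" and ad: "{a, d} = {ts ! i, ts ! (Suc i mod ?n)}" for a b d i
  proof -
    assume *: "p a < p b" "p b < p d" "b \<in> set ts"
    obtain g where g: "g \<in> G" "g \<inter> ?S = {a, d}" using ts i ad by metis
    have "{a, d} \<subseteq> set ts" using i unfolding ad by (auto intro!: nth_mem mod_less_divisor)
    then have "c \<notin> g" using ts g by blast
    then have "b \<in> g"
      using circ_order_convex[OF p _ max g(1), of a d b] * g(2) by auto
    then have "b \<in> {a, d}" using g(2) * by auto
    then show False using * by auto
  qed
  obtain i where i: "i < ?n" "\<And>j. j < ?n \<Longrightarrow> p (ts ! i) \<le> p (ts ! j)"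
  proof -
    have "finite (p ` set ts)" "p ` set ts \<noteq> {}" using ts by auto
    then obtain t where "t \<in> set ts" "p t = Min (p ` set ts)"
      by (metis (no_types, lifting) Min_in imageE)
    then show thesis using that by (metis Min_le \<open>finite (p ` set ts)\<close> image_eqI in_set_conv_nth)
  qed
  \<comment> \<open>Successor and predecessor of \<open>i\<close> on the cycle; they differ because
    there are at least three vertices.\<close>
  define j where "j = Suc i mod ?n"
  define k where "k = (if i = 0 then ?n - 1 else i - 1)"
  have jk: "j < ?n" "k < ?n" "Suc k mod ?n = i" "j \<noteq> k" "j \<noteq> i" "k \<noteq> i"
    using ts i(1) unfolding j_def k_def by (auto simp: mod_Suc)
  have lt: "p (ts ! i) < p (ts ! l)" if "l < ?n" "l \<noteq> i" for l
  proof -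
    have "ts ! i \<noteq> ts ! l" using ts that i(1) nth_eq_iff_index_eq by blast
    then have "p (ts ! i) \<noteq> p (ts ! l)"
      using circ_order_inj[OF p] that i(1) unfolding inj_on_def by (meson insertI2 nth_mem)
    then show ?thesis using i(2)[OF that(1)] by simp
  qed
  have "p (ts ! j) \<noteq> p (ts ! k)"
    using circ_order_inj[OF p] ts jk unfolding inj_on_def by (metis insertI2 nth_eq_iff_index_eq nth_mem)
  then consider "p (ts ! j) < p (ts ! k)" | "p (ts ! k) < p (ts ! j)" by linarith
  then show False
  proof cases
    case 1
    show False by (rule gap[of k "ts ! i" "ts ! k" "ts ! j"]) (use jk lt 1 in auto)
  next
    case 2
    show False by (rule gap[of i "ts ! i" "ts ! j" "ts ! k"]) (use jk lt 2 i in \<open>auto simp: j_def\<close>)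
  qed
qed

text \<open>Place \<open>c\<close> in the gap after \<open>x\<close>. Since this gives no circular
  order, some member avoiding \<open>c\<close> has a hole on the line cut open at that gap. As it is
  an arc without \<open>c\<close>, it contains everything outside the hole, in particular both
  borders \<open>x\<close> and \<open>y\<close> of the gap.\<close>

lemma insertion_obstructed:
  assumes G: "\<And>g. g \<in> G \<Longrightarrow> - g \<in> G" and S: "finite S" and c: "c \<in> S" and nc: "\<not> circular G S"
    and p: "circ_order G (S - {c}) p" and x: "x \<in> S - {c}"
  obtains y f where "y \<in> S - {c}" "y \<noteq> x" "f \<in> G" "c \<notin> f" "\<not> S - {c} \<subseteq> f" "x \<in> f" "y \<in> f"
    "\<And>u. u \<in> S - {c} \<Longrightarrow> \<not> cyc p x u y"
proof -
  let ?Y = "S - {c}"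
  obtain q where q: "circ_order G ?Y q" and max: "\<And>y. y \<in> ?Y \<Longrightarrow> q y \<le> q x"
    and qp: "\<And>a b d. a \<in> ?Y \<Longrightarrow> b \<in> ?Y \<Longrightarrow> d \<in> ?Y \<Longrightarrow> cyc q a b d = cyc p a b d"
    by (rule circ_order_rotate[OF _ p x]) (use S in auto)
  define q' where "q' = q(c := q x + 1)"
  have "inj_on q ?Y" using q by (rule circ_order_inj)
  then have "inj_on q' S" using max unfolding q'_def
    by (smt (verit, best) DiffI empty_iff fun_upd_apply inj_on_def insert_iff)
  then obtain g u v z where g: "g \<in> G" "c \<notin> g" and uvz: "u \<in> S" "u \<in> g" "v \<in> S" "v \<in> g" "z \<in> S"
      "q' u < q' z" "q' z < q' v" "z \<notin> g"
    using circ_orderI_convex[OF G _ c, of q'] nc unfolding circular_def by metis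
  have "u \<in> ?Y" "v \<in> ?Y" using uvz g by auto
  moreover have "z \<noteq> c" using uvz max[of v] g unfolding q'_def by (auto split: if_splits)
  ultimately have *: "u \<in> ?Y" "v \<in> ?Y" "z \<in> ?Y" "q u < q z" "q z < q v"
    using uvz g unfolding q'_def by (auto split: if_splits)
  \<comment> \<open>The first point of the line, hence the successor of \<open>x\<close> on the
    circle.\<close>
  obtain y where y: "y \<in> ?Y" and min: "\<And>w. w \<in> ?Y \<Longrightarrow> q y \<le> q w"
    using ex_min_if_finite[of "q ` ?Y"] S x by (fastforce simp: not_less)
  \<comment> \<open>The point \<open>z\<close> between \<open>u\<close> and \<open>v\<close> is
    missing from \<open>g\<close>, so the arc runs the other way round from \<open>v\<close> to
    \<open>u\<close>.\<close>
  have out: "w \<in> g" if "w \<in> ?Y" "\<not> (q u < q w \<and> q w < q v)" for w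
  proof (rule ccontr)
    assume w: "w \<notin> g"
    have "cyc q u z v = cyc q u w v" using circ_orderD[OF q g(1)] * uvz w that by blast
    then show False using * that unfolding cyc_def by auto
  qed
  have "x \<in> g" "y \<in> g" using out[OF x] out[OF y] max[OF *(2)] min[OF *(1)] by auto
  moreover have "y \<noteq> x" using max[OF *(3)] max[OF *(2)] min[OF *(1)] * by auto
  moreover have "\<not> cyc p x w y" if "w \<in> ?Y" for w
    using qp[OF x that y] max[OF that] min[OF that] max[OF y] unfolding cyc_def by auto
  ultimately show thesis using that[OF y, of g] g * uvz by blast
qed

text \<open>A finite relation with an edge leaving every point has a closed walk, and a repeated
  vertex or a chord of a shortest one would yield a shorter one. The absence of chords is what later
  confines an arc to two vertices.\<close>

lemma shortest_cycle:
  assumes fin: "finite Y" "Y \<noteq> {}" and EY: "E \<subseteq> Y \<times> Y" and succ: "\<And>x. x \<in> Y \<Longrightarrow> \<exists>y. (x, y) \<in> E"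
    and irr: "\<And>x. (x, x) \<notin> E"
  obtains ts where "distinct ts" "2 \<le> length ts" "set ts \<subseteq> Y"
    "\<And>i j. i < length ts \<Longrightarrow> j < length ts \<Longrightarrow> (ts ! i, ts ! j) \<in> E \<longleftrightarrow> j = Suc i mod length ts"
proof -
  have "\<not> acyclic E"
  proof
    assume "acyclic E"
    moreover have "finite E" using finite_subset[OF EY] fin(1) by simp
    ultimately have "wf (E\<inverse>)" using finite_acyclic_wf_converse by metis
    then obtain m where "m \<in> Y" "\<And>y. (y, m) \<in> E\<inverse> \<Longrightarrow> y \<notin> Y"
      using fin wfE_min[of "E\<inverse>" _ Y] by (metis all_not_in_conv)
    then show False using succ EY by blast
  qed
  define P where "P n \<longleftrightarrow> 0 < n \<and> (\<exists>x. (x, x) \<in> E ^^ n)" for n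
  have "\<exists>n. P n" using \<open>\<not> acyclic E\<close> unfolding acyclic_def P_def by (metis trancl_power)
  define n where "n = (LEAST n. P n)"
  have Pn: "P n" unfolding n_def using \<open>\<exists>n. P n\<close> LeastI_ex by metis
  have least: "\<not> P k" if "k < n" for k using that not_less_Least unfolding n_def by metis
  obtain f where f: "f 0 = f n" "\<And>i. i < n \<Longrightarrow> (f i, f (Suc i)) \<in> E"
    using Pn unfolding P_def by (metis relpow_fun_conv)
  have path: "(f i, f j) \<in> E ^^ (j - i)" if "i \<le> j" "j \<le> n" for i j
  proof -
    have "\<forall>l<j - i. (f (i + l), f (i + Suc l)) \<in> E" using f(2) that by auto
    then show ?thesis using that unfolding relpow_fun_conv
      by (intro exI[of _ "\<lambda>l. f (i + l)"]) auto
  qed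
  have n2: "2 \<le> n"
    using Pn f irr unfolding P_def by (metis One_nat_def Suc_1 Suc_leI Suc_lessI)
  have inj: "f i \<noteq> f j" if "i < j" "j < n" for i j
    using path[of i j] least[of "j - i"] that unfolding P_def by force
  define ts where "ts = map f [0..<n]"
  have "distinct ts" unfolding ts_def distinct_map inj_on_def
    using inj by (metis atLeastLessThan_iff distinct_upt linorder_neqE_nat set_upt)
  moreover have "f i \<in> Y" if "i < n" for i using f(2)[OF that] EY by blast
  then have "set ts \<subseteq> Y" unfolding ts_def by auto
  moreover have "(ts ! i, ts ! j) \<in> E \<longleftrightarrow> j = Suc i mod n" if ij: "i < n" "j < n" for i j
  proof
    assume "j = Suc i mod n"
    then show "(ts ! i, ts ! j) \<in> E" using f ij n2 unfolding ts_def by (auto simp: mod_Suc)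
  next
    assume "(ts ! i, ts ! j) \<in> E"
    then have e: "(f i, f j) \<in> E" using ij unfolding ts_def by simp
    show "j = Suc i mod n"
    proof (rule ccontr)
      assume ne: "j \<noteq> Suc i mod n"
      \<comment> \<open>A backward chord closes up the part of the walk from \<open>j\<close> to
        \<open>i\<close>; a forward chord skips the vertices between \<open>i\<close> and
        \<open>j\<close>.\<close>
      show False
      proof (cases "j \<le> i")
        case True
        have "(f j, f j) \<in> E ^^ Suc (i - j)"
          using path[OF True] ij e by (metis less_imp_le_nat relpow_Suc_I)
        moreover have "Suc (i - j) < n"
          using ne ij True n2 by (cases "i = n - 1") (auto simp: mod_Suc split: if_splits)
        ultimately show False using least unfolding P_def by blast
      next
        case False
        have "(f j, f j) \<in> E ^^ (Suc ((n - j) + i))"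
          using path[of j n] path[of 0 i] ij e f(1)
          by (metis (no_types, lifting) diff_zero le_refl less_imp_le_nat relpow_Suc_I relpow_add relcomp.relcompI zero_le)
        moreover have "Suc ((n - j) + i) < n" using False ne ij by (auto simp: mod_Suc split: if_splits)
        ultimately show False using least unfolding P_def by blast
      qed
    qed
  qed
  ultimately show thesis using that[of ts] n2 unfolding ts_def by auto
qed

definition sep :: "'a set set \<Rightarrow> 'a \<Rightarrow> 'a \<Rightarrow> 'a \<Rightarrow> 'a \<Rightarrow> bool" where
  "sep G x y z w \<longleftrightarrow> (\<exists>g\<in>G. x \<in> g \<and> y \<in> g \<and> z \<notin> g \<and> w \<notin> g)"

text \<open>Of the three splits of four points into pairs, arcs of a circle realize at most two. The
  sets witnessing all three avoid \<open>w\<close> and trace the sides of a triangle around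
  it.\<close>

lemma cyc_obs_triangle:
  assumes d: "distinct [x, y, z, w]" and s: "sep G x y z w" "sep G y z x w" "sep G z x y w"
  shows "cyc_obs G w [x, y, z]"
proof -
  have "\<exists>g\<in>G. g \<inter> insert w (set [x, y, z]) = {a, b}"
    if sab: "sep G a b e w" and "{a, b, e} = {x, y, z}" "w \<notin> {x, y, z}" for a b e
  proof -
    have "insert w (set [x, y, z]) = {a, b, e, w}" using that by auto
    moreover obtain g where "g \<in> G" "a \<in> g" "b \<in> g" "e \<notin> g" "w \<notin> g"
      using sab unfolding sep_def by blast
    moreover from this have "g \<inter> {a, b, e, w} = {a, b}" by blast
    ultimately show ?thesis by metis
  qed
  note edges = this[OF s(1)] this[OF s(2)] this[OF s(3)]
  show ?thesis unfolding cyc_obs_def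
  proof (intro conjI allI impI)
    fix i assume "i < length [x, y, z]"
    then consider "i = 0" | "i = 1" | "i = 2" by fastforce
    then show "\<exists>g\<in>G. g \<inter> insert w (set [x, y, z]) = {[x, y, z] ! i, [x, y, z] ! (Suc i mod length [x, y, z])}"
      by cases (use edges d in \<open>auto simp: insert_commute\<close>)
  qed (use d in auto)
qed

text \<open>Also incompatible with a circle: three disjoint pairs that are arcs tile the six points,
  and any three consecutive points then include a whole pair, whereas the triple meets each pair
  once. It enters only through \<open>corner_nested_rest\<close>.\<close>

definition matching_obs :: "'a set set \<Rightarrow> 'a \<Rightarrow> 'a \<Rightarrow> 'a \<Rightarrow> 'a \<Rightarrow> 'a \<Rightarrow> 'a \<Rightarrow> bool" where
  "matching_obs G x1 y1 x2 y2 x3 y3 \<longleftrightarrow> distinct [x1, y1, x2, y2, x3, y3] \<and>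
     (\<exists>g\<in>G. g \<inter> {x1, y1, x2, y2, x3, y3} = {x1, y1}) \<and>
     (\<exists>g\<in>G. g \<inter> {x1, y1, x2, y2, x3, y3} = {x2, y2}) \<and>
     (\<exists>g\<in>G. g \<inter> {x1, y1, x2, y2, x3, y3} = {x3, y3}) \<and>
     (\<exists>g\<in>G. g \<inter> {x1, y1, x2, y2, x3, y3} = {x1, x2, x3})"

text \<open>\<open>E\<close> leads from \<open>x\<close> to \<open>y\<close> when a member avoiding
  \<open>c\<close> covers the stretch from \<open>x\<close> on to \<open>y\<close>, but not
  everything. Every point has such an edge to its successor because \<open>c\<close> fits into no
  gap, so there is a shortest directed cycle. Two vertices give the two arcs of a corner. With more
  vertices, the arc of an edge contains no third one, since \<open>split\<close> would produce a
  chord.\<close>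

lemma cycle_or_corner:
  assumes G: "\<And>g. g \<in> G \<Longrightarrow> - g \<in> G" and X: "finite X" and c: "c \<in> X" and nc: "\<not> circular G X"
    and p: "circ_order G (X - {c}) p" and ne: "X - {c} \<noteq> {}"
  obtains ts where "cyc_obs G c ts" "set ts \<subseteq> X"
  | f g x y where "f \<in> G" "g \<in> G" "c \<notin> f" "c \<notin> g" "\<not> X - {c} \<subseteq> f" "\<not> X - {c} \<subseteq> g" "X - {c} \<subseteq> f \<union> g"
      "x \<in> X" "y \<in> X" "x \<noteq> y" "x \<in> f" "x \<in> g" "y \<in> f" "y \<in> g"
proof -
  let ?Y = "X - {c}"
  define W where "W x y f \<longleftrightarrow> f \<in> G \<and> c \<notin> f \<and> \<not> ?Y \<subseteq> f \<and> x \<in> f \<and> y \<in> f \<and>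
    (\<forall>u\<in>?Y. cyc p x u y \<longrightarrow> u \<in> f)" for x y f
  define E where "E = {(x, y). x \<in> ?Y \<and> y \<in> ?Y \<and> x \<noteq> y \<and> (\<exists>f. W x y f)}"
  have "\<exists>y. (x, y) \<in> E" if "x \<in> ?Y" for x
    using insertion_obstructed[OF G X c nc p that] that unfolding E_def W_def
    by (smt (verit, best) case_prodI mem_Collect_eq)
  moreover have "E \<subseteq> ?Y \<times> ?Y" "\<And>x. (x, x) \<notin> E" unfolding E_def by auto
  ultimately obtain ts where ts: "distinct ts" "2 \<le> length ts" "set ts \<subseteq> ?Y"
      and tsE: "\<And>i j. i < length ts \<Longrightarrow> j < length ts \<Longrightarrow> (ts ! i, ts ! j) \<in> E \<longleftrightarrow> j = Suc i mod length ts"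
    using shortest_cycle[of ?Y E] X ne by (metis finite_Diff)
  let ?n = "length ts"
  have split: "(x, u) \<in> E \<or> (u, y) \<in> E"
    if w: "W x y f" and xyu: "x \<in> ?Y" "y \<in> ?Y" "x \<noteq> y" "u \<in> ?Y" "u \<in> f" "u \<noteq> x" "u \<noteq> y" for x y f u
  proof -
    have f: "f \<in> G" "c \<notin> f" "\<not> ?Y \<subseteq> f" "x \<in> f" "y \<in> f" "\<And>v. v \<in> ?Y \<Longrightarrow> cyc p x v y \<Longrightarrow> v \<in> f"
      using w unfolding W_def by auto
    have inj: "v = v'" if "p v = p v'" "v \<in> ?Y" "v' \<in> ?Y" for v v'
      using circ_order_inj[OF p] that by (meson inj_onD)
    have neq: "p x \<noteq> p y" "p u \<noteq> p x" "p u \<noteq> p y" using inj xyu by metis+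
    have xu: "(x, u) \<in> E" if "\<And>v. v \<in> ?Y \<Longrightarrow> cyc p x v u \<Longrightarrow> v \<in> f"
      using that f xyu unfolding E_def W_def by auto
    have uy: "(u, y) \<in> E" if "\<And>v. v \<in> ?Y \<Longrightarrow> cyc p u v y \<Longrightarrow> v \<in> f"
      using that f xyu unfolding E_def W_def by auto
    show ?thesis
    proof (cases "cyc p x u y")
      case True
      have "cyc p x v u \<Longrightarrow> cyc p x v y" for v using True unfolding cyc_def by linarith
      then show ?thesis using xu f(6) by blast
    next
      case False
      \<comment> \<open>Here \<open>u\<close> lies beyond \<open>y\<close>. The arc \<open>f\<close>
        cannot miss points both between \<open>y\<close> and \<open>u\<close> and between
        \<open>u\<close> and \<open>x\<close>, so it covers the way from \<open>x\<close> through
        \<open>y\<close> to \<open>u\<close> or the way from \<open>u\<close> through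
        \<open>x\<close> to \<open>y\<close>.\<close>
      have "(\<forall>v\<in>?Y. cyc p y v u \<longrightarrow> v \<in> f) \<or> (\<forall>v\<in>?Y. cyc p u v x \<longrightarrow> v \<in> f)"
      proof (rule ccontr)
        assume "\<not> ?thesis"
        then obtain v v' where v: "v \<in> ?Y" "cyc p y v u" "v \<notin> f" "v' \<in> ?Y" "cyc p u v' x" "v' \<notin> f" by blast
        have "cyc p y v u = cyc p y v' u" using circ_orderD[OF p f(1)] f xyu v by blast
        then show False using v False neq unfolding cyc_def by linarith
      qed
      then show ?thesis
      proof
        assume *: "\<forall>v\<in>?Y. cyc p y v u \<longrightarrow> v \<in> f"
        have "v \<in> f" if "v \<in> ?Y" "cyc p x v u" for v
        proof -
          have "cyc p x v y \<or> p v = p y \<or> cyc p y v u"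
            using that False neq unfolding cyc_def by linarith
          then show ?thesis using * f inj that xyu by metis
        qed
        then show ?thesis using xu by blast
      next
        assume *: "\<forall>v\<in>?Y. cyc p u v x \<longrightarrow> v \<in> f"
        have "v \<in> f" if "v \<in> ?Y" "cyc p u v y" for v
        proof -
          have "cyc p x v y \<or> p v = p x \<or> cyc p u v x"
            using that False neq unfolding cyc_def by linarith
          then show ?thesis using * f inj that xyu by metis
        qed
        then show ?thesis using uy by blast
      qed
    qed
  qed
  have next_lt: "Suc i mod ?n < ?n" if "i < ?n" for i 
    by (rule mod_less_divisor) (use that in linarith)
  have wit: "\<exists>f. W (ts ! i) (ts ! (Suc i mod ?n)) f" and ine: "ts ! i \<noteq> ts ! (Suc i mod ?n)" if "i < ?n" for i
    using tsE[OF that next_lt[OF that]] unfolding E_def by auto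
  show thesis
  proof (cases "?n = 2")
    case True
    obtain f where f: "W (ts ! 0) (ts ! 1) f" using wit[of 0] True by auto
    obtain g where g: "W (ts ! 1) (ts ! 0) g" using wit[of 1] True by (auto simp: numeral_2_eq_2)
    have t: "ts ! 0 \<in> ?Y" "ts ! 1 \<in> ?Y" "ts ! 0 \<noteq> ts ! 1"
      using ts True ine[of 0] by (auto simp: subset_iff)
    \<comment> \<open>The stretches from one vertex to the other and back make up the whole
      circle.\<close>
    have "?Y \<subseteq> f \<union> g"
    proof
      fix u assume u: "u \<in> ?Y"
      have pn: "p (ts ! 0) \<noteq> p (ts ! 1)" using circ_order_inj[OF p] t by (meson inj_onD)
      have "u = ts ! 0 \<or> u = ts ! 1 \<or> cyc p (ts ! 0) u (ts ! 1) \<or> cyc p (ts ! 1) u (ts ! 0)"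
      proof (rule ccontr)
        assume *: "\<not> ?thesis"
        then have "p u \<noteq> p (ts ! 0)" "p u \<noteq> p (ts ! 1)" using circ_order_inj[OF p] t u by (meson inj_onD)+
        then show False using * pn unfolding cyc_def by linarith
      qed
      then show "u \<in> f \<union> g" using f g u unfolding W_def by blast
    qed
    then show thesis using f g t that(2)[of f g "ts ! 0" "ts ! 1"] unfolding W_def by blast
  next
    case False
    have "cyc_obs G c ts" unfolding cyc_obs_def
    proof (intro conjI allI impI)
      fix i assume i: "i < ?n"
      obtain f where f: "W (ts ! i) (ts ! (Suc i mod ?n)) f" using wit[OF i] by blast
      have ti: "ts ! i \<in> ?Y" "ts ! (Suc i mod ?n) \<in> ?Y" using ts i next_lt[OF i] by (meson nth_mem subsetD)+
      have "f \<inter> insert c (set ts) \<subseteq> {ts ! i, ts ! (Suc i mod ?n)}"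
      proof
        fix u assume u: "u \<in> f \<inter> insert c (set ts)"
        then obtain j where j: "j < ?n" "u = ts ! j" using f unfolding W_def by (auto simp: in_set_conv_nth)
        show "u \<in> {ts ! i, ts ! (Suc i mod ?n)}"
        proof (rule ccontr)
          assume "u \<notin> {ts ! i, ts ! (Suc i mod ?n)}"
          then have "(ts ! i, ts ! j) \<in> E \<or> (ts ! j, ts ! (Suc i mod ?n)) \<in> E"
            using split[OF f ti ine[OF i], of u] u j ts f by (auto simp: W_def subset_iff)
          \<comment> \<open>Without chords, the edge leaving \<open>ts ! i\<close> is the cyclic
            step and the edge entering its successor starts at \<open>ts ! i\<close>; either way
            \<open>u\<close> is an end of the pair.\<close>
          then have "j = Suc i mod ?n \<or> Suc i mod ?n = Suc j mod ?n"
            using tsE i j next_lt[OF i] by blast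
          then have "j = Suc i mod ?n \<or> i = j"
            using i j by (auto simp: mod_Suc split: if_splits)
          then show False using \<open>u \<notin> _\<close> j by auto
        qed
      qed
      moreover have "{ts ! i, ts ! (Suc i mod ?n)} \<subseteq> f \<inter> insert c (set ts)"
        using f i next_lt[OF i] unfolding W_def by auto
      ultimately show "\<exists>g\<in>G. g \<inter> insert c (set ts) = {ts ! i, ts ! (Suc i mod ?n)}"
        using f unfolding W_def by blast
    qed (use ts False in auto)
    then show thesis using that(1) ts by blast
  qed
qed

section \<open>Gluing linear orders\<close>

definition order_convex :: "('a \<Rightarrow> int) \<Rightarrow> 'a set \<Rightarrow> 'a set \<Rightarrow> bool" where
  "order_convex p S h \<longleftrightarrow> (\<forall>x\<in>S \<inter> h. \<forall>y\<in>S \<inter> h. \<forall>z\<in>S. p x < p z \<longrightarrow> p z < p y \<longrightarrow> z \<in> h)"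

definition order_upper :: "('a \<Rightarrow> int) \<Rightarrow> 'a set \<Rightarrow> 'a set \<Rightarrow> bool" where
  "order_upper p S h \<longleftrightarrow> (\<forall>x\<in>S \<inter> h. \<forall>y\<in>S. p x < p y \<longrightarrow> y \<in> h)"

lemma order_convexD:
  "order_convex p S h \<Longrightarrow> x \<in> S \<Longrightarrow> x \<in> h \<Longrightarrow> y \<in> S \<Longrightarrow> y \<in> h \<Longrightarrow> z \<in> S \<Longrightarrow> p x < p z \<Longrightarrow> p z < p y \<Longrightarrow> z \<in> h"
  unfolding order_convex_def by blast

lemma order_upperD: "order_upper p S h \<Longrightarrow> x \<in> S \<Longrightarrow> x \<in> h \<Longrightarrow> y \<in> S \<Longrightarrow> p x < p y \<Longrightarrow> y \<in> h"
  unfolding order_upper_def by blast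

lemma order_convex_subset: "order_convex p S h \<Longrightarrow> T \<subseteq> S \<Longrightarrow> order_convex p T h"
  unfolding order_convex_def by blast

lemma order_convex_uminus:
  assumes "order_convex p S h"
  shows "order_convex (\<lambda>x. - p x) S h"
  unfolding order_convex_def
proof (intro ballI impI)
  fix x y z assume "x \<in> S \<inter> h" "y \<in> S \<inter> h" "z \<in> S" "- p x < - p z" "- p z < - p y"
  then show "z \<in> h" using order_convexD[OF assms, of y x z] by auto
qed

lemma circ_order_root:
  assumes "finite S" "circular G S" "c \<in> S"
  shows "\<exists>p. inj_on p S \<and> (\<forall>y\<in>S. p y \<le> p c) \<and> (\<forall>h\<in>G. c \<notin> h \<longrightarrow> order_convex p S h)"
proof -
  obtain p where p: "circ_order G S p" using assms unfolding circular_def by blast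
  obtain q where q: "circ_order G S q" and m: "\<And>y. y \<in> S \<Longrightarrow> q y \<le> q c"
    by (rule circ_order_rotate[OF assms(1) p assms(3)]) blast
  show ?thesis unfolding order_convex_def
    by (rule exI[of _ q]) (use circ_order_inj[OF q] m circ_order_convex[OF q assms(3) m] in blast)
qed

text \<open>Cut at \<open>c\<close>, the sets \<open>f\<close> and \<open>g\<close> force
  \<open>e\<close> to lie between \<open>b\<close> and all of \<open>A\<close>. After a reflection
  \<open>A\<close> comes before \<open>e\<close>, so a convex set through \<open>e\<close> meets
  \<open>A\<close> in a final segment. In a corner, \<open>b\<close> and \<open>e\<close> stand for
  the other side and the rest.\<close>

lemma side_order:
  assumes A: "finite A" "c \<notin> A" "b \<notin> A" "e \<notin> A" "distinct [c, b, e]"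
    and circ: "circular G (insert c (insert b (insert e A)))"
    and f: "f \<in> G" "c \<notin> f" "b \<in> f" "e \<in> f" "A \<inter> f = {}"
    and g: "g \<in> G" "c \<notin> g" "b \<notin> g" "e \<in> g" "A \<subseteq> g"
  shows "\<exists>p. inj_on p A \<and> (\<forall>h\<in>G. c \<notin> h \<longrightarrow> (e \<in> h \<longrightarrow> order_upper p A h) \<and> order_convex p A h)"
proof -
  define S where "S = insert c (insert b (insert e A))"
  have S: "finite S" "c \<in> S" "b \<in> S" "e \<in> S" "A \<subseteq> S" using A unfolding S_def by auto
  obtain p where inj: "inj_on p S" and conv: "\<And>h. h \<in> G \<Longrightarrow> c \<notin> h \<Longrightarrow> order_convex p S h"
    using circ_order_root[OF S(1) circ[folded S_def] S(2)] by blast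
  have injD: "p x \<noteq> p y" if "x \<noteq> y" "x \<in> S" "y \<in> S" for x y using inj that by (meson inj_onD)
  have injA: "inj_on p A" using inj S(5) by (rule inj_on_subset)
  have sides: "(p a < p e \<longleftrightarrow> p e < p b) \<and> p a \<noteq> p e" if "a \<in> A" for a
  proof -
    have "a \<in> S" using that S by blast
    have "\<not> (p e < p a \<and> p a < p b)" "\<not> (p b < p a \<and> p a < p e)"
      using order_convexD[OF conv[OF f(1,2)], of e b a] order_convexD[OF conv[OF f(1,2)], of b e a]
        f S \<open>a \<in> S\<close> that by blast+
    moreover have "\<not> (p e < p b \<and> p b < p a)" "\<not> (p a < p b \<and> p b < p e)"
      using order_convexD[OF conv[OF g(1,2)], of e a b] order_convexD[OF conv[OF g(1,2)], of a e b]
        g S \<open>a \<in> S\<close> that by blast+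
    moreover have "a \<noteq> e" "a \<noteq> b" "e \<noteq> b" using A that by auto
    then have "p a \<noteq> p e" "p a \<noteq> p b" "p e \<noteq> p b" using injD S \<open>a \<in> S\<close> by blast+
    ultimately show ?thesis by linarith
  qed
  show ?thesis
  proof (cases "p e < p b")
    case True
    have "order_upper p A h" if "h \<in> G" "c \<notin> h" "e \<in> h" for h unfolding order_upper_def
      using order_convexD[OF conv[OF that(1,2)], of _ e] that S sides True by blast
    then show ?thesis using injA conv order_convex_subset[OF _ S(5)] by blast
  next
    case False
    have "order_upper (\<lambda>x. - p x) A h" if "h \<in> G" "c \<notin> h" "e \<in> h" for h unfolding order_upper_def
    proof (intro ballI impI)
      fix x y assume xy: "x \<in> A \<inter> h" "y \<in> A" "- p x < - p y"
      then have "p e < p y" using sides[of y] False by force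
      then show "y \<in> h" using order_convexD[OF conv[OF that(1,2)], of e x y] that S xy by auto
    qed
    moreover have "inj_on (\<lambda>x. - p x) A" using injA by (simp add: inj_on_def)
    ultimately show ?thesis using conv order_convex_uminus[OF order_convex_subset[OF _ S(5)]]
      by (intro exI[of _ "\<lambda>x. - p x"]) blast
  qed
qed

text \<open>Apart from \<open>c\<close>, the convex set \<open>f\<close> misses only
  \<open>a\<close> and the convex set \<open>g\<close> misses only \<open>b\<close>, so these two
  are the ends of the line and \<open>R\<close> lies between them. Convex sets through an end are
  initial or final segments of \<open>R\<close>.\<close>

lemma middle_order:
  assumes R: "finite R" "c \<notin> R" "a \<notin> R" "b \<notin> R" "distinct [c, a, b]"
    and circ: "circular G (insert c (insert a (insert b R)))"
    and f: "f \<in> G" "c \<notin> f" "a \<notin> f" "b \<in> f" "R \<subseteq> f"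
    and g: "g \<in> G" "c \<notin> g" "a \<in> g" "b \<notin> g" "R \<subseteq> g"
  shows "\<exists>p. inj_on p R \<and> (\<forall>h\<in>G. c \<notin> h \<longrightarrow>
    (a \<in> h \<longrightarrow> order_upper (\<lambda>x. - p x) R h) \<and> (b \<in> h \<longrightarrow> order_upper p R h) \<and> order_convex p R h)"
proof -
  define S where "S = insert c (insert a (insert b R))"
  have S: "finite S" "c \<in> S" "b \<in> S" "a \<in> S" "R \<subseteq> S" using R unfolding S_def by auto
  obtain p0 where p0: "inj_on p0 S" "\<forall>h\<in>G. c \<notin> h \<longrightarrow> order_convex p0 S h"
    using circ_order_root[OF S(1) circ[folded S_def] S(2)] by blast
  have p0': "inj_on (\<lambda>x. - p0 x) S" using p0(1) by (simp add: inj_on_def)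
  have "p0 a \<noteq> p0 b" using p0(1) S R(5) by (auto dest: inj_onD)
  then consider "p0 a < p0 b" | "- p0 a < - p0 b" by linarith
  then obtain p where inj: "inj_on p S" and conv: "\<And>h. h \<in> G \<Longrightarrow> c \<notin> h \<Longrightarrow> order_convex p S h"
    and ab: "p a < p b"
  proof cases
    case 1
    then show thesis using that[of p0] p0 by blast
  next
    case 2
    then show thesis using that[of "\<lambda>x. - p0 x"] p0' p0(2) order_convex_uminus by blast
  qed
  have injD: "p x \<noteq> p y" if "x \<noteq> y" "x \<in> S" "y \<in> S" for x y using inj that by (meson inj_onD)
  have injR: "inj_on p R" using inj S(5) by (rule inj_on_subset)
  have lt: "p a < p x \<and> p x < p b" if "x \<in> R" for x
  proof -
    have "x \<in> S" using that S by blast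
    have "\<not> (p x < p a \<and> p a < p b)"
      using order_convexD[OF conv[OF f(1,2)], of x b a] f S \<open>x \<in> S\<close> that by blast
    moreover have "\<not> (p a < p b \<and> p b < p x)"
      using order_convexD[OF conv[OF g(1,2)], of a x b] g S \<open>x \<in> S\<close> that by blast
    moreover have "x \<noteq> a" "x \<noteq> b" using R that by auto
    then have "p x \<noteq> p a" "p x \<noteq> p b" using injD S \<open>x \<in> S\<close> by blast+
    ultimately show ?thesis using ab by linarith
  qed
  have "order_upper (\<lambda>x. - p x) R h" if "h \<in> G" "c \<notin> h" "a \<in> h" for h unfolding order_upper_def
  proof (intro ballI impI)
    fix x y assume "x \<in> R \<inter> h" "y \<in> R" "- p x < - p y"
    then show "y \<in> h" using order_convexD[OF conv[OF that(1,2)], of a x y] that S lt by auto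
  qed
  moreover have "order_upper p R h" if "h \<in> G" "c \<notin> h" "b \<in> h" for h unfolding order_upper_def
    using order_convexD[OF conv[OF that(1,2)], of _ b] that S lt by blast
  ultimately show ?thesis using injR conv order_convex_subset[OF _ S(5)] by blast
qed

text \<open>The smallest set of a finite chain lies in all the others. This is how a representative
  of a whole part of a corner is chosen.\<close>

lemma nested_common_element:
  assumes R: "finite R" "R \<noteq> {}" and F: "\<And>T. T \<in> F \<Longrightarrow> T \<subseteq> R \<and> T \<noteq> {}"
    and nested: "\<And>T T'. T \<in> F \<Longrightarrow> T' \<in> F \<Longrightarrow> T \<subseteq> T' \<or> T' \<subseteq> T"
  obtains e where "e \<in> R" "\<And>T. T \<in> F \<Longrightarrow> e \<in> T"
proof (cases "F = {}")
  case True
  then show thesis using that R by blast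
next
  case False
  have "finite F" using F R by (meson PowI finite_Pow_iff finite_subset subsetI)
  then obtain T where T: "T \<in> F" "\<And>T'. T' \<in> F \<Longrightarrow> card T \<le> card T'"
    using False by (metis arg_min_if_finite(1) arg_min_least)
  have "T \<subseteq> T'" if "T' \<in> F" for T'
    using nested[OF T(1) that] T(2)[OF that] F[OF T(1)] F[OF that] R(1)
    by (metis card_subset_eq finite_subset nle_le card_mono order_antisym)
  then show thesis using that F[OF T(1)] by blast
qed

lemma sep_rotate:
  assumes "\<And>g. g \<in> G \<Longrightarrow> - g \<in> G" "sep G x y z w"
  shows "sep G z w x y"
  using assms unfolding sep_def by (meson ComplD ComplI)

section \<open>Minimal families without a circular order\<close>

locale minimal_noncircular =
  fixes G :: "'a set set" and X :: "'a set"
  assumes compl: "g \<in> G \<Longrightarrow> - g \<in> G"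
    and fin: "finite X"
    and nc: "\<not> circular G X"
    and minimal: "S \<subset> X \<Longrightarrow> circular G S"

text \<open>Set up in order to be refuted: \<open>no_obstruction_free\<close> derives a
  contradiction here, which proves \<open>minimal_obstruction\<close>.\<close>

locale obstruction_free = minimal_noncircular +
  assumes no_obs: "cyc_obs G w ts \<Longrightarrow> \<not> insert w (set ts) \<subseteq> X"
    and no_match: "matching_obs G x1 y1 x2 y2 x3 y3 \<Longrightarrow> \<not> {x1, y1, x2, y2, x3, y3} \<subseteq> X"
begin

lemma quartet:
  assumes "distinct [x, y, z, w]" "{x, y, z, w} \<subseteq> X" "sep G x y z w" "sep G y z x w" "sep G z x y w"
  shows False
  using no_obs[OF cyc_obs_triangle[OF assms(1,3-5)]] assms(2) by auto

text \<open>The two sides of a corner are \<open>X - {c} - f\<close> and \<open>X - {c} - g\<close>, its rest is \<open>X \<inter> f \<inter> g\<close>.\<close>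

definition corner :: "'a \<Rightarrow> 'a set \<Rightarrow> 'a set \<Rightarrow> bool" where
  "corner c f g \<longleftrightarrow> c \<in> X \<and> f \<in> G \<and> g \<in> G \<and> c \<notin> f \<and> c \<notin> g \<and> \<not> X - {c} \<subseteq> f \<and> \<not> X - {c} \<subseteq> g \<and>
     X - {c} \<subseteq> f \<union> g \<and> (\<exists>x\<in>X \<inter> f \<inter> g. \<exists>y\<in>X \<inter> f \<inter> g. x \<noteq> y)"

lemma corner_sym: "corner c f g \<Longrightarrow> corner c g f"
  unfolding corner_def by blast

text \<open>If \<open>r\<close> were missing, then \<open>h\<close>, \<open>f\<close> and
  \<open>g\<close> would realize all three splits of \<open>a\<close>, \<open>b\<close>,
  \<open>r\<close>, \<open>c\<close>. So a member reaching from one side to the other passes over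
  the whole rest, as it should on a line.\<close>

lemma corner_both:
  assumes cor: "corner c f g" and h: "h \<in> G" "c \<notin> h"
    and a: "a \<in> X - {c} - f" "a \<in> h" and b: "b \<in> X - {c} - g" "b \<in> h" and r: "r \<in> X \<inter> f \<inter> g"
  shows "r \<in> h"
proof (rule ccontr)
  assume "r \<notin> h"
  note c = cor[unfolded corner_def]
  have "a \<in> g" "b \<in> f" using c a b by auto
  moreover have "distinct [a, b, r, c]" "{a, b, r, c} \<subseteq> X" using c a b r h \<open>a \<in> g\<close> by auto
  moreover have "sep G a b r c" unfolding sep_def using h a b r \<open>r \<notin> h\<close> by blast
  moreover have "sep G b r a c" unfolding sep_def using c a r \<open>b \<in> f\<close> by blast
  moreover have "sep G r a b c" unfolding sep_def using c b r \<open>a \<in> g\<close> by blast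
  ultimately show False using quartet by blast
qed

text \<open>Two members that reach into the rest from the same side must be nested there. A point
  \<open>u\<close> of the side common to both would give all three splits of \<open>t\<close>,
  \<open>t'\<close>, \<open>u\<close>, \<open>c\<close>; without a common point the six-column
  obstruction appears.\<close>

lemma corner_nested_rest:
  assumes cor: "corner c f g" and h: "h \<in> G" "c \<notin> h" "h \<inter> (X - {c} - g) = {}"
    and h': "h' \<in> G" "c \<notin> h'" "h' \<inter> (X - {c} - g) = {}"
    and a: "a \<in> X - {c} - f" "a \<in> h" and a': "a' \<in> X - {c} - f" "a' \<in> h'"
    and t: "t \<in> X \<inter> f \<inter> g" "t \<in> h" "t \<notin> h'" and t': "t' \<in> X \<inter> f \<inter> g" "t' \<in> h'" "t' \<notin> h"
  shows False
proof -
  note c = cor[unfolded corner_def]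
  obtain b where b: "b \<in> X" "b \<noteq> c" "b \<notin> g" "b \<in> f" using c by blast
  have "b \<notin> h" "b \<notin> h'" using b h h' by auto
  have ag: "a \<in> g" "a' \<in> g" using c a a' by auto
  have common: False if "u \<in> X - {c} - f" "u \<in> h" "u \<in> h'" for u
  proof (rule quartet)
    show "distinct [t, t', u, c]" "{t, t', u, c} \<subseteq> X" using c t t' that h by auto
    show "sep G t t' u c" unfolding sep_def using c t t' that by blast
    show "sep G t' u t c" unfolding sep_def using h' t t' that by blast
    show "sep G u t t' c" unfolding sep_def using h t t' that by blast
  qed
  then have ah: "a \<notin> h'" "a' \<notin> h" using a a' by auto
  let ?S = "{a, t, a', t', c, b}"
  have d: "distinct [a, t, a', t', c, b]" using a a' t t' b c ah ag h h' by auto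
  \<comment> \<open>The three pairs come from \<open>h\<close>, \<open>h'\<close> and the complement
    of \<open>g\<close>, the triple from the complement of \<open>f\<close>.\<close>
  have "matching_obs G a t a' t' c b" unfolding matching_obs_def
  proof (intro conjI)
    have "h \<inter> ?S = {a, t}" using a t h t' ah \<open>b \<notin> h\<close> by auto
    then show "\<exists>g\<in>G. g \<inter> ?S = {a, t}" using h by blast
    have "h' \<inter> ?S = {a', t'}" using a' t h' t' ah \<open>b \<notin> h'\<close> by auto
    then show "\<exists>g\<in>G. g \<inter> ?S = {a', t'}" using h' by blast
    have "(- g) \<inter> ?S = {c, b}" using ag t t' b c by auto
    then show "\<exists>g\<in>G. g \<inter> ?S = {c, b}" using compl c by blast
    have "(- f) \<inter> ?S = {a, a', c}" using a a' t t' b c by auto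
    then show "\<exists>g\<in>G. g \<inter> ?S = {a, a', c}" using compl c by blast
  qed (fact d)
  then show False using no_match a a' t t' b c by auto
qed

text \<open>The traces on the rest are nested, so \<open>h\<close> and \<open>h'\<close> share a
  point \<open>s\<close> there. Then \<open>a\<close>, \<open>a'\<close>, \<open>s\<close> and a
  point \<open>b\<close> of the other side are split in all three ways, by \<open>h\<close>,
  \<open>h'\<close> and the complement of \<open>f\<close>.\<close>

lemma corner_nested_side:
  assumes cor: "corner c f g" and h: "h \<in> G" "c \<notin> h" "h \<inter> (X - {c} - g) = {}"
    and h': "h' \<in> G" "c \<notin> h'" "h' \<inter> (X - {c} - g) = {}"
    and a: "a \<in> X - {c} - f" "a \<in> h" "a \<notin> h'" and a': "a' \<in> X - {c} - f" "a' \<in> h'" "a' \<notin> h"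
    and t: "t \<in> X \<inter> f \<inter> g" "t \<in> h" and t': "t' \<in> X \<inter> f \<inter> g" "t' \<in> h'"
  shows False
proof -
  note c = cor[unfolded corner_def]
  obtain b where b: "b \<in> X" "b \<noteq> c" "b \<notin> g" "b \<in> f" using c by blast
  have "b \<notin> h" "b \<notin> h'" using b h h' by auto
  have "t \<in> h' \<or> t' \<in> h"
    using corner_nested_rest[OF cor h h' a(1,2) a'(1,2) t _ t'] by blast
  then obtain s where s: "s \<in> X \<inter> f \<inter> g" "s \<in> h" "s \<in> h'" using t t' by blast
  show False
  proof (rule quartet)
    show "distinct [a, a', s, b]" "{a, a', s, b} \<subseteq> X" using a a' s b by auto
    show "sep G a a' s b" unfolding sep_def
      by (rule bexI[of _ "- f"]) (use a a' s b c compl in auto)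
    show "sep G a' s a b" unfolding sep_def using h' a a' s \<open>b \<notin> h'\<close> by blast
    show "sep G s a a' b" unfolding sep_def using h a a' s \<open>b \<notin> h\<close> by blast
  qed
qed

text \<open>The point \<open>e\<close> can replace the rest while a side is being ordered. It is
  taken from the smallest of the nested traces; members that also meet the other side contain the
  whole rest anyway.\<close>

lemma corner_common_rest:
  assumes cor: "corner c f g"
  obtains e where "e \<in> X \<inter> f \<inter> g"
    "\<And>h. \<lbrakk>h \<in> G; c \<notin> h; h \<inter> (X - {c} - f) \<noteq> {}; h \<inter> (X \<inter> f \<inter> g) \<noteq> {}\<rbrakk> \<Longrightarrow> e \<in> h"
proof -
  let ?A = "X - {c} - f" and ?B = "X - {c} - g" and ?R = "X \<inter> f \<inter> g"
  define F where "F = {h \<inter> ?R | h. h \<in> G \<and> c \<notin> h \<and> h \<inter> ?A \<noteq> {} \<and> h \<inter> ?B = {} \<and> h \<inter> ?R \<noteq> {}}"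
  have "T \<subseteq> T' \<or> T' \<subseteq> T" if TT: "T \<in> F" "T' \<in> F" for T T'
  proof (rule ccontr)
    assume "\<not> ?thesis"
    then obtain t t' where t: "t \<in> T" "t \<notin> T'" "t' \<in> T'" "t' \<notin> T" by blast
    obtain h where h: "T = h \<inter> ?R" "h \<in> G" "c \<notin> h" "h \<inter> ?A \<noteq> {}" "h \<inter> ?B = {}" using TT(1) unfolding F_def by blast
    obtain h' where h': "T' = h' \<inter> ?R" "h' \<in> G" "c \<notin> h'" "h' \<inter> ?A \<noteq> {}" "h' \<inter> ?B = {}" using TT(2) unfolding F_def by blast
    obtain a a' where "a \<in> ?A" "a \<in> h" "a' \<in> ?A" "a' \<in> h'" using h h' by blast
    then show False using corner_nested_rest[OF cor h(2,3,5) h'(2,3,5)] t h(1) h'(1) by blast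
  qed
  moreover have "?R \<noteq> {}" "finite ?R" using cor fin unfolding corner_def by auto
  moreover have "T \<subseteq> ?R \<and> T \<noteq> {}" if "T \<in> F" for T using that unfolding F_def by blast
  ultimately obtain e where e: "e \<in> ?R" "\<And>T. T \<in> F \<Longrightarrow> e \<in> T"
    using nested_common_element[of ?R F] by metis
  have "e \<in> h" if h: "h \<in> G" "c \<notin> h" "h \<inter> ?A \<noteq> {}" "h \<inter> ?R \<noteq> {}" for h
  proof (cases "h \<inter> ?B = {}")
    case True
    then have "h \<inter> ?R \<in> F" unfolding F_def using h by blast
    then show ?thesis using e by blast
  next
    case False
    then show ?thesis using corner_both[OF cor h(1,2) _ _ _ _ e(1)] h(3) by blast
  qed
  then show thesis using that e by blast
qed

text \<open>The point \<open>a\<close> can replace the side while the rest is being ordered. Members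
  containing the whole rest impose nothing on its order; excluding them excludes, by
  \<open>corner_both\<close>, those that meet both sides.\<close>

lemma corner_common_side:
  assumes cor: "corner c f g"
  obtains a where "a \<in> X - {c} - f"
    "\<And>h. \<lbrakk>h \<in> G; c \<notin> h; h \<inter> (X - {c} - f) \<noteq> {}; h \<inter> (X \<inter> f \<inter> g) \<noteq> {}; \<not> X \<inter> f \<inter> g \<subseteq> h\<rbrakk> \<Longrightarrow> a \<in> h"
proof -
  let ?A = "X - {c} - f" and ?B = "X - {c} - g" and ?R = "X \<inter> f \<inter> g"
  define F where "F = {h \<inter> ?A | h. h \<in> G \<and> c \<notin> h \<and> h \<inter> ?A \<noteq> {} \<and> h \<inter> ?B = {} \<and> h \<inter> ?R \<noteq> {}}"
  have "T \<subseteq> T' \<or> T' \<subseteq> T" if TT: "T \<in> F" "T' \<in> F" for T T'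
  proof (rule ccontr)
    assume "\<not> ?thesis"
    then obtain a a' where a: "a \<in> T" "a \<notin> T'" "a' \<in> T'" "a' \<notin> T" by blast
    obtain h where h: "T = h \<inter> ?A" "h \<in> G" "c \<notin> h" "h \<inter> ?R \<noteq> {}" "h \<inter> ?B = {}" using TT(1) unfolding F_def by blast
    obtain h' where h': "T' = h' \<inter> ?A" "h' \<in> G" "c \<notin> h'" "h' \<inter> ?R \<noteq> {}" "h' \<inter> ?B = {}" using TT(2) unfolding F_def by blast
    obtain t t' where "t \<in> ?R" "t \<in> h" "t' \<in> ?R" "t' \<in> h'" using h h' by blast
    then show False using corner_nested_side[OF cor h(2,3,5) h'(2,3,5)] a h(1) h'(1) by blast
  qed
  moreover have "?A \<noteq> {}" "finite ?A" using cor fin unfolding corner_def by auto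
  moreover have "T \<subseteq> ?A \<and> T \<noteq> {}" if "T \<in> F" for T using that unfolding F_def by blast
  ultimately obtain a where a: "a \<in> ?A" "\<And>T. T \<in> F \<Longrightarrow> a \<in> T"
    using nested_common_element[of ?A F] by metis
  have "a \<in> h" if h: "h \<in> G" "c \<notin> h" "h \<inter> ?A \<noteq> {}" "h \<inter> ?R \<noteq> {}" "\<not> ?R \<subseteq> h" for h
  proof -
    have "h \<inter> ?B = {}" using corner_both[OF cor h(1,2)] h(3,5) by blast
    then have "h \<inter> ?A \<in> F" unfolding F_def using h by blast
    then show ?thesis using a by blast
  qed
  then show thesis using that a by blast
qed


end

section \<open>Ordering and gluing the parts of a corner\<close>

context obstruction_free begin

text \<open>The side is ordered together with \<open>c\<close>, \<open>b\<close> and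
  \<open>e\<close> only. A second point \<open>r\<close> of the rest is left out, so minimality
  applies; and every member meeting both the side and the rest contains \<open>e\<close>, so
  \<open>side_order\<close> makes it a final segment.\<close>

lemma corner_side_order:
  assumes cor: "corner c f g"
  shows "\<exists>p. inj_on p (X - {c} - f) \<and> (\<forall>h\<in>G. c \<notin> h \<longrightarrow>
    (h \<inter> (X \<inter> f \<inter> g) \<noteq> {} \<longrightarrow> order_upper p (X - {c} - f) h) \<and> order_convex p (X - {c} - f) h)"
proof -
  let ?A = "X - {c} - f" and ?B = "X - {c} - g" and ?R = "X \<inter> f \<inter> g"
  note c = cor[unfolded corner_def]
  obtain e where e: "e \<in> ?R"
    "\<And>h. \<lbrakk>h \<in> G; c \<notin> h; h \<inter> ?A \<noteq> {}; h \<inter> ?R \<noteq> {}\<rbrakk> \<Longrightarrow> e \<in> h"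
    using corner_common_rest[OF cor] by metis
  obtain b where b: "b \<in> X" "b \<noteq> c" "b \<notin> g" "b \<in> f" using c by blast
  obtain r where r: "r \<in> ?R" "r \<noteq> e" using c by metis
  have sub: "insert c (insert b (insert e ?A)) \<subset> X"
  proof
    show "insert c (insert b (insert e ?A)) \<subseteq> X" using c b e(1) by auto
    have "r \<notin> insert c (insert b (insert e ?A))" using r b c by auto
    then show "insert c (insert b (insert e ?A)) \<noteq> X" using r by blast
  qed
  have "\<exists>p. inj_on p ?A \<and> (\<forall>h\<in>G. c \<notin> h \<longrightarrow> (e \<in> h \<longrightarrow> order_upper p ?A h) \<and> order_convex p ?A h)"
  proof (rule side_order)
    show "circular G (insert c (insert b (insert e ?A)))" using minimal sub by blast
    show "f \<in> G" "g \<in> G" using c by auto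
  qed (use c b e(1) fin in auto)
  then obtain p where p: "inj_on p ?A"
      "\<forall>h\<in>G. c \<notin> h \<longrightarrow> (e \<in> h \<longrightarrow> order_upper p ?A h) \<and> order_convex p ?A h" by (elim exE conjE)
  have "order_upper p ?A h" if h: "h \<in> G" "c \<notin> h" "h \<inter> ?R \<noteq> {}" for h
  proof (cases "h \<inter> ?A = {}")
    case True
    then show ?thesis unfolding order_upper_def by blast
  next
    case False
    then have "e \<in> h" using e(2)[OF h(1,2)] h(3) by blast
    then show ?thesis using p(2) h by simp
  qed
  then show ?thesis using p by (intro exI[of _ p]) simp
qed

text \<open>Both sides are reduced to their representatives \<open>a\<close> and \<open>b\<close>.
  Minimality applies only if a further point \<open>s\<close> of a side is left out, which is what
  \<open>big\<close> guarantees.\<close>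

lemma corner_middle_order:
  assumes cor: "corner c f g" and big: "\<not> (\<exists>a b. X - {c} - f = {a} \<and> X - {c} - g = {b})"
  shows "\<exists>p. inj_on p (X \<inter> f \<inter> g) \<and> (\<forall>h\<in>G. c \<notin> h \<longrightarrow>
    (h \<inter> (X - {c} - f) \<noteq> {} \<longrightarrow> order_upper (\<lambda>x. - p x) (X \<inter> f \<inter> g) h) \<and>
    (h \<inter> (X - {c} - g) \<noteq> {} \<longrightarrow> order_upper p (X \<inter> f \<inter> g) h) \<and> order_convex p (X \<inter> f \<inter> g) h)"
proof -
  let ?A = "X - {c} - f" and ?B = "X - {c} - g" and ?R = "X \<inter> f \<inter> g"
  note c = cor[unfolded corner_def]
  obtain a where a: "a \<in> ?A"
    "\<And>h. \<lbrakk>h \<in> G; c \<notin> h; h \<inter> ?A \<noteq> {}; h \<inter> ?R \<noteq> {}; \<not> ?R \<subseteq> h\<rbrakk> \<Longrightarrow> a \<in> h"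
    using corner_common_side[OF cor] by metis
  have Rsym: "X \<inter> g \<inter> f = ?R" by auto
  obtain b where b: "b \<in> ?B"
    "\<And>h. \<lbrakk>h \<in> G; c \<notin> h; h \<inter> ?B \<noteq> {}; h \<inter> ?R \<noteq> {}; \<not> ?R \<subseteq> h\<rbrakk> \<Longrightarrow> b \<in> h"
    using corner_common_side[OF corner_sym[OF cor]] unfolding Rsym by metis
  obtain s where s: "s \<in> X" "s \<noteq> c" "s \<noteq> a" "s \<noteq> b" "s \<notin> ?R"
  proof -
    have "?A \<noteq> {a} \<or> ?B \<noteq> {b}" using big by blast
    then obtain s where "s \<in> ?A \<and> s \<noteq> a \<or> s \<in> ?B \<and> s \<noteq> b" using a(1) b(1) by blast
    then show thesis using that[of s] a(1) b(1) c by auto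
  qed
  have sub: "insert c (insert a (insert b ?R)) \<subset> X" using s c a(1) b(1) by blast
  have "\<exists>p. inj_on p ?R \<and> (\<forall>h\<in>G. c \<notin> h \<longrightarrow>
      (a \<in> h \<longrightarrow> order_upper (\<lambda>x. - p x) ?R h) \<and> (b \<in> h \<longrightarrow> order_upper p ?R h) \<and> order_convex p ?R h)"
  proof (rule middle_order)
    show "circular G (insert c (insert a (insert b ?R)))" using minimal sub by blast
    show "f \<in> G" "g \<in> G" using c by auto
  qed (use c a(1) b(1) fin in auto)
  then obtain p where p: "inj_on p ?R"
      "\<forall>h\<in>G. c \<notin> h \<longrightarrow> (a \<in> h \<longrightarrow> order_upper (\<lambda>x. - p x) ?R h) \<and> (b \<in> h \<longrightarrow> order_upper p ?R h) \<and>
        order_convex p ?R h" by (elim exE conjE)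
  have trivial: "order_upper q ?R h" if "h \<inter> ?R = {} \<or> ?R \<subseteq> h" for q :: "'a \<Rightarrow> int" and h
    using that unfolding order_upper_def by blast
  have "order_upper (\<lambda>x. - p x) ?R h" if h: "h \<in> G" "c \<notin> h" "h \<inter> ?A \<noteq> {}" for h
    using trivial[of h "\<lambda>x. - p x"] a(2)[OF h] p(2)[rule_format, OF h(1,2)] by blast
  moreover have "order_upper p ?R h" if h: "h \<in> G" "c \<notin> h" "h \<inter> ?B \<noteq> {}" for h
    using trivial[of h p] b(2)[OF h] p(2)[rule_format, OF h(1,2)] by blast
  ultimately show ?thesis using p by (intro exI[of _ p]) simp
qed

text \<open>Otherwise the parts can be lined up as \<open>c\<close>, \<open>A\<close>,
  \<open>R\<close>, \<open>B\<close>, with \<open>B\<close> reversed so that both sides turn their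
  upper ends towards \<open>R\<close>. A member crossing between neighbouring parts is an end
  segment in each of them, and one that meets both sides contains \<open>R\<close>; so all members
  avoiding \<open>c\<close> are convex.\<close>

lemma corner_sides_singletons:
  assumes cor: "corner c f g"
  shows "\<exists>a b. X - {c} - f = {a} \<and> X - {c} - g = {b}"
proof (rule ccontr)
  assume big: "\<not> ?thesis"
  define A B R where "A = X - {c} - f" and "B = X - {c} - g" and "R = X \<inter> f \<inter> g"
  note c = cor[unfolded corner_def]
  obtain pA where pA: "inj_on pA A" "\<And>h. h \<in> G \<Longrightarrow> c \<notin> h \<Longrightarrow> h \<inter> R \<noteq> {} \<Longrightarrow> order_upper pA A h"
    "\<And>h. h \<in> G \<Longrightarrow> c \<notin> h \<Longrightarrow> order_convex pA A h"
    using corner_side_order[OF cor] unfolding A_def R_def by metis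
  have Rsym: "X \<inter> g \<inter> f = X \<inter> f \<inter> g" by auto
  obtain pB where pB: "inj_on pB B" "\<And>h. h \<in> G \<Longrightarrow> c \<notin> h \<Longrightarrow> h \<inter> R \<noteq> {} \<Longrightarrow> order_upper pB B h"
    "\<And>h. h \<in> G \<Longrightarrow> c \<notin> h \<Longrightarrow> order_convex pB B h"
    using corner_side_order[OF corner_sym[OF cor]] unfolding B_def R_def Rsym by metis
  obtain pR where pR: "inj_on pR R"
    "\<And>h. h \<in> G \<Longrightarrow> c \<notin> h \<Longrightarrow> h \<inter> A \<noteq> {} \<Longrightarrow> order_upper (\<lambda>x. - pR x) R h"
    "\<And>h. h \<in> G \<Longrightarrow> c \<notin> h \<Longrightarrow> h \<inter> B \<noteq> {} \<Longrightarrow> order_upper pR R h"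
    "\<And>h. h \<in> G \<Longrightarrow> c \<notin> h \<Longrightarrow> order_convex pR R h"
    using corner_middle_order[OF cor big] unfolding A_def B_def R_def by metis
  have both: "R \<subseteq> h" if "h \<in> G" "c \<notin> h" "x \<in> A" "x \<in> h" "y \<in> B" "y \<in> h" for h x y
    using corner_both[OF cor that(1,2)] that unfolding A_def B_def R_def by blast
  have part: "X = insert c (A \<union> R \<union> B)" "c \<notin> A" "c \<notin> B" "c \<notin> R" "A \<inter> R = {}" "A \<inter> B = {}" "B \<inter> R = {}" "R \<noteq> {}"
    using c unfolding A_def B_def R_def by auto
  obtain KA where KA: "KA > 0" "\<And>x. x \<in> X \<Longrightarrow> - KA < pA x \<and> pA x < KA" using finite_int_bound[OF fin] by metis
  obtain KB where KB: "KB > 0" "\<And>x. x \<in> X \<Longrightarrow> - KB < pB x \<and> pB x < KB" using finite_int_bound[OF fin] by metis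
  obtain KR where KR: "KR > 0" "\<And>x. x \<in> X \<Longrightarrow> - KR < pR x \<and> pR x < KR" using finite_int_bound[OF fin] by metis
  \<comment> \<open>\<open>A\<close> is shifted below \<open>- KR\<close>, \<open>B\<close> is
    reflected and moved above \<open>KR\<close>, and \<open>c\<close> is placed below
    everything.\<close>
  define q where "q u = (if u \<in> A then pA u - KA - KR else if u \<in> R then pR u else if u \<in> B then KR + KB - pB u
    else - 2 * KA - KR - 1)" for u
  have qA: "q u = pA u - KA - KR" "- 2 * KA - KR < q u" "q u < - KR" if "u \<in> A" for u
    using that KA(2)[of u] part unfolding q_def by auto
  have qR: "q u = pR u" "- KR < q u" "q u < KR" if "u \<in> R" for u
    using that KR(2)[of u] part unfolding q_def by auto
  have qB: "q u = KR + KB - pB u" "KR < q u" if "u \<in> B" for u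
    using that KB(2)[of u] part unfolding q_def by auto
  have qc: "q c = - 2 * KA - KR - 1" using part unfolding q_def by auto
  have loc: "u = c \<and> q u = - 2 * KA - KR - 1 \<or> u \<in> A \<and> - 2 * KA - KR < q u \<and> q u < - KR \<or>
      u \<in> R \<and> - KR < q u \<and> q u < KR \<or> u \<in> B \<and> KR < q u" if "u \<in> X" for u
    using that qA(2,3)[of u] qR(2,3)[of u] qB(2)[of u] qc part(1) by blast
  have "circ_order G X q"
  proof (rule circ_orderI_convex[OF compl])
    show "c \<in> X" using c by simp
    show "inj_on q X"
    proof (rule inj_onI)
      fix x y assume xy: "x \<in> X" "y \<in> X" "q x = q y"
      then consider "x \<in> A" "y \<in> A" | "x \<in> R" "y \<in> R" | "x \<in> B" "y \<in> B" | "x = c" "y = c"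
        using loc[OF xy(1)] loc[OF xy(2)] KA(1) KR(1) by (smt (verit))
      then show "x = y"
      proof cases
        case 1 then show ?thesis using xy qA(1) pA(1) by (simp add: inj_on_def)
      next
        case 2 then show ?thesis using xy qR(1) pR(1) by (simp add: inj_on_def)
      next
        case 3 then show ?thesis using xy qB(1) pB(1) by (simp add: inj_on_def)
      qed auto
    qed
    fix h x y z
    assume h: "h \<in> G" "c \<notin> h" and x: "x \<in> X" "x \<in> h" and y: "y \<in> X" "y \<in> h" and z: "z \<in> X" "q x < q z" "q z < q y"
    have ne: "x \<noteq> c" "y \<noteq> c" using x y h by auto
    consider "x \<in> A" "z \<in> A" "y \<in> A" | "x \<in> A" "z \<in> A" "y \<in> R" | "x \<in> A" "z \<in> A" "y \<in> B"
      | "x \<in> A" "z \<in> R" "y \<in> R" | "x \<in> A" "z \<in> R" "y \<in> B" | "x \<in> A" "z \<in> B" "y \<in> B"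
      | "x \<in> R" "z \<in> R" "y \<in> R" | "x \<in> R" "z \<in> R" "y \<in> B" | "x \<in> R" "z \<in> B" "y \<in> B"
      | "x \<in> B" "z \<in> B" "y \<in> B"
      using loc[OF x(1)] loc[OF y(1)] loc[OF z(1)] z(2,3) ne KA(1) KR(1) by (smt (verit))
    then show "z \<in> h"
    proof cases
      case 1 then show ?thesis using order_convexD[OF pA(3)[OF h], of x y z] x y z qA(1) by auto
    next
      case 2 then show ?thesis using order_upperD[OF pA(2)[OF h], of x z] x y z qA(1) by auto
    next
      case 3
      then have "R \<subseteq> h" using both h x y by blast
      then have "h \<inter> R \<noteq> {}" using part(8) by blast
      then show ?thesis using 3 order_upperD[OF pA(2)[OF h], of x z] x z qA(1) by auto
    next
      case 4
      then have "h \<inter> A \<noteq> {}" using x by blast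
      then show ?thesis using 4 order_upperD[OF pR(2)[OF h], of y z] y z qR(1) by auto
    next
      case 5 then show ?thesis using both h x y by blast
    next
      case 6
      then have "R \<subseteq> h" using both h x y by blast
      then have "h \<inter> R \<noteq> {}" using part(8) by blast
      then show ?thesis using 6 order_upperD[OF pB(2)[OF h], of y z] y z qB(1) by auto
    next
      case 7 then show ?thesis using order_convexD[OF pR(4)[OF h], of x y z] x y z qR(1) by auto
    next
      case 8
      then have "h \<inter> B \<noteq> {}" using y by blast
      then show ?thesis using 8 order_upperD[OF pR(3)[OF h], of x z] x z qR(1) by auto
    next
      case 9
      then have "h \<inter> R \<noteq> {}" using x by blast
      then show ?thesis using 9 order_upperD[OF pB(2)[OF h], of y z] y z qB(1) by auto
    next
      case 10 then show ?thesis using order_convexD[OF pB(3)[OF h], of y x z] x y z qB(1) by auto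
    qed
 qed
  then show False using nc unfolding circular_def by blast
qed


end

section \<open>The graph of pairs\<close>

context obstruction_free begin

text \<open>The trace is taken on all of \<open>X\<close>, so the pair remains exact on every
  smaller set containing it and a centre can be chosen afterwards.\<close>

definition edge :: "'a \<Rightarrow> 'a \<Rightarrow> bool" where
  "edge u v \<longleftrightarrow> u \<noteq> v \<and> u \<in> X \<and> v \<in> X \<and> (\<exists>h\<in>G. h \<inter> X = {u, v})"

text \<open>Each side of a corner at \<open>c\<close> is a single point, and the complement of the
  corresponding arc consists of that point and \<open>c\<close>.\<close>

lemma two_edges:
  assumes c: "c \<in> X"
  obtains a b where "a \<noteq> b" "edge c a" "edge c b"
proof -
  have "X - {c} \<subset> X" using c by blast
  then obtain p where p: "circ_order G (X - {c}) p" using minimal unfolding circular_def by blast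
  have "X - {c} \<noteq> {}"
  proof
    assume "X - {c} = {}"
    then have X: "X = {c}" using c by blast
    have "circ_order G X (\<lambda>_. 0)" by (rule circ_orderI) (auto simp: X)
    then show False using nc unfolding circular_def by blast
  qed
  have "\<exists>f g. corner c f g"
  proof (rule cycle_or_corner[of G X c p])
    fix ts assume "cyc_obs G c ts" "set ts \<subseteq> X"
    then show ?thesis using no_obs c by blast
  next
    fix f g x y
    assume "f \<in> G" "g \<in> G" "c \<notin> f" "c \<notin> g" "\<not> X - {c} \<subseteq> f" "\<not> X - {c} \<subseteq> g" "X - {c} \<subseteq> f \<union> g"
      "x \<in> X" "y \<in> X" "x \<noteq> y" "x \<in> f" "x \<in> g" "y \<in> f" "y \<in> g"
    then have "corner c f g" unfolding corner_def using c by blast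
    then show ?thesis by blast
  qed (use compl fin c nc p \<open>X - {c} \<noteq> {}\<close> in auto)
  then obtain f g where cor: "corner c f g" by blast
  note cr = cor[unfolded corner_def]
  obtain a b where ab: "X - {c} - f = {a}" "X - {c} - g = {b}" using corner_sides_singletons[OF cor] by blast
  have "(- f) \<inter> X = {c, a}" "(- g) \<inter> X = {c, b}" using ab cr by auto
  moreover have "a \<noteq> b" using ab cr by blast
  moreover have "a \<in> X" "b \<in> X" "a \<noteq> c" "b \<noteq> c" using ab by auto
  moreover have "- f \<in> G" "- g \<in> G" using compl cr by auto
  ultimately have "edge c a" "edge c b" unfolding edge_def using c by auto
  then show thesis using that \<open>a \<noteq> b\<close> by blast
qed

text \<open>All neighbours of the first vertex of a longest path lie on the path. One of two
  neighbours is at distance at least two along the path and closes a cycle.\<close>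

lemma edge_cycle:
  obtains ts where "distinct ts" "3 \<le> length ts" "set ts \<subseteq> X"
    "\<And>i. i < length ts \<Longrightarrow> edge (ts ! i) (ts ! (Suc i mod length ts))"
proof -
  define P where "P n \<longleftrightarrow> (\<exists>vs. distinct vs \<and> set vs \<subseteq> X \<and> length vs = n \<and>
    (\<forall>i. Suc i < n \<longrightarrow> edge (vs ! i) (vs ! Suc i)))" for n
  have "X \<noteq> {}"
  proof
    assume "X = {}"
    then have "circ_order G X (\<lambda>_. 0)" by (intro circ_orderI) auto
    then show False using nc unfolding circular_def by blast
  qed
  then obtain x where "x \<in> X" by blast
  then have P1: "P 1" unfolding P_def by (intro exI[of _ "[x]"]) auto
  have bound: "n \<le> card X" if "P n" for n
    using that fin unfolding P_def by (metis card_mono distinct_card)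
  define n where "n = (GREATEST n. P n)"
  have "P n" "\<And>m. P m \<Longrightarrow> m \<le> n"
    unfolding n_def using GreatestI_nat[of P, OF P1] Greatest_le_nat[of P] bound by metis+
  then obtain vs where vs: "distinct vs" "set vs \<subseteq> X" "length vs = n"
      "\<And>i. Suc i < n \<Longrightarrow> edge (vs ! i) (vs ! Suc i)"
    unfolding P_def by blast
  have n1: "1 \<le> n" using \<open>\<And>m. P m \<Longrightarrow> m \<le> n\<close> P1 by blast
  have hd: "vs ! 0 \<in> X" using vs n1 by (metis One_nat_def Suc_le_lessD nth_mem subsetD)
  have nbr: "a \<in> set vs" if "edge (vs ! 0) a" for a
  proof (rule ccontr)
    assume "a \<notin> set vs"
    have sym: "edge a (vs ! 0)" using that unfolding edge_def by (metis insert_commute)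
    have "edge ((a # vs) ! i) ((a # vs) ! Suc i)" if "Suc i < Suc n" for i
      using vs(4)[of "i - 1"] sym that by (cases i) auto
    then have "P (Suc n)" unfolding P_def
      using vs \<open>a \<notin> set vs\<close> sym by (intro exI[of _ "a # vs"]) (auto simp: edge_def)
    then show False using \<open>\<And>m. P m \<Longrightarrow> m \<le> n\<close> by fastforce
  qed
  obtain a b where ab: "a \<noteq> b" "edge (vs ! 0) a" "edge (vs ! 0) b" using two_edges[OF hd] by metis
  obtain i j where ij: "i < n" "vs ! i = a" "j < n" "vs ! j = b" using nbr ab vs by (metis in_set_conv_nth)
  have "i \<noteq> 0" "j \<noteq> 0" using ab(2,3) ij unfolding edge_def by metis+
  moreover have "i \<noteq> j" using ab ij by blast
  ultimately have "2 \<le> i \<or> 2 \<le> j" by linarith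
  then obtain k where k: "2 \<le> k" "k < n" "edge (vs ! 0) (vs ! k)"
    using ab ij by blast
  define ts where "ts = take (Suc k) vs"
  have len: "length ts = Suc k" unfolding ts_def using k vs by simp
  show thesis
  proof (rule that[of ts])
    show "distinct ts" "set ts \<subseteq> X" unfolding ts_def using vs by (auto dest: in_set_takeD)
    show "3 \<le> length ts" using len k by simp
    fix i assume i: "i < length ts"
    show "edge (ts ! i) (ts ! (Suc i mod length ts))"
    proof (cases "i = k")
      case True
      have "edge (vs ! k) (vs ! 0)" using k(3) unfolding edge_def by (metis insert_commute)
      then show ?thesis using True len unfolding ts_def by simp
    next
      case False
      then show ?thesis using vs(4)[of i] i len k unfolding ts_def by simp
    qed
  qed
qed

text \<open>A column off the cycle is a centre for it. If the cycle exhausts \<open>X\<close>, its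
  own order is not circular either, so some member \<open>g\<close> avoiding the first vertex has a
  hole. The two vertices of \<open>g\<close> bordering the hole form a pair that closes the path
  across the hole, and the first vertex is a centre of this cycle.\<close>

lemma no_obstruction_free: False
proof -
  obtain ts where ts: "distinct ts" "3 \<le> length ts" "set ts \<subseteq> X"
    and e: "\<And>i. i < length ts \<Longrightarrow> edge (ts ! i) (ts ! (Suc i mod length ts))"
    using edge_cycle by metis
  let ?n = "length ts"
  show False
  proof (cases "set ts = X")
    case False
    then obtain w where w: "w \<in> X" "w \<notin> set ts" using ts by blast
    have "cyc_obs G w ts" unfolding cyc_obs_def
    proof (intro conjI allI impI)
      fix i assume i: "i < ?n"
      obtain h where h: "h \<in> G" "h \<inter> X = {ts ! i, ts ! (Suc i mod ?n)}" using e[OF i] unfolding edge_def by blast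
      have "Suc i mod ?n < ?n" by (rule mod_less_divisor) (use i in linarith)
      then have "{ts ! i, ts ! (Suc i mod ?n)} \<subseteq> insert w (set ts)" using i by auto
      then have "h \<inter> insert w (set ts) = {ts ! i, ts ! (Suc i mod ?n)}" using h w ts by blast
      then show "\<exists>g\<in>G. g \<inter> insert w (set ts) = {ts ! i, ts ! (Suc i mod ?n)}" using h by blast
    qed (use ts w in auto)
    then show False using no_obs w ts by blast
  next
    case True
    define q where "q u = int (THE i. i < ?n \<and> ts ! i = u)" for u
    have q: "q (ts ! i) = int i" if "i < ?n" for i
    proof -
      have "(THE j. j < ?n \<and> ts ! j = ts ! i) = i" using that ts(1) by (auto simp: nth_eq_iff_index_eq)
      then show ?thesis unfolding q_def by simp
    qed
    have inj: "inj_on q X"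
    proof (rule inj_onI)
      fix x y assume "x \<in> X" "y \<in> X" "q x = q y"
      then show "x = y" using q unfolding True[symmetric] by (metis in_set_conv_nth of_nat_eq_iff)
    qed
    have "0 < ?n" using ts(2) by linarith
    then have c: "ts ! 0 \<in> X" using ts(3) nth_mem[of 0 ts] by blast
    have "\<not> circ_order G X q" using nc unfolding circular_def by blast
    then obtain g x y z where g: "g \<in> G" "ts ! 0 \<notin> g" and
      xyz: "x \<in> X" "x \<in> g" "y \<in> X" "y \<in> g" "z \<in> X" "q x < q z" "q z < q y" "z \<notin> g"
      using circ_orderI_convex[OF compl inj c] by blast
    obtain ix l jy where il: "ix < ?n" "l < ?n" "jy < ?n" "ts ! ix = x" "ts ! l = z" "ts ! jy = y"
      using xyz unfolding True[symmetric] by (metis in_set_conv_nth)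
    then have lt: "ix < l" "l < jy" using xyz q by auto
    \<comment> \<open>The vertices of \<open>g\<close> nearest to the hole \<open>l\<close> on both
      sides. As \<open>ts ! 0\<close> is not in \<open>g\<close>, it is not on the path between
      them.\<close>
    define i where "i = Max {i. i < l \<and> ts ! i \<in> g}"
    define j where "j = (LEAST j. l < j \<and> ts ! j \<in> g)"
    have "finite {i. i < l \<and> ts ! i \<in> g}" "ix \<in> {i. i < l \<and> ts ! i \<in> g}" using il lt xyz by auto
    then have "i \<in> {i. i < l \<and> ts ! i \<in> g}" and ge: "\<And>m. m < l \<Longrightarrow> ts ! m \<in> g \<Longrightarrow> m \<le> i"
      unfolding i_def using Max_in[of "{i. i < l \<and> ts ! i \<in> g}"] Max_ge[of "{i. i < l \<and> ts ! i \<in> g}"]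
      by blast+
    then have i: "i < l" "ts ! i \<in> g" "\<And>m. i < m \<Longrightarrow> m < l \<Longrightarrow> ts ! m \<notin> g"
      using leD by blast+
    have jy: "l < jy \<and> ts ! jy \<in> g" using lt il xyz by auto
    have j: "l < j" "ts ! j \<in> g" "j \<le> jy"
      using LeastI[of "\<lambda>j. l < j \<and> ts ! j \<in> g", OF jy] Least_le[of "\<lambda>j. l < j \<and> ts ! j \<in> g", OF jy]
      unfolding j_def by simp_all
    have j': "ts ! m \<notin> g" if "l < m" "m < j" for m
      using not_less_Least[of m "\<lambda>j. l < j \<and> ts ! j \<in> g"] that unfolding j_def by simp
    have jn: "j < ?n" using j(3) il by simp
    have i0: "0 < i" using i(2) g(2) by (cases i) auto
    have gap: "ts ! m \<notin> g" if "i < m" "m < j" for m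
    proof -
      consider "m < l" | "m = l" | "l < m" by linarith
      then show ?thesis by cases (use i(3) j' that il(5) xyz(8) in auto)
    qed
    define us where "us = map ((!) ts) [i..<Suc j]"
    have len: "length us = Suc j - i" unfolding us_def by (simp del: upt_Suc)
    have us: "us ! m = ts ! (i + m)" if "m < Suc j - i" for m unfolding us_def using that by (simp del: upt_Suc)
    have sus: "u \<in> set us \<longleftrightarrow> (\<exists>m. i \<le> m \<and> m \<le> j \<and> u = ts ! m)" for u unfolding us_def by (auto simp del: upt_Suc)
    have usX: "set us \<subseteq> X" using sus jn unfolding True[symmetric] by auto
    have c_us: "ts ! 0 \<notin> set us"
    proof
      assume "ts ! 0 \<in> set us"
      then obtain m where "i \<le> m" "m \<le> j" "ts ! 0 = ts ! m" using sus by blast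
      moreover have "0 < ?n" using jn by linarith
      ultimately show False using i0 jn ts(1) nth_eq_iff_index_eq[of ts 0 m] by linarith
    qed
    have "cyc_obs G (ts ! 0) us" unfolding cyc_obs_def
    proof (intro conjI allI impI)
      show "distinct us" unfolding us_def distinct_map inj_on_def
        using ts(1) jn by (auto simp: nth_eq_iff_index_eq simp del: upt_Suc)
      show "3 \<le> length us" using len i j by simp
      fix m assume m: "m < length us"
      show "\<exists>h\<in>G. h \<inter> insert (ts ! 0) (set us) = {us ! m, us ! (Suc m mod length us)}"
      proof (cases "m = j - i")
        case True
        have e: "us ! m = ts ! j" "us ! (Suc m mod length us) = ts ! i" using True us len i j by (auto simp: Suc_diff_le)
        have "g \<inter> insert (ts ! 0) (set us) = {ts ! j, ts ! i}"
        proof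
          show "g \<inter> insert (ts ! 0) (set us) \<subseteq> {ts ! j, ts ! i}"
            using g(2) gap sus by (auto simp: order_le_less)
          show "{ts ! j, ts ! i} \<subseteq> g \<inter> insert (ts ! 0) (set us)"
          proof -
            have "i \<le> j" using i(1) j(1) by simp
            then have "ts ! i \<in> set us" "ts ! j \<in> set us" unfolding sus by blast+
            then show ?thesis using i(2) j(2) by blast
          qed
        qed
        then show ?thesis using g e by metis
      next
        case False
        then have ml: "Suc m < Suc j - i" using m len by auto
        have im: "i + m < ?n" "Suc (i + m) < ?n" using ml jn by auto
        obtain h where h: "h \<in> G" "h \<inter> X = {ts ! (i + m), ts ! Suc (i + m)}"
          using e[OF im(1)] im(2) unfolding edge_def by auto
        have "us ! m = ts ! (i + m)" "us ! (Suc m mod length us) = ts ! Suc (i + m)" using us ml m len by auto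
        moreover have "ts ! (i + m) \<in> set us" unfolding sus by (intro exI[of _ "i + m"]) (use ml in simp)
        moreover have "ts ! Suc (i + m) \<in> set us" unfolding sus by (intro exI[of _ "Suc (i + m)"]) (use ml in simp)
        ultimately have "us ! m = ts ! (i + m)" "us ! (Suc m mod length us) = ts ! Suc (i + m)"
          "h \<inter> insert (ts ! 0) (set us) = {ts ! (i + m), ts ! Suc (i + m)}" using h usX c by blast+
        then show ?thesis using h by metis
      qed
    qed (fact c_us)
    then show False using no_obs c usX by blast
  qed
qed

end

text \<open>A cyclic obstruction inside \<open>X\<close> exhausts \<open>X\<close> by minimality,
  hence the equation in the first case. In the second an inclusion suffices, because families coming
  from rows rule it out altogether.\<close>

theorem (in minimal_noncircular) minimal_obstruction:
  obtains c ts where "cyc_obs G c ts" "X = insert c (set ts)"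
  | x1 y1 x2 y2 x3 y3 where "matching_obs G x1 y1 x2 y2 x3 y3" "{x1, y1, x2, y2, x3, y3} \<subseteq> X"
proof (rule ccontr)
  assume *: "\<not> thesis"
  interpret obstruction_free G X
  proof
    fix w ts assume o: "cyc_obs G w ts"
    show "\<not> insert w (set ts) \<subseteq> X"
    proof
      assume "insert w (set ts) \<subseteq> X"
      then have "X = insert w (set ts)" using cyc_obs_not_circular[OF o] minimal[of "insert w (set ts)"] by blast
      then show False using that(1)[OF o] * by blast
    qed
  qed (use that(2) * in blast)
  show False by (rule no_obstruction_free)
qed

section \<open>Matrices and their rows\<close>

definition two_sided :: "'a set set \<Rightarrow> 'a set set" where
  "two_sided F = F \<union> uminus ` F"

lemma two_sided_compl: "g \<in> two_sided F \<Longrightarrow> - g \<in> two_sided F"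
  unfolding two_sided_def by auto

lemma circ_order_two_sided: "circ_order (two_sided F) S p \<longleftrightarrow> circ_order F S p"
proof
  assume "circ_order (two_sided F) S p"
  then show "circ_order F S p" unfolding circ_order_def two_sided_def by blast
next
  assume p: "circ_order F S p"
  show "circ_order (two_sided F) S p"
  proof (rule circ_orderI[OF circ_order_inj[OF p]])
    fix g x y z w
    assume g: "g \<in> two_sided F" and *: "x \<in> S" "x \<in> g" "y \<in> S" "y \<in> g" "z \<in> S" "z \<notin> g" "w \<in> S" "w \<notin> g"
    show "cyc p x z y = cyc p x w y"
    proof (cases "g \<in> F")
      case True
      then show ?thesis using circ_orderD[OF p True] * by blast
    next
      case False
      then have "- g \<in> F" using g unfolding two_sided_def by auto
      \<comment> \<open>Not being separated is a symmetric relation between the inner points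
        \<open>x\<close>, \<open>y\<close> and the outer points \<open>z\<close>,
        \<open>w\<close>.\<close>
      then have eq: "cyc p z x w = cyc p z y w" by (rule circ_orderD[OF p]) (use * in auto)
      have "p x \<noteq> p z" "p x \<noteq> p w" "p y \<noteq> p z" "p y \<noteq> p w"
        using circ_order_inj[OF p] * by (auto dest: inj_onD)
      then show ?thesis using eq unfolding cyc_def by (smt (verit))
    qed
  qed
qed

text \<open>Serves two purposes: passing to a configuration, with \<open>c\<close> the choice of
  columns, and complementing a matrix, with \<open>c\<close> the identity.\<close>

lemma circular_pullback:
  assumes "circular G S" "inj_on c T" "c ` T \<subseteq> S"
    and "\<And>h. h \<in> H \<Longrightarrow> \<exists>g\<in>G. \<forall>j\<in>T. j \<in> h \<longleftrightarrow> c j \<in> g"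
  shows "circular H T"
proof -
  obtain p where p: "circ_order G S p" using assms(1) unfolding circular_def by blast
  have "circ_order H T (p \<circ> c)"
  proof (rule circ_orderI)
    show "inj_on (p \<circ> c) T"
      using circ_order_inj[OF p] assms(2,3) by (meson comp_inj_on inj_on_subset)
    fix h x y z w
    assume h: "h \<in> H" and *: "x \<in> T" "x \<in> h" "y \<in> T" "y \<in> h" "z \<in> T" "z \<notin> h" "w \<in> T" "w \<notin> h"
    obtain g where g: "g \<in> G" "\<forall>j\<in>T. j \<in> h \<longleftrightarrow> c j \<in> g" using assms(4)[OF h] by blast
    have "cyc p (c x) (c z) (c y) = cyc p (c x) (c w) (c y)"
      by (rule circ_orderD[OF p g(1)]) (use * g(2) assms(3) in auto)
    then show "cyc (p \<circ> c) x z y = cyc (p \<circ> c) x w y" unfolding cyc_def by simp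
  qed
  then show ?thesis unfolding circular_def by blast
qed

text \<open>Links intervals given by end points to the separation form of arcs. In the converse
  direction, a nonempty set without a hole between its extremes is the interval between them; with a
  hole, the entire complement lies between the extremes and \<open>S\<close> wraps around
  it.\<close>

lemma circular_interval_iff:
  assumes X: "finite X" and inj: "inj_on p X" and R: "\<And>x y. x \<in> X \<Longrightarrow> y \<in> X \<Longrightarrow> (x, y) \<in> R \<longleftrightarrow> (p x :: int) \<le> p y"
    and S: "S \<subseteq> X"
  shows "circular_interval X R S \<longleftrightarrow>
    (\<forall>x\<in>S. \<forall>y\<in>S. \<forall>z\<in>X - S. \<forall>w\<in>X - S. cyc p x z y = cyc p x w y)"
proof
  assume ci: "circular_interval X R S"
  show "\<forall>x\<in>S. \<forall>y\<in>S. \<forall>z\<in>X - S. \<forall>w\<in>X - S. cyc p x z y = cyc p x w y"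
  proof (cases "S = {}")
    case False
    then obtain a b where ab: "a \<in> X" "b \<in> X" "S = circ_between X R a b"
      using ci unfolding circular_interval_def by blast
    have mem: "x \<in> S \<longleftrightarrow> (if p a \<le> p b then p a \<le> p x \<and> p x \<le> p b else p x \<le> p b \<or> p a \<le> p x)" if "x \<in> X" for x
      unfolding ab(3) circ_between_def using R ab(1,2) that by auto
    show ?thesis
    proof (intro ballI)
      fix x y z w assume *: "x \<in> S" "y \<in> S" "z \<in> X - S" "w \<in> X - S"
      then have "x \<in> X" "y \<in> X" "z \<in> X" "w \<in> X" using S by auto
      note mem[OF this(1)] mem[OF this(2)] mem[OF this(3)] mem[OF this(4)]
      then show "cyc p x z y = cyc p x w y" using * unfolding cyc_def by (smt (verit) DiffD2)
    qed
  qed simp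
next
  assume nc: "\<forall>x\<in>S. \<forall>y\<in>S. \<forall>z\<in>X - S. \<forall>w\<in>X - S. cyc p x z y = cyc p x w y"
  have fS: "finite S" using X S finite_subset by blast
  show "circular_interval X R S"
  proof (cases "S = {}")
    case True
    then show ?thesis unfolding circular_interval_def by simp
  next
    case ne: False
    have extremes: "\<exists>a\<in>T. \<exists>b\<in>T. \<forall>x\<in>T. p a \<le> p x \<and> p x \<le> p b" if "finite T" "T \<noteq> {}" for T
    proof -
      have "finite (p ` T)" "p ` T \<noteq> {}" using that by auto
      then obtain a b where "a \<in> T" "p a = Min (p ` T)" "b \<in> T" "p b = Max (p ` T)"
        by (metis (no_types, lifting) Min_in Max_in imageE)
      then show ?thesis using \<open>finite (p ` T)\<close> by (metis Min_le Max_ge imageI)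
    qed
    obtain a b where ab: "a \<in> S" "b \<in> S" "\<And>x. x \<in> S \<Longrightarrow> p a \<le> p x \<and> p x \<le> p b" using extremes[OF fS ne] by metis
    show ?thesis
    proof (cases "\<exists>z\<in>X - S. p a < p z \<and> p z < p b")
      case False
      have "S = circ_between X R a b"
      proof
        show "S \<subseteq> circ_between X R a b" using ab R S unfolding circ_between_def by (auto simp: subset_iff)
        show "circ_between X R a b \<subseteq> S"
        proof
          fix x assume x: "x \<in> circ_between X R a b"
          have "(a, b) \<in> R" using R ab S by (meson subsetD)
          then have "x \<in> X" "p a \<le> p x" "p x \<le> p b" using x R ab(1,2) S unfolding circ_between_def by auto
          then have "x = a \<or> x = b \<or> p a < p x \<and> p x < p b"
            using inj ab(1,2) S by (metis inj_onD order_le_less subsetD)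
          then show "x \<in> S" using False ab(1,2) \<open>x \<in> X\<close> by blast
        qed
      qed
      then show ?thesis using ab S unfolding circular_interval_def by blast
    next
      case True
      then obtain z where z: "z \<in> X - S" "p a < p z" "p z < p b" by blast
      have btw: "p a < p w \<and> p w < p b" if "w \<in> X - S" for w
      proof -
        have "cyc p a z b" using z unfolding cyc_def by simp
        then have "cyc p a w b" using nc ab(1,2) z(1) that by blast
        then show ?thesis using z unfolding cyc_def by auto
      qed
      obtain u v where uv: "u \<in> X - S" "v \<in> X - S" "\<And>w. w \<in> X - S \<Longrightarrow> p u \<le> p w \<and> p w \<le> p v"
        using extremes[of "X - S"] X z(1) by blast
      \<comment> \<open>The complement extends from \<open>u\<close> to \<open>v\<close>; the
        wrapping interval begins at \<open>r\<close>, the first point of \<open>S\<close> above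
        \<open>v\<close>, and ends at \<open>l\<close>, the last one below \<open>u\<close>.\<close>
      let ?L = "{x \<in> S. p x < p u}" and ?U = "{x \<in> S. p v < p x}"
      have "a \<in> ?L" "b \<in> ?U" using ab btw uv by auto
      then obtain l where l: "l \<in> ?L" "\<And>x. x \<in> ?L \<Longrightarrow> p x \<le> p l"
        using extremes[of ?L] fS by (metis (no_types, lifting) empty_iff finite_subset mem_Collect_eq subsetI)
      obtain r where r: "r \<in> ?U" "\<And>x. x \<in> ?U \<Longrightarrow> p r \<le> p x"
        using extremes[of ?U] fS \<open>b \<in> ?U\<close> by (metis (no_types, lifting) empty_iff finite_subset mem_Collect_eq subsetI)
      have "p l < p r" using l(1) r(1) uv(3)[OF uv(1)] by auto
      have out: "p x < p u \<or> p v < p x" if "x \<in> S" for x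
      proof (rule ccontr)
        assume "\<not> ?thesis"
        moreover have "p x \<noteq> p u" "p x \<noteq> p v" using inj that uv S by (auto dest: inj_onD)
        ultimately have x: "p u < p x" "p x < p v" by auto
        have "cyc p x v b = cyc p x u b" using nc that ab(2) uv by blast
        then show False using x btw[OF uv(1)] btw[OF uv(2)] unfolding cyc_def by auto
      qed
      have "S = circ_between X R r l"
      proof
        have "(r, l) \<notin> R" using R l(1) r(1) S \<open>p l < p r\<close> by (metis (no_types, lifting) leD mem_Collect_eq subsetD)
        then have cb: "circ_between X R r l = {x \<in> X. (x, l) \<in> R \<or> (r, x) \<in> R}" unfolding circ_between_def by simp
        have lr: "l \<in> X" "r \<in> X" using l r S by auto
        show "S \<subseteq> circ_between X R r l"
        proof
          fix x assume "x \<in> S"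
          then show "x \<in> circ_between X R r l" unfolding cb using out[of x] l(2)[of x] r(2)[of x] R lr S by auto
        qed
        show "circ_between X R r l \<subseteq> S"
        proof
          fix x assume "x \<in> circ_between X R r l"
          then have x: "x \<in> X" "p x \<le> p l \<or> p r \<le> p x" unfolding cb using R lr by auto
          show "x \<in> S"
          proof (rule ccontr)
            assume "x \<notin> S"
            then have "p u \<le> p x" "p x \<le> p v" using uv(3) x by auto
            then show False using x l(1) r(1) by auto
          qed
        qed
      qed
      then show ?thesis using l r S unfolding circular_interval_def by blast
    qed
  qed
qed

lemma linear_order_iff_circular:
  assumes X: "finite X" and F: "\<And>S. S \<in> F \<Longrightarrow> S \<subseteq> X"
  shows "(\<exists>R. linear_order_on X R \<and> (\<forall>S\<in>F. circular_interval X R S)) \<longleftrightarrow> circular (two_sided F) X"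
proof
  assume "\<exists>R. linear_order_on X R \<and> (\<forall>S\<in>F. circular_interval X R S)"
  then obtain R where lin: "linear_order_on X R" and ci: "\<forall>S\<in>F. circular_interval X R S" by blast
  \<comment> \<open>Counting predecessors turns the order into injective integer positions.\<close>
  define p where "p x = int (card {y \<in> X. (y, x) \<in> R})" for x
  have tr: "(x, z) \<in> R" if "(x, y) \<in> R" "(y, z) \<in> R" for x y z
    using lin that unfolding order_on_defs trans_def by blast
  have anti: "x = y" if "(x, y) \<in> R" "(y, x) \<in> R" for x y
    using lin that unfolding order_on_defs antisym_def by blast
  have "refl_on X R" "total_on X R" using lin unfolding order_on_defs by auto
  then have refl: "(x, x) \<in> R" if "x \<in> X" for x using that by (simp add: refl_onD)
  have tot: "(x, y) \<in> R \<or> (y, x) \<in> R" if "x \<in> X" "y \<in> X" for x y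
    using \<open>total_on X R\<close> that refl unfolding total_on_def by (cases "x = y") auto
  have R: "(x, y) \<in> R \<longleftrightarrow> p x \<le> p y" if xy: "x \<in> X" "y \<in> X" for x y
  proof
    assume "(x, y) \<in> R"
    then have "{u \<in> X. (u, x) \<in> R} \<subseteq> {u \<in> X. (u, y) \<in> R}" using tr by blast
    then show "p x \<le> p y" unfolding p_def using X by (simp add: card_mono)
  next
    assume le: "p x \<le> p y"
    show "(x, y) \<in> R"
    proof (rule ccontr)
      assume n: "(x, y) \<notin> R"
      then have "(y, x) \<in> R" using tot xy by blast
      then have "{u \<in> X. (u, y) \<in> R} \<subset> {u \<in> X. (u, x) \<in> R}" using tr refl xy n by blast
      then have "p y < p x" unfolding p_def using X by (simp add: psubset_card_mono)
      then show False using le by simp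
    qed
  qed
  have inj: "inj_on p X" using R anti by (metis inj_onI order_refl)
  have "circ_order F X p"
  proof (rule circ_orderI[OF inj])
    fix S x y z w
    assume S: "S \<in> F" and *: "x \<in> X" "x \<in> S" "y \<in> X" "y \<in> S" "z \<in> X" "z \<notin> S" "w \<in> X" "w \<notin> S"
    have "\<forall>x\<in>S. \<forall>y\<in>S. \<forall>z\<in>X - S. \<forall>w\<in>X - S. cyc p x z y = cyc p x w y"
      using circular_interval_iff[OF X inj R F[OF S]] ci S by blast
    then show "cyc p x z y = cyc p x w y" using * by blast
  qed
  then show "circular (two_sided F) X" unfolding circular_def circ_order_two_sided by blast
next
  assume "circular (two_sided F) X"
  then obtain p where p: "circ_order F X p" unfolding circular_def circ_order_two_sided by blast
  define R where "R = {(x, y). x \<in> X \<and> y \<in> X \<and> p x \<le> p y}"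
  have inj: "inj_on p X" by (rule circ_order_inj[OF p])
  have "linear_order_on X R"
    unfolding order_on_defs refl_on_def trans_def antisym_def total_on_def R_def
    using inj by (auto dest: inj_onD)
  moreover have "circular_interval X R S" if "S \<in> F" for S
  proof -
    have R: "(x, y) \<in> R \<longleftrightarrow> p x \<le> p y" if "x \<in> X" "y \<in> X" for x y using that unfolding R_def by auto
    have "\<forall>x\<in>S. \<forall>y\<in>S. \<forall>z\<in>X - S. \<forall>w\<in>X - S. cyc p x z y = cyc p x w y"
      using circ_orderD[OF p that] F[OF that] by blast
    then show ?thesis using circular_interval_iff[OF X inj R F[OF that]] by blast
  qed
  ultimately show "\<exists>R. linear_order_on X R \<and> (\<forall>S\<in>F. circular_interval X R S)" by blast
qed

section \<open>Families of sets attached to a matrix, and configurations\<close>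

definition row_family :: "bool mat \<Rightarrow> nat set set" where
  "row_family M = row_set M ` {..<dim_row M}"

definition D_family :: "bool mat \<Rightarrow> nat set set" where
  "D_family M = row_family M \<union> {s - r | r s. r \<in> row_family M \<and> s \<in> row_family M}"

abbreviation D_sets :: "bool mat \<Rightarrow> nat set set" where
  "D_sets M \<equiv> two_sided (D_family M)"

lemma row_in_D_family: "r \<in> row_family M \<Longrightarrow> r \<in> D_family M"
  unfolding D_family_def by simp

lemma diff_in_D_family: "r \<in> row_family M \<Longrightarrow> s \<in> row_family M \<Longrightarrow> s - r \<in> D_family M"
  unfolding D_family_def by (rule UnI2, rule CollectI, rule exI[of _ r], rule exI[of _ s]) simp

lemma D_family_cases:
  assumes "g \<in> D_family M"
  obtains "g \<in> row_family M" | r s where "r \<in> row_family M" "s \<in> row_family M" "g = s - r"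
  using assms unfolding D_family_def by (elim UnE CollectE exE conjE)

lemma row_family_subset: "S \<in> row_family M \<Longrightarrow> S \<subseteq> {..<dim_col M}"
  unfolding row_family_def row_set_def by auto

lemma D_family_subset: "S \<in> D_family M \<Longrightarrow> S \<subseteq> {..<dim_col M}"
  unfolding D_family_def using row_family_subset by blast

lemma circular_ones_iff: "circular_ones_property M \<longleftrightarrow> circular (two_sided (row_family M)) {..<dim_col M}"
proof -
  have "(\<forall>i<dim_row M. circular_interval {..<dim_col M} R (row_set M i)) \<longleftrightarrow>
      (\<forall>S\<in>row_family M. circular_interval {..<dim_col M} R S)" for R
    unfolding row_family_def by blast
  then show ?thesis unfolding circular_ones_property_def
    using linear_order_iff_circular[of "{..<dim_col M}" "row_family M"] row_family_subset[of _ M] by simp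
qed

lemma D_circular_iff: "D_circular_property M \<longleftrightarrow> circular (D_sets M) {..<dim_col M}"
proof -
  have "(\<forall>i<dim_row M. circular_interval {..<dim_col M} R (row_set M i)) \<and>
      (\<forall>i<dim_row M. \<forall>j<dim_row M. circular_interval {..<dim_col M} R (row_set M j - row_set M i)) \<longleftrightarrow>
      (\<forall>S\<in>D_family M. circular_interval {..<dim_col M} R S)" for R
    unfolding D_family_def row_family_def by blast
  then show ?thesis unfolding D_circular_property_def
    using linear_order_iff_circular[of "{..<dim_col M}" "D_family M"] D_family_subset[of _ M] by simp
qed

text \<open>Trades submatrices and permutations for injective choices of rows and columns. An index
  set is enumerated increasingly by \<open>pick\<close>; conversely, an injection is this
  enumeration of its image, preceded by the permutation that sends an index to the rank of its
  value.\<close>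

lemma contains_configuration_iff:
  "contains_configuration M N \<longleftrightarrow> (\<exists>r c. inj_on r {..<dim_row N} \<and> r ` {..<dim_row N} \<subseteq> {..<dim_row M} \<and>
     inj_on c {..<dim_col N} \<and> c ` {..<dim_col N} \<subseteq> {..<dim_col M} \<and>
     (\<forall>i<dim_row N. \<forall>j<dim_col N. N $$ (i, j) = M $$ (r i, c j)))"
proof
  assume "contains_configuration M N"
  then obtain I J p q where p: "p permutes {..<dim_row (submatrix M I J)}" and q: "q permutes {..<dim_col (submatrix M I J)}"
    and N: "N = mat (dim_row (submatrix M I J)) (dim_col (submatrix M I J)) (\<lambda>(i, j). submatrix M I J $$ (p i, q j))"
    unfolding contains_configuration_def equal_up_to_permutations_def by blast
  have pick: "inj_on (pick K \<circ> f) {..<card {i. i < n \<and> i \<in> K}} \<and> (pick K \<circ> f) ` {..<card {i. i < n \<and> i \<in> K}} \<subseteq> {..<n}"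
    if f: "f permutes {..<card {i. i < n \<and> i \<in> K}}" for K n f
  proof
    let ?m = "card {i. i < n \<and> i \<in> K}"
    have m: "?m \<le> card K \<or> infinite K" by (metis (no_types, lifting) card_mono mem_Collect_eq subsetI)
    have "inj_on (pick K) {..<?m}"
    proof (rule inj_onI)
      fix a b assume ab: "a \<in> {..<?m}" "b \<in> {..<?m}" "pick K a = pick K b"
      then show "a = b" using pick_mono[of b K a] pick_mono[of a K b] m
        by (metis lessThan_iff less_le_trans linorder_neqE_nat nat_neq_iff)
    qed
    moreover have "f ` {..<?m} = {..<?m}" using permutes_image[OF f] .
    ultimately show "inj_on (pick K \<circ> f) {..<?m}" using permutes_inj_on[OF f] by (simp add: comp_inj_on)
    show "(pick K \<circ> f) ` {..<?m} \<subseteq> {..<n}"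
      using pick_le[of _ n K] permutes_in_image[OF f] by auto
  qed
  have dims: "dim_row N = card {i. i < dim_row M \<and> i \<in> I}" "dim_col N = card {j. j < dim_col M \<and> j \<in> J}"
    using arg_cong[OF N, of dim_row] arg_cong[OF N, of dim_col] by (simp_all add: dim_submatrix)
  have r: "inj_on (pick I \<circ> p) {..<dim_row N} \<and> (pick I \<circ> p) ` {..<dim_row N} \<subseteq> {..<dim_row M}"
    unfolding dims by (rule pick) (use p in \<open>simp add: dim_submatrix\<close>)
  have c: "inj_on (pick J \<circ> q) {..<dim_col N} \<and> (pick J \<circ> q) ` {..<dim_col N} \<subseteq> {..<dim_col M}"
    unfolding dims by (rule pick) (use q in \<open>simp add: dim_submatrix\<close>)
  have "N $$ (i, j) = M $$ ((pick I \<circ> p) i, (pick J \<circ> q) j)" if ij: "i < dim_row N" "j < dim_col N" for i j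
  proof -
    have "p i < card {i. i < dim_row M \<and> i \<in> I}" "q j < card {j. j < dim_col M \<and> j \<in> J}"
      using permutes_in_image[OF p, of i] permutes_in_image[OF q, of j] ij unfolding dims by (auto simp: dim_submatrix)
    then have "submatrix M I J $$ (p i, q j) = M $$ (pick I (p i), pick J (q j))" by (rule submatrix_index)
    moreover have "N $$ (i, j) = submatrix M I J $$ (p i, q j)"
      by (subst N) (use ij in \<open>simp add: dims dim_submatrix\<close>)
    ultimately show ?thesis by simp
  qed
  then show "\<exists>r c. inj_on r {..<dim_row N} \<and> r ` {..<dim_row N} \<subseteq> {..<dim_row M} \<and>
     inj_on c {..<dim_col N} \<and> c ` {..<dim_col N} \<subseteq> {..<dim_col M} \<and>
     (\<forall>i<dim_row N. \<forall>j<dim_col N. N $$ (i, j) = M $$ (r i, c j))"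
    using r c by (intro exI[of _ "pick I \<circ> p"] exI[of _ "pick J \<circ> q"]) simp
next
  assume "\<exists>r c. inj_on r {..<dim_row N} \<and> r ` {..<dim_row N} \<subseteq> {..<dim_row M} \<and>
     inj_on c {..<dim_col N} \<and> c ` {..<dim_col N} \<subseteq> {..<dim_col M} \<and>
     (\<forall>i<dim_row N. \<forall>j<dim_col N. N $$ (i, j) = M $$ (r i, c j))"
  then obtain r c where r: "inj_on r {..<dim_row N}" "r ` {..<dim_row N} \<subseteq> {..<dim_row M}"
    and c: "inj_on c {..<dim_col N}" "c ` {..<dim_col N} \<subseteq> {..<dim_col M}"
    and N: "\<forall>i<dim_row N. \<forall>j<dim_col N. N $$ (i, j) = M $$ (r i, c j)" by (elim exE conjE)
  have perm: "\<exists>p. p permutes {..<m} \<and> (\<forall>i<m. pick (f ` {..<m}) (p i) = f i)" if f: "inj_on f {..<m}"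
    for f :: "nat \<Rightarrow> nat" and m
  proof -
    let ?I = "f ` {..<m}"
    define p where "p i = (if i < m then card {a \<in> ?I. a < f i} else i)" for i
    have pk: "pick ?I (p i) = f i" if "i < m" for i using pick_card_in_set[of "f i" ?I] that unfolding p_def by simp
    have "inj_on p {..<m}" using pk f by (metis inj_on_def lessThan_iff)
    moreover have "p i < m" if "i < m" for i
    proof -
      have "{a \<in> ?I. a < f i} \<subset> ?I" using that by auto
      then have "card {a \<in> ?I. a < f i} < card ?I" by (intro psubset_card_mono) auto
      then show ?thesis using that card_image[OF f] unfolding p_def by simp
    qed
    then have "p ` {..<m} \<subseteq> {..<m}" by auto
    ultimately have "bij_betw p {..<m} {..<m}" by (simp add: bij_betw_def endo_inj_surj)
    then have "p permutes {..<m}" by (rule bij_imp_permutes) (simp add: p_def)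
    then show ?thesis using pk by blast
  qed
  obtain p where p: "p permutes {..<dim_row N}" "\<And>i. i < dim_row N \<Longrightarrow> pick (r ` {..<dim_row N}) (p i) = r i"
    using perm[OF r(1)] by blast
  obtain q where q: "q permutes {..<dim_col N}" "\<And>i. i < dim_col N \<Longrightarrow> pick (c ` {..<dim_col N}) (q i) = c i"
    using perm[OF c(1)] by blast
  let ?A = "submatrix M (r ` {..<dim_row N}) (c ` {..<dim_col N})"
  have sets: "{i. i < dim_row M \<and> i \<in> r ` {..<dim_row N}} = r ` {..<dim_row N}"
    "{i. i < dim_col M \<and> i \<in> c ` {..<dim_col N}} = c ` {..<dim_col N}" using r(2) c(2) by auto
  have dims: "dim_row ?A = dim_row N" "dim_col ?A = dim_col N"
    unfolding dim_submatrix sets using card_image[OF r(1)] card_image[OF c(1)] by simp_all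
  have "N = mat (dim_row ?A) (dim_col ?A) (\<lambda>(i, j). ?A $$ (p i, q j))"
  proof (rule eq_matI)
    fix i j assume "i < dim_row (mat (dim_row ?A) (dim_col ?A) (\<lambda>(i, j). ?A $$ (p i, q j)))"
      "j < dim_col (mat (dim_row ?A) (dim_col ?A) (\<lambda>(i, j). ?A $$ (p i, q j)))"
    then have ij: "i < dim_row N" "j < dim_col N" using dims by auto
    then have "p i < dim_row ?A" "q j < dim_col ?A"
      using permutes_in_image[OF p(1), of i] permutes_in_image[OF q(1), of j] dims by auto
    then have "?A $$ (p i, q j) = M $$ (r i, c j)"
      using ij p(2) q(2) by (simp add: submatrix_index dim_submatrix)
    then show "N $$ (i, j) = mat (dim_row ?A) (dim_col ?A) (\<lambda>(i, j). ?A $$ (p i, q j)) $$ (i, j)"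
      using ij N dims by simp
  qed (simp_all add: dims)
  then show "contains_configuration M N"
    unfolding contains_configuration_def equal_up_to_permutations_def using p(1) q(1) dims by metis
qed

text \<open>Restriction to chosen columns commutes with differences and complements, so each member
  of the family of \<open>N\<close> is pulled back from a member of the family of
  \<open>M\<close>.\<close>

lemma configuration_circular:
  assumes "contains_configuration M N"
  shows configuration_circular_ones: "circular_ones_property M \<Longrightarrow> circular_ones_property N"
    and configuration_D_circular: "D_circular_property M \<Longrightarrow> D_circular_property N"
proof -
  obtain r c where r: "r ` {..<dim_row N} \<subseteq> {..<dim_row M}"
    and c: "inj_on c {..<dim_col N}" "c ` {..<dim_col N} \<subseteq> {..<dim_col M}"
    and N: "\<forall>i<dim_row N. \<forall>j<dim_col N. N $$ (i, j) = M $$ (r i, c j)"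
    using assms unfolding contains_configuration_iff by (elim exE conjE)
  have row: "\<exists>g\<in>row_family M. \<forall>j\<in>{..<dim_col N}. j \<in> h \<longleftrightarrow> c j \<in> g" if "h \<in> row_family N" for h
  proof -
    from that obtain i where i: "i < dim_row N" "h = row_set N i" unfolding row_family_def by auto
    have "r i \<in> {..<dim_row M}" using r i by auto
    moreover have "j \<in> h \<longleftrightarrow> c j \<in> row_set M (r i)" if "j < dim_col N" for j
      using that i N c(2) unfolding row_set_def by auto
    ultimately show ?thesis unfolding row_family_def by blast
  qed
  have D: "\<exists>g\<in>D_family M. \<forall>j\<in>{..<dim_col N}. j \<in> h \<longleftrightarrow> c j \<in> g" if hD: "h \<in> D_family N" for h
  proof (cases "h \<in> row_family N")
    case True
    then show ?thesis using row[of h] row_in_D_family by blast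
  next
    case False
    then obtain a b where h: "h = b - a" "a \<in> row_family N" "b \<in> row_family N"
      using D_family_cases[OF hD] by metis
    obtain a' b' where "a' \<in> row_family M" "\<forall>j\<in>{..<dim_col N}. j \<in> a \<longleftrightarrow> c j \<in> a'"
      "b' \<in> row_family M" "\<forall>j\<in>{..<dim_col N}. j \<in> b \<longleftrightarrow> c j \<in> b'" using row h by meson
    then show ?thesis unfolding h(1) by (intro bexI[of _ "b' - a'"]) (auto intro: diff_in_D_family)
  qed
  have ts: "\<exists>g\<in>two_sided F. \<forall>j\<in>T. j \<in> h \<longleftrightarrow> c j \<in> g"
    if H: "\<And>h. h \<in> H \<Longrightarrow> \<exists>g\<in>F. \<forall>j\<in>T. j \<in> h \<longleftrightarrow> c j \<in> g" and h: "h \<in> two_sided H" for F H T h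
  proof (cases "h \<in> H")
    case True
    then show ?thesis using H unfolding two_sided_def by blast
  next
    case False
    then obtain h' where h': "h' \<in> H" "h = - h'" using h unfolding two_sided_def by auto
    from H[OF h'(1)] obtain g where "g \<in> F" "\<forall>j\<in>T. j \<in> h' \<longleftrightarrow> c j \<in> g" by blast
    then show ?thesis using h' unfolding two_sided_def by (intro bexI[of _ "- g"]) auto
  qed
  show "circular_ones_property M \<Longrightarrow> circular_ones_property N"
    unfolding circular_ones_iff by (erule circular_pullback[OF _ c]) (rule ts[OF row])
  show "D_circular_property M \<Longrightarrow> D_circular_property N"
    unfolding D_circular_iff by (erule circular_pullback[OF _ c]) (rule ts[OF D])
qed

section \<open>The forbidden matrices are not circular\<close>

lemma bin_mat_dim [simp]: "dim_row (bin_mat n rs) = length rs" "dim_col (bin_mat n rs) = n"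
  unfolding bin_mat_def mat_of_rows_list_def by simp_all

lemma bin_mat_index: "i < length rs \<Longrightarrow> j < n \<Longrightarrow> bin_mat n rs $$ (i, j) \<longleftrightarrow> rs ! i ! j = 1"
  unfolding bin_mat_def mat_of_rows_list_def by simp

lemma star_bin_mat:
  assumes "\<forall>r\<in>set rs. length r = n"
  shows "star_mat (bin_mat n rs) = bin_mat (Suc n) (map (\<lambda>r. r @ [0]) rs)"
  by (rule eq_matI) (use assms in \<open>auto simp: star_mat_def bin_mat_index nth_append\<close>)

lemma complement_bin_mat:
  assumes "\<forall>r\<in>set rs. length r = n \<and> set r \<subseteq> {0, 1}"
  shows "complement_mat (bin_mat n rs) = bin_mat n (map (map (\<lambda>x. 1 - x)) rs)"
proof (rule eq_matI)
  fix i j assume "i < dim_row (bin_mat n (map (map (\<lambda>x. 1 - x)) rs))" "j < dim_col (bin_mat n (map (map (\<lambda>x. 1 - x)) rs))"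
  then have ij: "i < length rs" "j < n" by auto
  then have "rs ! i ! j \<in> {0, 1}" "length (rs ! i) = n" using assms nth_mem by (metis subsetD)+
  then show "complement_mat (bin_mat n rs) $$ (i, j) = bin_mat n (map (map (\<lambda>x. 1 - x)) rs) $$ (i, j)"
    using ij unfolding complement_mat_def by (auto simp: bin_mat_index)
qed (simp_all add: complement_mat_def)

text \<open>\<open>star_mat Z3\<close>, \<open>Z5\<close>, its transpose, \<open>Z7\<close> and
  \<open>Z8\<close> agree with their complements up to permutations, which is why only four
  complements are listed.\<close>

lemma F_Dcirc_explicit:
  shows "star_mat Z1 = bin_mat 4 [[1,1,1,0], [1,0,0,0], [0,1,0,0], [0,0,1,0]]"
    and "star_mat Z2 = bin_mat 4 [[1,0,0,0], [1,1,0,0], [1,1,1,0], [0,1,0,0]]"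
    and "star_mat Z3 = bin_mat 4 [[1,0,0,0], [1,1,0,0], [1,1,1,0], [1,0,1,0]]"
    and "star_mat Z4 = bin_mat 5 [[1,1,1,0,0], [0,1,1,1,0], [0,0,1,0,0]]"
    and "Z5 = bin_mat 4 [[1,0,0,1], [1,1,0,0], [1,1,1,0], [0,1,0,0]]"
    and "transpose_mat Z5 = bin_mat 4 [[1,1,1,0], [0,1,1,1], [0,0,1,0], [1,0,0,0]]"
    and "Z6 = bin_mat 4 [[1,1,1,0], [1,0,0,1], [0,1,0,0], [0,0,1,0]]"
    and "Z7 = bin_mat 4 [[1,1,1,0], [1,0,0,1], [0,1,0,1], [0,0,1,0]]"
    and "Z8 = bin_mat 5 [[1,1,1,0,1], [0,1,1,1,1], [0,0,1,0,0], [0,0,0,0,1]]"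
    and "complement_mat (star_mat Z1) = bin_mat 4 [[0,0,0,1], [0,1,1,1], [1,0,1,1], [1,1,0,1]]"
    and "complement_mat (star_mat Z2) = bin_mat 4 [[0,1,1,1], [0,0,1,1], [0,0,0,1], [1,0,1,1]]"
    and "complement_mat (star_mat Z4) = bin_mat 5 [[0,0,0,1,1], [1,0,0,0,1], [1,1,0,1,1]]"
    and "complement_mat Z6 = bin_mat 4 [[0,0,0,1], [0,1,1,0], [1,0,1,1], [1,1,0,1]]"
proof -
  show "transpose_mat Z5 = bin_mat 4 [[1,1,1,0], [0,1,1,1], [0,0,1,0], [1,0,0,0]]"
    by (rule eq_matI) (auto simp: Z5_def bin_mat_index less_Suc_eq numeral_eq_Suc)
qed (simp_all add: Z1_def Z2_def Z3_def Z4_def Z5_def Z6_def Z7_def Z8_def star_bin_mat complement_bin_mat)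

text \<open>Whether a row, a difference of rows, or the complement of either has exactly the ones \<open>a\<close> and \<open>b\<close>;
  the additional zero row turns a row into a difference.\<close>

definition realizes_pair :: "nat \<Rightarrow> nat list list \<Rightarrow> nat \<Rightarrow> nat \<Rightarrow> bool" where
  "realizes_pair n rs a b \<longleftrightarrow> (\<exists>s\<in>set rs. \<exists>r\<in>set (replicate n 0 # rs).
     (\<forall>j\<in>set [0..<n]. (s ! j = 1 \<and> r ! j \<noteq> 1) = (j = a \<or> j = b)) \<or>
     (\<forall>j\<in>set [0..<n]. (s ! j = 1 \<and> r ! j \<noteq> 1) = (j \<noteq> a \<and> j \<noteq> b)))"

definition realizes_cycle :: "nat \<Rightarrow> nat list list \<Rightarrow> nat list \<Rightarrow> bool" where
  "realizes_cycle n rs ts \<longleftrightarrow> distinct ts \<and> 3 \<le> length ts \<and> length ts + 1 = n \<and> (\<forall>t\<in>set ts. t < n) \<and>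
     (\<forall>i\<in>set [0..<length ts]. realizes_pair n rs (ts ! i) (ts ! (Suc i mod length ts)))"

lemma realizes_pair_trace:
  assumes "realizes_pair n rs a b" "a < n" "b < n"
  shows "\<exists>g\<in>D_sets (bin_mat n rs). g \<inter> {..<n} = {a, b}"
proof -
  let ?M = "bin_mat n rs"
  obtain s r where sr: "s \<in> set rs" "r \<in> set (replicate n 0 # rs)"
    and d: "(\<forall>j<n. (s ! j = 1 \<and> r ! j \<noteq> 1) = (j = a \<or> j = b)) \<or> (\<forall>j<n. (s ! j = 1 \<and> r ! j \<noteq> 1) = (j \<noteq> a \<and> j \<noteq> b))"
    using assms(1) unfolding realizes_pair_def by (metis atLeastLessThan_iff le0 set_upt)
  have row: "{j. j < n \<and> s ! j = 1} \<in> row_family ?M" if s: "s \<in> set rs" for s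
  proof -
    obtain i where i: "i < length rs" "rs ! i = s" using s by (metis in_set_conv_nth)
    have "row_set ?M i = {j. j < n \<and> s ! j = 1}" using i unfolding row_set_def by (auto simp: bin_mat_index)
    then show ?thesis using i(1) unfolding row_family_def by (metis bin_mat_dim(1) imageI lessThan_iff)
  qed
  define D where "D = {j. j < n \<and> s ! j = 1 \<and> r ! j \<noteq> 1}"
  have "D \<in> D_family ?M"
  proof (cases "r \<in> set rs")
    case True
    have "D = {j. j < n \<and> s ! j = 1} - {j. j < n \<and> r ! j = 1}" unfolding D_def by auto
    then show ?thesis using diff_in_D_family row True sr(1) by metis
  next
    case False
    then have "r = replicate n 0" using sr by simp
    then have "D = {j. j < n \<and> s ! j = 1}" unfolding D_def by auto
    then show ?thesis using row_in_D_family row sr(1) by metis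
  qed
  then have "D \<in> two_sided (D_family ?M)" "- D \<in> two_sided (D_family ?M)" unfolding two_sided_def by auto
  moreover have "D \<inter> {..<n} = {a, b} \<or> (- D) \<inter> {..<n} = {a, b}" using d assms(2,3) unfolding D_def by auto
  ultimately show ?thesis by metis
qed

text \<open>The condition \<open>length ts + 1 = n\<close> leaves exactly one column off the cycle,
  and it serves as the centre.\<close>

lemma realizes_cycle_not_D_circular:
  assumes "realizes_cycle n rs ts"
  shows "\<not> D_circular_property (bin_mat n rs)"
proof -
  note ts = assms[unfolded realizes_cycle_def]
  have "card (set ts) < card {..<n}" using ts distinct_card[of ts] by simp
  then have "\<not> {..<n} \<subseteq> set ts" by (meson card_mono List.finite_set leD)
  then obtain c where c: "c < n" "c \<notin> set ts" by auto
  have sub: "insert c (set ts) \<subseteq> {..<n}" using ts c by auto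
  have "cyc_obs (D_sets (bin_mat n rs)) c ts" unfolding cyc_obs_def
  proof (intro conjI allI impI)
    fix i assume i: "i < length ts"
    have "Suc i mod length ts < length ts" by (rule mod_less_divisor) (use i in linarith)
    then have t: "ts ! i \<in> set ts" "ts ! (Suc i mod length ts) \<in> set ts" using i by simp_all
    have "realizes_pair n rs (ts ! i) (ts ! (Suc i mod length ts))" using ts i by simp
    then obtain g where g: "g \<in> D_sets (bin_mat n rs)" "g \<inter> {..<n} = {ts ! i, ts ! (Suc i mod length ts)}"
      using realizes_pair_trace t sub by (metis insert_subset lessThan_iff subsetD)
    then have "g \<inter> insert c (set ts) = {ts ! i, ts ! (Suc i mod length ts)}" using sub t by blast
    then show "\<exists>g\<in>D_sets (bin_mat n rs). g \<inter> insert c (set ts) = {ts ! i, ts ! (Suc i mod length ts)}"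
      using g(1) by blast
  qed (use ts c in auto)
  from cyc_obs_not_circular[OF this] show ?thesis
    using circular_subset[OF _ sub] unfolding D_circular_iff bin_mat_dim by metis
qed

text \<open>Each matrix carries a cycle of pairs, checked by evaluation: a triangle around the last
  column if there are four columns, a four-cycle around column \<open>2\<close> for
  \<open>star_mat Z4\<close> and its complement, and around column \<open>1\<close> for
  \<open>Z8\<close>.\<close>

lemma F_Dcirc_not_D_circular:
  assumes "N \<in> F_Dcirc"
  shows "\<not> D_circular_property N"
proof -
  note cycle = realizes_cycle_not_D_circular
  have "\<not> D_circular_property (star_mat Z1)" unfolding F_Dcirc_explicit(1) by (rule cycle[of _ _ "[0, 1, 2]"]) code_simp
  moreover
  have "\<not> D_circular_property (star_mat Z2)" unfolding F_Dcirc_explicit(2) by (rule cycle[of _ _ "[0, 1, 2]"]) code_simp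
  moreover
  have "\<not> D_circular_property (star_mat Z3)" unfolding F_Dcirc_explicit(3) by (rule cycle[of _ _ "[0, 1, 2]"]) code_simp
  moreover
  have "\<not> D_circular_property (star_mat Z4)" unfolding F_Dcirc_explicit(4) by (rule cycle[of _ _ "[0, 1, 3, 4]"]) code_simp
  moreover
  have "\<not> D_circular_property (Z5)" unfolding F_Dcirc_explicit(5) by (rule cycle[of _ _ "[0, 1, 2]"]) code_simp
  moreover
  have "\<not> D_circular_property (transpose_mat Z5)" unfolding F_Dcirc_explicit(6) by (rule cycle[of _ _ "[0, 1, 2]"]) code_simp
  moreover
  have "\<not> D_circular_property (Z6)" unfolding F_Dcirc_explicit(7) by (rule cycle[of _ _ "[0, 1, 2]"]) code_simp
  moreover
  have "\<not> D_circular_property (Z7)" unfolding F_Dcirc_explicit(8) by (rule cycle[of _ _ "[0, 1, 2]"]) code_simp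
  moreover
  have "\<not> D_circular_property (Z8)" unfolding F_Dcirc_explicit(9) by (rule cycle[of _ _ "[0, 2, 3, 4]"]) code_simp
  moreover
  have "\<not> D_circular_property (complement_mat (star_mat Z1))" unfolding F_Dcirc_explicit(10) by (rule cycle[of _ _ "[0, 1, 2]"]) code_simp
  moreover
  have "\<not> D_circular_property (complement_mat (star_mat Z2))" unfolding F_Dcirc_explicit(11) by (rule cycle[of _ _ "[0, 1, 2]"]) code_simp
  moreover
  have "\<not> D_circular_property (complement_mat (star_mat Z4))" unfolding F_Dcirc_explicit(12) by (rule cycle[of _ _ "[0, 1, 3, 4]"]) code_simp
  moreover
  have "\<not> D_circular_property (complement_mat Z6)" unfolding F_Dcirc_explicit(13) by (rule cycle[of _ _ "[0, 1, 2]"]) code_simp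
  ultimately show ?thesis
    using assms unfolding F_Dcirc_def by (elim insertE emptyE) (simp_all only: not_False_eq_True)
qed

lemma row_set_complement: "i < dim_row M \<Longrightarrow> row_set (complement_mat M) i = {..<dim_col M} - row_set M i"
  unfolding row_set_def complement_mat_def by auto

lemma circular_ones_complement: "circular_ones_property (complement_mat M) \<Longrightarrow> circular_ones_property M"
  unfolding circular_ones_iff
proof (erule circular_pullback[of _ _ id])
  fix h assume h: "h \<in> two_sided (row_family M)"
  have "\<exists>g\<in>two_sided (row_family (complement_mat M)). \<forall>j\<in>{..<dim_col M}. j \<in> r \<longleftrightarrow> j \<in> g" if r: "r \<in> row_family M" for r
  proof -
    obtain i where i: "i < dim_row M" "r = row_set M i" using r unfolding row_family_def by auto
    then have "row_set (complement_mat M) i \<in> row_family (complement_mat M)"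
      unfolding row_family_def by (simp add: complement_mat_def)
    then have "- row_set (complement_mat M) i \<in> two_sided (row_family (complement_mat M))" unfolding two_sided_def by blast
    then show ?thesis using i row_set_complement by (intro bexI[of _ "- row_set (complement_mat M) i"]) auto
  qed
  then have *: "\<exists>g\<in>two_sided (row_family (complement_mat M)). \<forall>j\<in>{..<dim_col M}. j \<in> r \<longleftrightarrow> j \<in> g"
    if "r \<in> row_family M" for r using that .
  show "\<exists>g\<in>two_sided (row_family (complement_mat M)). \<forall>j\<in>{..<dim_col M}. j \<in> h \<longleftrightarrow> id j \<in> g"
  proof (cases "h \<in> row_family M")
    case True
    then show ?thesis using * by simp
  next
    case False
    then obtain r where r: "r \<in> row_family M" "h = - r" using h unfolding two_sided_def by auto
    then obtain g where g: "g \<in> two_sided (row_family (complement_mat M))" "\<forall>j\<in>{..<dim_col M}. j \<in> r \<longleftrightarrow> j \<in> g"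
      using * by blast
    then show ?thesis using r two_sided_compl by (intro bexI[of _ "- g"]) auto
  qed
qed (simp_all add: complement_mat_def)

lemma M_I_dim [simp]: "dim_row (star_mat (M_I k)) = k" "dim_col (star_mat (M_I k)) = Suc k"
  unfolding star_mat_def M_I_def by simp_all

lemma star_M_I_index:
  "i < k \<Longrightarrow> j \<le> k \<Longrightarrow> star_mat (M_I k) $$ (i, j) \<longleftrightarrow> j = i \<or> j = Suc i mod k \<and> j < k"
  unfolding star_mat_def M_I_def by (auto simp: mod_Suc)

text \<open>The rows themselves are the pairs of a cycle and the added zero column is its centre. No
  difference of rows is involved, so already the circular-ones property fails.\<close>

lemma star_M_I_not_circular_ones:
  assumes "3 \<le> k"
  shows "\<not> circular_ones_property (star_mat (M_I k))"
proof -
  let ?M = "star_mat (M_I k)"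
  have "cyc_obs (two_sided (row_family ?M)) k [0..<k]" unfolding cyc_obs_def
  proof (intro conjI allI impI)
    fix i assume "i < length [0..<k]"
    then have i: "i < k" by simp
    have m: "Suc i mod k < k" by (rule mod_less_divisor) (use i in linarith)
    have "row_set ?M i = {i, Suc i mod k}" unfolding row_set_def using i m by (auto simp: star_M_I_index less_Suc_eq_le)
    moreover have "row_set ?M i \<in> two_sided (row_family ?M)"
      unfolding two_sided_def row_family_def using i by simp
    ultimately show "\<exists>g\<in>two_sided (row_family ?M).
        g \<inter> insert k (set [0..<k]) = {[0..<k] ! i, [0..<k] ! (Suc i mod length [0..<k])}"
      using i m by (intro bexI[of _ "row_set ?M i"]) auto
  qed (use assms in auto)
  moreover have "insert k (set [0..<k]) = {..<dim_col ?M}" by auto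
  ultimately show ?thesis using cyc_obs_not_circular unfolding circular_ones_iff by metis
qed

section \<open>Cycles up to rotation and the traces along them\<close>

definition edge_set :: "'a list \<Rightarrow> 'a set set" where
  "edge_set ts = (\<lambda>i. {ts ! i, ts ! (Suc i mod length ts)}) ` {..<length ts}"

lemma edge_set_rotate_subset: "edge_set (rotate n ts) \<subseteq> edge_set ts"
proof
  fix e assume "e \<in> edge_set (rotate n ts)"
  then obtain i where i: "i < length ts" "e = {rotate n ts ! i, rotate n ts ! (Suc i mod length ts)}"
    unfolding edge_set_def by auto
  let ?m = "length ts"
  have m: "0 < ?m" using i by linarith
  define k where "k = (n + i) mod ?m"
  have "rotate n ts ! i = ts ! k" using i unfolding k_def by (simp add: nth_rotate)
  moreover have "(n + Suc i mod ?m) mod ?m = Suc k mod ?m" unfolding k_def by (simp add: mod_simps)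
  then have "rotate n ts ! (Suc i mod ?m) = ts ! (Suc k mod ?m)" using m by (simp add: nth_rotate)
  moreover have "k < ?m" unfolding k_def using m by simp
  ultimately show "e \<in> edge_set ts" unfolding edge_set_def i(2) by (intro image_eqI[of _ _ k]) simp_all
qed

text \<open>Rotating on by the remaining amount restores \<open>ts\<close>, so the inclusion for
  rotations gives equality.\<close>

lemma edge_set_rotate: "edge_set (rotate n ts) = edge_set ts"
proof (cases "ts = []")
  case False
  then have "n mod length ts \<le> length ts" by (simp add: less_imp_le)
  then have "rotate (length ts - n mod length ts) (rotate (n mod length ts) ts) = ts"
    by (simp add: rotate_rotate)
  then show ?thesis
    using edge_set_rotate_subset[of "length ts - n mod length ts" "rotate (n mod length ts) ts"]
      edge_set_rotate_subset[of n ts] by (simp add: rotate_conv_mod[symmetric])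
qed simp

lemma cyc_obs_iff: "cyc_obs G c ts \<longleftrightarrow> distinct ts \<and> 3 \<le> length ts \<and> c \<notin> set ts \<and>
    (\<forall>e\<in>edge_set ts. \<exists>g\<in>G. g \<inter> insert c (set ts) = e)"
  unfolding cyc_obs_def edge_set_def ball_simps(9) by (simp only: Ball_def lessThan_iff)

lemma cyc_obs_rotate: "cyc_obs G c ts \<Longrightarrow> cyc_obs G c (rotate n ts)"
  unfolding cyc_obs_iff edge_set_rotate by simp

lemma edge_set_subset: "e \<in> edge_set ts \<Longrightarrow> e \<subseteq> set ts"
  unfolding edge_set_def by (auto intro!: nth_mem mod_less_divisor)

lemma edge_set_card:
  assumes "distinct ts" "2 \<le> length ts" "e \<in> edge_set ts"
  shows "card e = 2"
proof -
  obtain i where i: "i < length ts" "e = {ts ! i, ts ! (Suc i mod length ts)}" using assms(3) unfolding edge_set_def by auto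
  have "Suc i mod length ts < length ts" by (rule mod_less_divisor) (use i in linarith)
  moreover have "Suc i mod length ts \<noteq> i" using i assms(2) by (auto simp: mod_Suc)
  ultimately have "ts ! i \<noteq> ts ! (Suc i mod length ts)" using i assms(1) by (simp add: nth_eq_iff_index_eq)
  then show ?thesis using i by simp
qed

text \<open>Suppose that \<open>g\<close> leaves the cycle at some vertex and first returns two or
  more steps later. The part in between, closed up by \<open>g\<close>, is a cycle around
  \<open>c\<close>. By minimality it has all the vertices, so \<open>g\<close> traces an edge after
  all.\<close>

lemma (in minimal_noncircular) cyc_obs_traces:
  assumes o: "cyc_obs G c ts" and X: "X = insert c (set ts)" and g: "g \<in> G" "c \<notin> g"
  shows "g \<inter> X = set ts \<or> (\<exists>e\<in>edge_set ts. g \<inter> X \<subseteq> e)"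
proof (rule ccontr)
  assume neg: "\<not> ?thesis"
  let ?m = "length ts"
  have ts: "distinct ts" "3 \<le> ?m" "c \<notin> set ts" using o unfolding cyc_obs_def by auto
  have gX: "g \<inter> X \<subseteq> set ts" using X g by auto
  \<comment> \<open>A nonempty trace that is closed under the cyclic successor is the whole
    cycle.\<close>
  have "\<exists>i<?m. ts ! i \<in> g \<and> ts ! (Suc i mod ?m) \<notin> g"
  proof (rule ccontr)
    assume "\<not> ?thesis"
    then have step: "ts ! (Suc i mod ?m) \<in> g" if "i < ?m" "ts ! i \<in> g" for i using that by blast
    have m: "0 < ?m" using ts by linarith
    obtain i0 where i0: "i0 < ?m" "ts ! i0 \<in> g"
    proof -
      have "edge_set ts \<noteq> {}" unfolding edge_set_def using m by auto
      then have "g \<inter> X \<noteq> {}" using neg by auto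
      then show thesis using that gX by (metis Int_iff all_not_in_conv in_set_conv_nth subsetD)
    qed
    have "ts ! ((i0 + n) mod ?m) \<in> g" for n
    proof (induction n)
      case 0
      then show ?case using i0 by simp
    next
      case (Suc n)
      have "Suc ((i0 + n) mod ?m) mod ?m = (i0 + Suc n) mod ?m" by (simp add: mod_simps)
      then show ?case using step[OF _ Suc] m by (metis mod_less_divisor)
    qed
    note all = this
    have "set ts \<subseteq> g"
    proof
      fix x assume "x \<in> set ts"
      then obtain j where j: "j < ?m" "x = ts ! j" by (metis in_set_conv_nth)
      have "(i0 + (?m - i0 + j)) mod ?m = j" using i0 j by simp
      then show "x \<in> g" using all[of "?m - i0 + j"] j by simp
    qed
    then show False using neg gX X by blast
  qed
  then obtain i where i: "i < ?m" "ts ! i \<in> g" "ts ! (Suc i mod ?m) \<notin> g" by blast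
  \<comment> \<open>The rotated cycle starts where \<open>g\<close> is left; \<open>j\<close> is
    going to be the first return.\<close>
  define us where "us = rotate i ts"
  have us: "distinct us" "length us = ?m" "set us = set ts" "edge_set us = edge_set ts"
    unfolding us_def by (simp_all add: ts edge_set_rotate)
  have ou: "cyc_obs G c us" unfolding us_def by (rule cyc_obs_rotate[OF o])
  have m: "0 < ?m" "1 < ?m" "2 < ?m" using ts by linarith+
  have u0: "us ! 0 \<in> g" and u1: "us ! 1 \<notin> g"
    using i m unfolding us_def by (simp_all add: nth_rotate)
  have ue: "{us ! j, us ! Suc j} \<in> edge_set us" if "Suc j < ?m" for j
    unfolding edge_set_def us(2) using that by (intro image_eqI[of _ _ j]) auto
  define P where "P j \<longleftrightarrow> 1 \<le> j \<and> j < ?m \<and> us ! j \<in> g" for j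
  have "\<exists>j. P j"
  proof (rule ccontr)
    assume none: "\<not> (\<exists>j. P j)"
    have "g \<inter> X \<subseteq> {us ! 0, us ! Suc 0}"
    proof
      fix x assume x: "x \<in> g \<inter> X"
      then have "x \<in> set us" using gX us by auto
      then obtain j where "j < ?m" "x = us ! j" using us(2) by (metis in_set_conv_nth)
      then show "x \<in> {us ! 0, us ! Suc 0}" using none x unfolding P_def by (cases j) auto
    qed
    then show False using neg ue[of 0] m us(4) by auto
  qed
  define j where "j = (LEAST j. P j)"
  have j: "P j" unfolding j_def using \<open>\<exists>j. P j\<close> by (rule LeastI_ex)
  have least: "us ! l \<notin> g" if "1 \<le> l" "l < j" for l
    using not_less_Least[of l P] that j unfolding j_def P_def by auto
  have j2: "2 \<le> j" using j u1 unfolding P_def by (cases "j = 1") auto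
  define vs where "vs = take (Suc j) us"
  have jm: "j < ?m" "us ! j \<in> g" using j unfolding P_def by auto
  have vs: "length vs = Suc j" "distinct vs" "set vs \<subseteq> set ts" "\<And>l. l \<le> j \<Longrightarrow> vs ! l = us ! l"
    unfolding vs_def using jm us by (auto dest: in_set_takeD)
  have gvs: "g \<inter> insert c (set vs) = {us ! j, us ! 0}"
  proof
    show "g \<inter> insert c (set vs) \<subseteq> {us ! j, us ! 0}"
    proof
      fix x assume x: "x \<in> g \<inter> insert c (set vs)"
      then have "x \<in> set vs" using g by auto
      then obtain l where l: "l \<le> j" "x = us ! l" using vs by (metis in_set_conv_nth less_Suc_eq_le)
      then show "x \<in> {us ! j, us ! 0}" using least[of l] x by (cases "l = 0 \<or> l = j") auto
    qed
    have "us ! j = vs ! j" "us ! 0 = vs ! 0" using vs(4) by simp_all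
    then have "us ! j \<in> set vs" "us ! 0 \<in> set vs" using vs(1) by (metis lessI nth_mem zero_less_Suc)+
    then show "{us ! j, us ! 0} \<subseteq> g \<inter> insert c (set vs)" using u0 jm by blast
  qed
  have "cyc_obs G c vs" unfolding cyc_obs_def
  proof (intro conjI allI impI)
    fix l assume l: "l < length vs"
    show "\<exists>g\<in>G. g \<inter> insert c (set vs) = {vs ! l, vs ! (Suc l mod length vs)}"
    proof (cases "l = j")
      case True
      have "{vs ! l, vs ! (Suc l mod length vs)} = {us ! j, us ! 0}" using True vs by simp
      then show ?thesis using gvs g by metis
    next
      case False
      then have lj: "Suc l \<le> j" using l vs by simp
      then have e: "{us ! l, us ! Suc l} \<in> edge_set us" using ue jm by simp
      then obtain h where h: "h \<in> G" "h \<inter> insert c (set us) = {us ! l, us ! Suc l}"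
        using ou unfolding cyc_obs_iff by blast
      have "vs ! l \<in> set vs" "vs ! Suc l \<in> set vs" using lj vs(1) by simp_all
      moreover have "vs ! l = us ! l" "vs ! Suc l = us ! Suc l" using vs(4) lj by simp_all
      ultimately have "h \<inter> insert c (set vs) = {vs ! l, vs ! Suc l}" using h vs(3) us(3) by auto
      moreover have "Suc l mod length vs = Suc l" using lj vs(1) by simp
      ultimately show ?thesis using h by metis
    qed
  qed (use vs ts j2 in auto)
  then have "\<not> circular G (insert c (set vs))" by (rule cyc_obs_not_circular)
  then have "insert c (set vs) = X" using minimal[of "insert c (set vs)"] vs(3) X by blast
  then have "card (set vs) = card (set ts)" using X ts(3) vs(3) by (metis insert_ident subsetD)
  then have "Suc j = ?m" using vs ts(1) distinct_card by metis
  then have "{us ! j, us ! 0} \<in> edge_set us" unfolding edge_set_def us(2) by (intro image_eqI[of _ _ j]) auto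
  then show False using neg gvs \<open>insert c (set vs) = X\<close> us(4) by auto
qed

text \<open>Different rows of \<open>N\<close> need different rows of \<open>M\<close>, so the
  choice of rows is automatically injective.\<close>

lemma contains_configurationI:
  assumes c: "inj_on c {..<dim_col N}" "c ` {..<dim_col N} \<subseteq> {..<dim_col M}"
    and distinct_rows: "\<And>i i'. i < dim_row N \<Longrightarrow> i' < dim_row N \<Longrightarrow> i \<noteq> i' \<Longrightarrow> \<exists>j<dim_col N. N $$ (i, j) \<noteq> N $$ (i', j)"
    and rows: "\<And>i. i < dim_row N \<Longrightarrow> \<exists>h\<in>row_family M. \<forall>j<dim_col N. N $$ (i, j) \<longleftrightarrow> c j \<in> h"
  shows "contains_configuration M N"
proof -
  have "\<exists>r<dim_row M. \<forall>j<dim_col N. N $$ (i, j) = M $$ (r, c j)" if i: "i < dim_row N" for i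
  proof -
    obtain h where h: "h \<in> row_family M" "\<forall>j<dim_col N. N $$ (i, j) \<longleftrightarrow> c j \<in> h" using rows[OF i] by blast
    then obtain r where "r < dim_row M" "h = row_set M r" unfolding row_family_def by auto
    moreover have "c j < dim_col M" if "j < dim_col N" for j using c(2) that by auto
    ultimately show ?thesis using h(2) unfolding row_set_def by auto
  qed
  then obtain r where r: "\<And>i. i < dim_row N \<Longrightarrow> r i < dim_row M"
    "\<And>i j. i < dim_row N \<Longrightarrow> j < dim_col N \<Longrightarrow> N $$ (i, j) = M $$ (r i, c j)" by metis
  have "inj_on r {..<dim_row N}"
  proof (rule inj_onI, rule ccontr)
    fix i i' assume "i \<in> {..<dim_row N}" "i' \<in> {..<dim_row N}" "r i = r i'" "i \<noteq> i'"
    then show False using distinct_rows[of i i'] r(2) by auto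
  qed
  then show ?thesis unfolding contains_configuration_iff
    using c r by (intro exI[of _ r] exI[of _ c]) auto
qed

section \<open>Rows realizing a cycle\<close>

definition row_trace :: "bool mat \<Rightarrow> nat set \<Rightarrow> nat set \<Rightarrow> bool" where
  "row_trace M X A \<longleftrightarrow> (\<exists>h\<in>row_family M. h \<inter> X = A)"

lemma row_trace_subset: "row_trace M X A \<Longrightarrow> A \<subseteq> X"
  unfolding row_trace_def by blast

lemma row_trace_in:
  assumes "row_trace M X A"
  shows "\<exists>g\<in>D_sets M. g \<inter> X = A" "\<exists>g\<in>D_sets M. g \<inter> X = X - A"
proof -
  obtain h where h: "h \<in> row_family M" "h \<inter> X = A" using assms unfolding row_trace_def by blast
  then have "h \<in> D_sets M" "- h \<in> D_sets M"
    unfolding two_sided_def using row_in_D_family by auto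
  moreover have "(- h) \<inter> X = X - A" using h(2) by blast
  ultimately show "\<exists>g\<in>D_sets M. g \<inter> X = A" "\<exists>g\<in>D_sets M. g \<inter> X = X - A"
    using h(2) by metis+
qed

lemma row_trace_diff_in:
  assumes "row_trace M X A" "row_trace M X B"
  shows "\<exists>g\<in>D_sets M. g \<inter> X = B - A" "\<exists>g\<in>D_sets M. g \<inter> X = X - (B - A)"
proof -
  obtain r where r: "r \<in> row_family M" "r \<inter> X = A" using assms unfolding row_trace_def by blast
  obtain s where s: "s \<in> row_family M" "s \<inter> X = B" using assms unfolding row_trace_def by blast
  have "s - r \<in> D_sets M" "- (s - r) \<in> D_sets M"
    unfolding two_sided_def using diff_in_D_family[OF r(1) s(1)] by auto
  moreover have "(s - r) \<inter> X = B - A" "(- (s - r)) \<inter> X = X - (B - A)" using r(2) s(2) by blast+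
  ultimately show "\<exists>g\<in>D_sets M. g \<inter> X = B - A" "\<exists>g\<in>D_sets M. g \<inter> X = X - (B - A)"
    by metis+
qed

lemma trace_cases:
  assumes "g \<in> D_sets M"
  obtains "row_trace M X (g \<inter> X)" | "row_trace M X (X - g)"
  | A B where "row_trace M X A" "row_trace M X B" "g \<inter> X = B - A"
  | A B where "row_trace M X A" "row_trace M X B" "X - g = B - A"
proof -
  have rt: "row_trace M X (h \<inter> X)" if "h \<in> row_family M" for h using that unfolding row_trace_def by blast
  have D: "row_trace M X (h \<inter> X) \<or> (\<exists>A B. row_trace M X A \<and> row_trace M X B \<and> h \<inter> X = B - A)" if h: "h \<in> D_family M" for h
  proof (rule D_family_cases[OF h])
    fix r s assume rs: "r \<in> row_family M" "s \<in> row_family M" "h = s - r"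
    have "h \<inter> X = s \<inter> X - r \<inter> X" unfolding rs(3) by blast
    then show ?thesis using rt rs by blast
  qed (use rt in blast)
  from assms consider "g \<in> D_family M" | h where "h \<in> D_family M" "g = - h" unfolding two_sided_def by blast
  then show thesis
  proof cases
    case 1
    then show thesis using D[OF 1] that(1,3) by blast
  next
    case 2
    have "X - g = h \<inter> X" using 2 by blast
    then show thesis using D[OF 2(1)] that(2,4) by metis
  qed
qed

lemma contains_star_M_I:
  assumes ts: "distinct ts" "3 \<le> length ts" "c \<notin> set ts" and cols: "insert c (set ts) \<subseteq> {..<dim_col M}"
    and rows: "\<And>e. e \<in> edge_set ts \<Longrightarrow> row_trace M (insert c (set ts)) e"
  shows "contains_configuration M (star_mat (M_I (length ts)))"
proof (rule contains_configurationI[of "(!) (ts @ [c])"])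
  let ?m = "length ts"
  have d: "distinct (ts @ [c])" using ts by simp
  then show "inj_on ((!) (ts @ [c])) {..<dim_col (star_mat (M_I ?m))}"
    by (simp add: inj_on_def nth_eq_iff_index_eq del: distinct_append)
  show "(!) (ts @ [c]) ` {..<dim_col (star_mat (M_I ?m))} \<subseteq> {..<dim_col M}"
    using cols by (auto simp: nth_append subset_iff)
  {
    fix i i' assume i: "i < dim_row (star_mat (M_I ?m))" "i' < dim_row (star_mat (M_I ?m))" "i \<noteq> i'"
    then have im: "i < ?m" "i' < ?m" by simp_all
    have "Suc i mod ?m < ?m" by (rule mod_less_divisor) (use im in linarith)
    moreover have "\<not> (i = Suc i' mod ?m \<and> i' = Suc i mod ?m)" using im ts(2) by (auto simp: mod_Suc split: if_splits)
    ultimately show "\<exists>j<dim_col (star_mat (M_I ?m)). star_mat (M_I ?m) $$ (i, j) \<noteq> star_mat (M_I ?m) $$ (i', j)"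
      using im i(3) by (metis M_I_dim(2) less_SucI less_imp_le star_M_I_index)
  }
  fix i assume "i < dim_row (star_mat (M_I ?m))"
  then have i: "i < ?m" by simp
  have si: "Suc i mod ?m < ?m" by (rule mod_less_divisor) (use i in linarith)
  obtain h where h: "h \<in> row_family M" "h \<inter> insert c (set ts) = {ts ! i, ts ! (Suc i mod ?m)}"
    using rows i unfolding row_trace_def edge_set_def by blast
  have "star_mat (M_I ?m) $$ (i, j) \<longleftrightarrow> (ts @ [c]) ! j \<in> h" if j: "j < dim_col (star_mat (M_I ?m))" for j
  proof (cases "j = ?m")
    case True
    then have "(ts @ [c]) ! j = c" by simp
    moreover have "c \<notin> h" using h(2) i si ts(3) by (metis Int_iff insertI1 insertE nth_mem singletonD)
    ultimately show ?thesis using True i si by (simp add: star_M_I_index)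
  next
    case False
    then have jm: "j < ?m" using j by simp
    then have "(ts @ [c]) ! j \<in> h \<longleftrightarrow> ts ! j \<in> h \<inter> insert c (set ts)" by (simp add: nth_append)
    also have "\<dots> \<longleftrightarrow> j = i \<or> j = Suc i mod ?m" unfolding h(2) using jm i si ts(1) by (simp add: nth_eq_iff_index_eq)
    finally show ?thesis using jm i by (simp add: star_M_I_index)
  qed
  then show "\<exists>h\<in>row_family M. \<forall>j<dim_col (star_mat (M_I ?m)). star_mat (M_I ?m) $$ (i, j) \<longleftrightarrow> (ts @ [c]) ! j \<in> h"
    using h(1) by blast
qed

locale cycle_core = minimal_noncircular "D_sets M" X
  for M :: "bool mat" and X :: "nat set" +
  fixes c :: nat and ts :: "nat list"
  assumes cols: "X \<subseteq> {..<dim_col M}" and obs: "cyc_obs (D_sets M) c ts" and X_eq: "X = insert c (set ts)"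
begin

text \<open>By \<open>cyc_obs_traces\<close>, these are the only traces on \<open>X\<close> that a
  member avoiding the centre can have.\<close>

definition admissible :: "nat set \<Rightarrow> bool" where
  "admissible A \<longleftrightarrow> A = set ts \<or> (\<exists>e\<in>edge_set ts. A \<subseteq> e)"

lemma ts: "distinct ts" "3 \<le> length ts" "c \<notin> set ts"
  using obs unfolding cyc_obs_def by auto

lemma card_ts: "card (set ts) = length ts"
  using ts distinct_card by blast

lemma admissible_trace: "g \<in> D_sets M \<Longrightarrow> g \<inter> X = A \<Longrightarrow> c \<notin> A \<Longrightarrow> admissible A"
  using cyc_obs_traces[OF obs X_eq, of g] X_eq unfolding admissible_def by blast

lemma admissible_row: "row_trace M X A \<Longrightarrow> c \<notin> A \<Longrightarrow> admissible A"
  using row_trace_in(1) admissible_trace by blast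

lemma admissible_corow: "row_trace M X (X - A) \<Longrightarrow> A \<subseteq> set ts \<Longrightarrow> admissible A"
proof -
  assume *: "row_trace M X (X - A)" "A \<subseteq> set ts"
  have "X - (X - A) = A" using * X_eq by blast
  then show "admissible A" using row_trace_in(2)[OF *(1)] admissible_trace[of _ A] * ts by auto
qed

lemma admissible_diff: "row_trace M X A \<Longrightarrow> row_trace M X B \<Longrightarrow> c \<notin> B - A \<Longrightarrow> admissible (B - A)"
  using row_trace_diff_in(1) admissible_trace by blast

text \<open>Subtracting the row \<open>A\<close> from the row \<open>X - B\<close> and complementing
  gives the union. This is the main restriction: a row and a complemented row can coexist only if
  their union is admissible.\<close>

lemma admissible_union:
  assumes "row_trace M X A" "row_trace M X (X - B)" "A \<subseteq> set ts" "B \<subseteq> set ts"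
  shows "admissible (A \<union> B)"
proof -
  have "X - (X - B - A) = A \<union> B" using assms X_eq by blast
  then show ?thesis using row_trace_diff_in(2)[OF assms(1,2)] admissible_trace[of _ "A \<union> B"] assms ts by auto
qed

lemma edge_card: "e \<in> edge_set ts \<Longrightarrow> card e = 2"
  using edge_set_card[of ts e] ts by simp

lemma edge_eq: "e \<in> edge_set ts \<Longrightarrow> e' \<in> edge_set ts \<Longrightarrow> e \<subseteq> e' \<Longrightarrow> e = e'"
  using edge_card by (metis card.infinite card_subset_eq zero_neq_numeral)

lemma corow_form:
  assumes "row_trace M X B" "c \<in> B"
  obtains A where "A \<subseteq> set ts" "B = X - A" "admissible A"
proof -
  have B: "B \<subseteq> X" by (rule row_trace_subset[OF assms(1)])
  then have "X - (X - B) = B" "X - B \<subseteq> set ts" using assms(2) X_eq by blast+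
  then show thesis using that[of "X - B"] admissible_corow[of "X - B"] assms(1) by simp
qed

text \<open>An admissible set that contains an edge is the edge or the whole cycle. If the edge
  arises as a difference, the whole cycle leads to the last two alternatives. If it arises from the
  complement of a difference, it is the union of a row and a complemented row, which may share it as
  in the third alternative.\<close>

lemma edge_realized:
  assumes e: "e \<in> edge_set ts" and m: "4 \<le> length ts"
  shows "row_trace M X e \<or> row_trace M X (X - e) \<or>
    (\<exists>u v. e = {u, v} \<and> row_trace M X {u} \<and> row_trace M X (X - {v})) \<or>
    row_trace M X {c} \<and> row_trace M X (X - (set ts - e)) \<or>
    row_trace M X (set ts) \<and> row_trace M X (set ts - e)"
proof -
  have esub: "e \<subseteq> set ts" by (rule edge_set_subset[OF e])
  have eX: "e \<subseteq> X" "c \<notin> e" using esub X_eq ts by auto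
  have ne: "e \<noteq> {}" "e \<noteq> set ts" using edge_card[OF e] card_ts m by auto
  have small: "A = e" if "admissible A" "e \<subseteq> A" "A \<noteq> set ts" for A
    using that edge_eq[OF e] unfolding admissible_def by blast
  obtain g where g: "g \<in> D_sets M" "g \<inter> X = e"
    using obs e X_eq unfolding cyc_obs_iff by auto
  have Xg: "X - g = X - e" using g(2) by blast
  from g(1) show ?thesis
  proof (cases rule: trace_cases[where X = X])
    case 1
    then show ?thesis using g(2) by simp
  next
    case 2
    then show ?thesis using Xg by simp
  next
    case (3 A B)
    have eBA: "e = B - A" using 3(3) g(2) by simp
    show ?thesis
    proof (cases "c \<in> B")
      case True
      then have "c \<in> A" using eBA eX by blast
      obtain A' where A': "A' \<subseteq> set ts" "A = X - A'" "admissible A'" using corow_form[OF 3(1) \<open>c \<in> A\<close>] by blast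
      obtain B' where B': "B' \<subseteq> set ts" "B = X - B'" "admissible B'" using corow_form[OF 3(2) True] by blast
      have eA: "e = A' - B'" using eBA A' B' X_eq by blast
      show ?thesis
      proof (cases "A' = set ts")
        case True
        then have "A = {c}" "B' = set ts - e" using A' B' eA X_eq ts by auto
        then show ?thesis using 3 B' by simp
      next
        case False
        then have "A' = e" using small[OF A'(3)] eA by blast
        then show ?thesis using A' 3(1) by simp
      qed
    next
      case False
      then have B: "admissible B" "B \<subseteq> set ts" using admissible_row[OF 3(2)] row_trace_subset[OF 3(2)] X_eq by auto
      show ?thesis
      proof (cases "B = set ts")
        case False
        then have "B = e" using small[OF B(1)] eBA by blast
        then show ?thesis using 3 by simp
      next
        case Y: True
        show ?thesis
        proof (cases "c \<in> A")
          case True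
          then have "A = X - e" using eBA Y row_trace_subset[OF 3(1)] X_eq by blast
          then show ?thesis using 3 by simp
        next
          case False
          then have "A = set ts - e" using eBA Y row_trace_subset[OF 3(1)] X_eq by blast
          then show ?thesis using 3 Y by simp
        qed
      qed
    qed
  next
    case (4 A B)
    have BA: "B - A = X - e" using 4(3) Xg by simp
    then have cB: "c \<in> B" "c \<notin> A" using eX X_eq by blast+
    obtain B' where B': "B' \<subseteq> set ts" "B = X - B'" "admissible B'" using corow_form[OF 4(2) cB(1)] by blast
    have A: "A \<subseteq> set ts" using row_trace_subset[OF 4(1)] cB X_eq by blast
    have un: "e = A \<union> B'" using BA B' A esub X_eq by blast
    obtain u v where uv: "e = {u, v}" "u \<noteq> v" using edge_card[OF e] by (meson card_2_iff)
    have sub: "A \<subseteq> {u, v}" "B' \<subseteq> {u, v}" "{u, v} \<subseteq> A \<union> B'" using un uv(1) by auto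
    have pow: "S = {} \<or> S = {u} \<or> S = {v} \<or> S = {u, v}" if "S \<subseteq> {u, v}" for S
      using that by (cases "u \<in> S"; cases "v \<in> S") auto
    consider "A = e" | "B' = e" | "A = {u}" "B' = {v}" | "A = {v}" "B' = {u}"
      using pow[OF sub(1)] pow[OF sub(2)] sub(3) uv by (elim disjE) simp_all
    then have "row_trace M X e \<or> row_trace M X (X - e) \<or>
      row_trace M X {u} \<and> row_trace M X (X - {v}) \<or> row_trace M X {v} \<and> row_trace M X (X - {u})"
      by cases (use 4(1,2) B'(2) in simp_all)
    then show ?thesis using uv(1) by (metis insert_commute)
  qed
qed

end

lemma row_family_complement: "row_family (complement_mat M) = (\<lambda>h. {..<dim_col M} - h) ` row_family M"
proof -
  have "dim_row (complement_mat M) = dim_row M" by (simp add: complement_mat_def)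
  then show ?thesis unfolding row_family_def image_image by (auto simp: row_set_complement)
qed

lemma row_trace_complement:
  assumes "X \<subseteq> {..<dim_col M}" "row_trace M X (X - A)" "A \<subseteq> X"
  shows "row_trace (complement_mat M) X A"
proof -
  obtain h where h: "h \<in> row_family M" "h \<inter> X = X - A" using assms(2) unfolding row_trace_def by blast
  have "({..<dim_col M} - h) \<inter> X = A" using assms(1,3) h(2) by blast
  then show ?thesis unfolding row_trace_def row_family_complement using h(1) by blast
qed

lemma contains_complement:
  assumes "contains_configuration (complement_mat M) N"
  shows "contains_configuration M (complement_mat N)"
proof -
  have d: "dim_row (complement_mat A) = dim_row A" "dim_col (complement_mat A) = dim_col A" for A
    by (simp_all add: complement_mat_def)
  obtain r c where rc: "inj_on r {..<dim_row N}" "r ` {..<dim_row N} \<subseteq> {..<dim_row M}"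
      "inj_on c {..<dim_col N}" "c ` {..<dim_col N} \<subseteq> {..<dim_col M}"
      "\<forall>i<dim_row N. \<forall>j<dim_col N. N $$ (i, j) = complement_mat M $$ (r i, c j)"
    using assms unfolding contains_configuration_iff d by (elim exE conjE)
  have "complement_mat N $$ (i, j) = M $$ (r i, c j)" if ij: "i < dim_row N" "j < dim_col N" for i j
  proof -
    have "r i < dim_row M" "c j < dim_col M" using rc(2,4) ij by auto
    then show ?thesis using rc(5) ij unfolding complement_mat_def by simp
  qed
  then show ?thesis unfolding contains_configuration_iff d using rc(1-4)
    by (intro exI[of _ r] exI[of _ c]) simp
qed

definition ones :: "'a list \<Rightarrow> nat list \<Rightarrow> 'a set" where
  "ones cs b = set (map fst (filter (\<lambda>(c, v). v = 1) (zip cs b)))"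

lemma ones_simps [simp]:
  "ones [] b = {}"
  "ones (c # cs) (v # b) = (if v = 1 then insert c (ones cs b) else ones cs b)"
  unfolding ones_def by simp_all

lemma nth_in_ones:
  assumes "distinct cs" "length b = length cs" "j < length cs"
  shows "cs ! j \<in> ones cs b \<longleftrightarrow> b ! j = 1"
proof -
  have "cs ! j \<in> ones cs b \<longleftrightarrow> (cs ! j, 1) \<in> set (zip cs b)" unfolding ones_def by force
  also have "\<dots> \<longleftrightarrow> b ! j = 1" using assms unfolding in_set_zip by (auto simp: nth_eq_iff_index_eq)
  finally show ?thesis .
qed

lemma contains_bin_mat:
  assumes rows: "\<forall>b\<in>set rs. row_trace M (set cs) (ones cs b)"
    and cs: "distinct cs" "set cs \<subseteq> {..<dim_col M}" "length cs = n"
    and rs: "distinct rs" "\<forall>b\<in>set rs. length b = n \<and> set b \<subseteq> {0, 1}"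
  shows "contains_configuration M (bin_mat n rs)"
proof (rule contains_configurationI[of "(!) cs"])
  show "inj_on ((!) cs) {..<dim_col (bin_mat n rs)}" using cs by (simp add: inj_on_def nth_eq_iff_index_eq)
  show "(!) cs ` {..<dim_col (bin_mat n rs)} \<subseteq> {..<dim_col M}" using cs by (auto simp: subset_iff)
next
  fix i i' assume "i < dim_row (bin_mat n rs)" "i' < dim_row (bin_mat n rs)" "i \<noteq> i'"
  then have i: "i < length rs" "i' < length rs" "rs ! i \<noteq> rs ! i'" using rs(1) by (simp_all add: nth_eq_iff_index_eq)
  then have len: "length (rs ! i) = n" "length (rs ! i') = n" and bits: "set (rs ! i) \<subseteq> {0, 1}" "set (rs ! i') \<subseteq> {0, 1}"
    using rs(2) by simp_all
  obtain j where j: "j < n" "rs ! i ! j \<noteq> rs ! i' ! j" using i(3) len by (metis nth_equalityI)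
  then have "rs ! i ! j \<in> {0, 1}" "rs ! i' ! j \<in> {0, 1}" using bits len by (metis nth_mem subsetD)+
  then have "(rs ! i ! j = 1) \<noteq> (rs ! i' ! j = 1)" using j by auto
  then show "\<exists>j<dim_col (bin_mat n rs). bin_mat n rs $$ (i, j) \<noteq> bin_mat n rs $$ (i', j)"
    using i j by (intro exI[of _ j]) (simp add: bin_mat_index)
next
  fix i assume "i < dim_row (bin_mat n rs)"
  then have i: "i < length rs" by simp
  then have "row_trace M (set cs) (ones cs (rs ! i))" using rows by simp
  then obtain h where h: "h \<in> row_family M" "h \<inter> set cs = ones cs (rs ! i)" unfolding row_trace_def by blast
  have "bin_mat n rs $$ (i, j) \<longleftrightarrow> cs ! j \<in> h" if j: "j < n" for j
  proof -
    have "cs ! j \<in> h \<longleftrightarrow> cs ! j \<in> ones cs (rs ! i)" using h(2) cs(3) j by (metis IntD1 IntI nth_mem)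
    also have "\<dots> \<longleftrightarrow> rs ! i ! j = 1" by (rule nth_in_ones) (use cs rs(2) i j in simp_all)
    finally show ?thesis using i j by (simp add: bin_mat_index)
  qed
  then show "\<exists>h\<in>row_family M. \<forall>j<dim_col (bin_mat n rs). bin_mat n rs $$ (i, j) \<longleftrightarrow> cs ! j \<in> h"
    using h(1) by auto
qed

section \<open>Matrices with four columns\<close>

lemma star_M_I_3:
  "star_mat (M_I 3) = bin_mat 4 [[1,1,0,0], [0,1,1,0], [1,0,1,0]]"
proof (rule eq_matI)
  let ?N = "bin_mat 4 [[1,1,0,0], [0,1,1,0], [1,0,1,0]]"
  fix i j assume "i < dim_row ?N" "j < dim_col ?N"
  then have "i \<in> {0, 1, 2}" "j \<in> {0, 1, 2, 3}" by auto
  then show "star_mat (M_I 3) $$ (i, j) = ?N $$ (i, j)"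
    by (elim insertE emptyE) (simp_all add: star_M_I_index bin_mat_index)
qed simp_all

lemma complement_star_M_I_3:
  "complement_mat (star_mat (M_I 3)) = bin_mat 4 [[0,0,1,1], [1,0,0,1], [0,1,0,1]]"
  unfolding star_M_I_3 by (simp add: complement_bin_mat)

text \<open>In the following, \<open>S x\<close>, \<open>P x y\<close> and \<open>Q x\<close> say that the singleton of \<open>x\<close>, the pair of \<open>x\<close> and \<open>y\<close>
  and the complement of the singleton of \<open>x\<close> are traces of rows on a set of four columns. The disjuncts are the
  matrices with four columns in the list of forbidden configurations.\<close>

definition four_obs :: "('a \<Rightarrow> bool) \<Rightarrow> ('a \<Rightarrow> 'a \<Rightarrow> bool) \<Rightarrow> ('a \<Rightarrow> bool) \<Rightarrow> 'a \<Rightarrow> 'a \<Rightarrow> 'a \<Rightarrow> 'a \<Rightarrow> bool" where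
  "four_obs S P Q a b c d \<longleftrightarrow>
     Q d \<and> S a \<and> S b \<and> S c \<or> S a \<and> P a b \<and> Q d \<and> S b \<or> S a \<and> P a b \<and> Q d \<and> P a c \<or>
     P a d \<and> P a b \<and> Q d \<and> S b \<or> Q d \<and> Q a \<and> S c \<and> S a \<or> Q d \<and> P a d \<and> S b \<and> S c \<or>
     Q d \<and> P a d \<and> P b d \<and> S c \<or> S d \<and> Q a \<and> Q b \<and> Q c \<or> Q a \<and> P c d \<and> S d \<and> Q b \<or>
     S d \<and> P b c \<and> Q b \<and> Q c \<or> P a b \<and> P b c \<and> P a c \<or> P c d \<and> P a d \<and> P b d"

text \<open>Each hypothesis lists the ways in which rows can realize one of the three splits of the
  four columns into pairs. The rest is a finite propositional check over all 24 arrangements of the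
  columns.\<close>

lemma four_obs_complete:
  assumes sym: "\<And>a b. P a b = P b a" and d: "distinct [x, y, z, w]"
    and pairs: "P x y \<or> P z w \<or> S x \<and> Q y \<or> S y \<and> Q x \<or> S z \<and> Q w \<or> S w \<and> Q z"
      "P x z \<or> P y w \<or> S x \<and> Q z \<or> S z \<and> Q x \<or> S y \<and> Q w \<or> S w \<and> Q y"
      "P x w \<or> P y z \<or> S x \<and> Q w \<or> S w \<and> Q x \<or> S y \<and> Q z \<or> S z \<and> Q y"
  shows "\<exists>a b c d. distinct [a, b, c, d] \<and> {a, b, c, d} = {x, y, z, w} \<and> four_obs S P Q a b c d"
proof (rule ccontr)
  assume neg: "\<not> ?thesis"
  have n: "\<not> four_obs S P Q a b c d" if "distinct [a, b, c, d]" "{a, b, c, d} = {x, y, z, w}" for a b c d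
    using neg that by blast
  have "\<not> four_obs S P Q x y z w" "\<not> four_obs S P Q x y w z" "\<not> four_obs S P Q x z y w" "\<not> four_obs S P Q x z w y"
    "\<not> four_obs S P Q x w y z" "\<not> four_obs S P Q x w z y" "\<not> four_obs S P Q y x z w" "\<not> four_obs S P Q y x w z"
    "\<not> four_obs S P Q y z x w" "\<not> four_obs S P Q y z w x" "\<not> four_obs S P Q y w x z" "\<not> four_obs S P Q y w z x"
    "\<not> four_obs S P Q z x y w" "\<not> four_obs S P Q z x w y" "\<not> four_obs S P Q z y x w" "\<not> four_obs S P Q z y w x"
    "\<not> four_obs S P Q z w x y" "\<not> four_obs S P Q z w y x" "\<not> four_obs S P Q w x y z" "\<not> four_obs S P Q w x z y"
    "\<not> four_obs S P Q w y x z" "\<not> four_obs S P Q w y z x" "\<not> four_obs S P Q w z x y" "\<not> four_obs S P Q w z y x"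
    by (rule n; use d in auto)+
  moreover have "P y x = P x y" "P z x = P x z" "P w x = P x w" "P z y = P y z" "P w y = P y w" "P w z = P z w"
    using sym by blast+
  ultimately show False using pairs unfolding four_obs_def by (smt (verit))
qed

lemma M_I_in_inf:
  "3 \<le> k \<Longrightarrow> star_mat (M_I k) \<in> F_Dcirc_inf" "3 \<le> k \<Longrightarrow> complement_mat (star_mat (M_I k)) \<in> F_Dcirc_inf"
  unfolding F_Dcirc_inf_def by auto

lemma configuration_in_list:
  assumes "N \<in> F_Dcirc_inf" "N = bin_mat n rs" "\<forall>b\<in>set rs. row_trace M (set cs) (ones cs b)"
    "distinct cs" "set cs \<subseteq> {..<dim_col M}" "length cs = n"
    "distinct rs" "\<forall>b\<in>set rs. length b = n \<and> set b \<subseteq> {0, 1}"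
  shows "\<exists>N\<in>F_Dcirc_inf. contains_configuration M N"
  using contains_bin_mat[OF assms(3-8)] assms(1,2) by blast

lemma four_obs_configuration:
  assumes o: "four_obs (\<lambda>x. row_trace M X {x}) (\<lambda>x y. row_trace M X {x, y}) (\<lambda>x. row_trace M X (X - {x})) a b c d"
    and d: "distinct [a, b, c, d]" and X: "X = {a, b, c, d}" "X \<subseteq> {..<dim_col M}"
  shows "\<exists>N\<in>F_Dcirc_inf. contains_configuration M N"
proof -
  have co: "X - {a} = {b, c, d}" "X - {b} = {a, c, d}" "X - {c} = {a, b, d}" "X - {d} = {a, b, c}"
    using d X(1) by auto
  note conf = configuration_in_list[where cs = "[a, b, c, d]" and M = M]
  from o consider
      (1) "row_trace M X (X - {d})" "row_trace M X {a}" "row_trace M X {b}" "row_trace M X {c}"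
    | (2) "row_trace M X {a}" "row_trace M X {a, b}" "row_trace M X (X - {d})" "row_trace M X {b}"
    | (3) "row_trace M X {a}" "row_trace M X {a, b}" "row_trace M X (X - {d})" "row_trace M X {a, c}"
    | (4) "row_trace M X {a, d}" "row_trace M X {a, b}" "row_trace M X (X - {d})" "row_trace M X {b}"
    | (5) "row_trace M X (X - {d})" "row_trace M X (X - {a})" "row_trace M X {c}" "row_trace M X {a}"
    | (6) "row_trace M X (X - {d})" "row_trace M X {a, d}" "row_trace M X {b}" "row_trace M X {c}"
    | (7) "row_trace M X (X - {d})" "row_trace M X {a, d}" "row_trace M X {b, d}" "row_trace M X {c}"
    | (8) "row_trace M X {d}" "row_trace M X (X - {a})" "row_trace M X (X - {b})" "row_trace M X (X - {c})"
    | (9) "row_trace M X (X - {a})" "row_trace M X {c, d}" "row_trace M X {d}" "row_trace M X (X - {b})"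
    | (10) "row_trace M X {d}" "row_trace M X {b, c}" "row_trace M X (X - {b})" "row_trace M X (X - {c})"
    | (11) "row_trace M X {a, b}" "row_trace M X {b, c}" "row_trace M X {a, c}"
    | (12) "row_trace M X {c, d}" "row_trace M X {a, d}" "row_trace M X {b, d}"
    unfolding four_obs_def by argo
  then show ?thesis
  proof cases
    case 1
    show ?thesis by (rule conf[OF _ F_Dcirc_explicit(1)]) (use 1 d X co in \<open>simp_all add: F_Dcirc_inf_def F_Dcirc_def insert_commute\<close>)
  next
    case 2
    show ?thesis by (rule conf[OF _ F_Dcirc_explicit(2)]) (use 2 d X co in \<open>simp_all add: F_Dcirc_inf_def F_Dcirc_def insert_commute\<close>)
  next
    case 3
    show ?thesis by (rule conf[OF _ F_Dcirc_explicit(3)]) (use 3 d X co in \<open>simp_all add: F_Dcirc_inf_def F_Dcirc_def insert_commute\<close>)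
  next
    case 4
    show ?thesis by (rule conf[OF _ F_Dcirc_explicit(5)]) (use 4 d X co in \<open>simp_all add: F_Dcirc_inf_def F_Dcirc_def insert_commute\<close>)
  next
    case 5
    show ?thesis by (rule conf[OF _ F_Dcirc_explicit(6)]) (use 5 d X co in \<open>simp_all add: F_Dcirc_inf_def F_Dcirc_def insert_commute\<close>)
  next
    case 6
    show ?thesis by (rule conf[OF _ F_Dcirc_explicit(7)]) (use 6 d X co in \<open>simp_all add: F_Dcirc_inf_def F_Dcirc_def insert_commute\<close>)
  next
    case 7
    show ?thesis by (rule conf[OF _ F_Dcirc_explicit(8)]) (use 7 d X co in \<open>simp_all add: F_Dcirc_inf_def F_Dcirc_def insert_commute\<close>)
  next
    case 8
    show ?thesis by (rule conf[OF _ F_Dcirc_explicit(10)]) (use 8 d X co in \<open>simp_all add: F_Dcirc_inf_def F_Dcirc_def insert_commute\<close>)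
  next
    case 9
    show ?thesis by (rule conf[OF _ F_Dcirc_explicit(11)]) (use 9 d X co in \<open>simp_all add: F_Dcirc_inf_def F_Dcirc_def insert_commute\<close>)
  next
    case 10
    show ?thesis by (rule conf[OF _ F_Dcirc_explicit(13)]) (use 10 d X co in \<open>simp_all add: F_Dcirc_inf_def F_Dcirc_def insert_commute\<close>)
  next
    case 11
    show ?thesis by (rule conf[OF _ star_M_I_3]) (use 11 d X co in \<open>simp_all add: M_I_in_inf insert_commute\<close>)
  next
    case 12
    show ?thesis by (rule conf[OF _ complement_star_M_I_3]) (use 12 d X co in \<open>simp_all add: M_I_in_inf insert_commute\<close>)
  qed
qed

text \<open>A pair and the opposite pair are interchangeable. If the pair is a difference
  \<open>B - A\<close>, then each other column of \<open>B\<close> lies in \<open>A\<close>: so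
  \<open>B\<close> is the pair, or \<open>A\<close> is the opposite pair, or one other column lies
  in both sets and the last one in neither.\<close>

lemma pair_trace_cases:
  assumes g: "g \<in> D_sets M" "g \<inter> X = {x, y}" and d: "distinct [x, y, z, w]" and X: "X = {x, y, z, w}"
  shows "row_trace M X {x, y} \<or> row_trace M X {z, w} \<or> row_trace M X {x} \<and> row_trace M X (X - {y}) \<or>
    row_trace M X {y} \<and> row_trace M X (X - {x}) \<or> row_trace M X {z} \<and> row_trace M X (X - {w}) \<or>
    row_trace M X {w} \<and> row_trace M X (X - {z})"
proof -
  have diff: "B = {a, b} \<or> A = {e, f} \<or> A = {e} \<and> B = X - {f} \<or> A = {f} \<and> B = X - {e}"
    if "A \<subseteq> X" "B \<subseteq> X" "B - A = {a, b}" "X = {a, b, e, f}" "distinct [a, b, e, f]" for A B a b e f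
  proof -
    have ab: "a \<in> B" "b \<in> B" "a \<notin> A" "b \<notin> A" "e \<in> B \<longrightarrow> e \<in> A" "f \<in> B \<longrightarrow> f \<in> A" using that(3,5) by auto
    then have "A \<subseteq> {e, f}" "B \<subseteq> {a, b, e, f}" using that(1,2,4) by auto
    moreover have "e \<in> B \<Longrightarrow> f \<notin> B \<Longrightarrow> B = X - {f}" "e \<notin> B \<Longrightarrow> f \<in> B \<Longrightarrow> B = X - {e}"
      using ab(1,2) that(2,4,5) by auto
    moreover have "e \<in> A \<Longrightarrow> A = {e} \<or> A = {e, f}" "f \<in> A \<Longrightarrow> A = {f} \<or> A = {e, f}"
      using calculation(1) by blast+
    moreover have "e \<notin> B \<Longrightarrow> f \<notin> B \<Longrightarrow> B = {a, b}" "e \<in> A \<Longrightarrow> f \<in> A \<Longrightarrow> A = {e, f}"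
      using calculation(1,2) ab(1,2) by blast+
    ultimately show ?thesis using ab(5,6) by metis
  qed
  have Xg: "X - g = {z, w}" using g(2) d X by auto
  from g(1) show ?thesis
  proof (cases rule: trace_cases[where X = X])
    case (3 A B)
    note sub = row_trace_subset[OF 3(1)] row_trace_subset[OF 3(2)]
    have "B - A = {x, y}" using 3(3) g(2) by simp
    from diff[OF sub this X d] show ?thesis using 3(1,2) by auto
  next
    case (4 A B)
    note sub = row_trace_subset[OF 4(1)] row_trace_subset[OF 4(2)]
    have "B - A = {z, w}" using 4(3) Xg by simp
    moreover have "X = {z, w, x, y}" "distinct [z, w, x, y]" using X d by auto
    ultimately show ?thesis using diff[OF sub, of z w x y] 4(1,2) by auto
  qed (use g(2) Xg in simp_all)
qed

text \<open>For the vertices 1 to 4 of the cycle, \<open>p\<close> and \<open>q\<close> stand for an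
  edge that is a row or a complemented row, \<open>s\<close> and \<open>t\<close> for the same with
  a vertex; \<open>y\<close> and \<open>k\<close> stand for the whole cycle and the centre as rows.
  The first group of hypotheses collects the inadmissible combinations, the second the ways to
  realize the four edges.\<close>

lemma four_cycle_cases:
  fixes s1 :: bool
  assumes ex: "\<not> (s1 \<and> t3)" "\<not> (s3 \<and> t1)" "\<not> (s2 \<and> t4)" "\<not> (s4 \<and> t2)"
   "\<not> (s3 \<and> q12)" "\<not> (s4 \<and> q12)" "\<not> (s1 \<and> q23)" "\<not> (s4 \<and> q23)" "\<not> (s1 \<and> q34)" "\<not> (s2 \<and> q34)" "\<not> (s2 \<and> q41)" "\<not> (s3 \<and> q41)"
   "\<not> (p12 \<and> t3)" "\<not> (p12 \<and> t4)" "\<not> (p23 \<and> t1)" "\<not> (p23 \<and> t4)" "\<not> (p34 \<and> t1)" "\<not> (p34 \<and> t2)" "\<not> (p41 \<and> t2)" "\<not> (p41 \<and> t3)"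
   "\<not> (p12 \<and> q23)" "\<not> (p12 \<and> q41)" "\<not> (p23 \<and> q12)" "\<not> (p23 \<and> q34)" "\<not> (p34 \<and> q23)" "\<not> (p34 \<and> q41)" "\<not> (p41 \<and> q34)" "\<not> (p41 \<and> q12)"
   "\<not> (y \<and> (s1 \<or> s2 \<or> s3 \<or> s4))" "\<not> (k \<and> (t1 \<or> t2 \<or> t3 \<or> t4))"
  and re: "p12 \<or> q12 \<or> s1 \<and> t2 \<or> s2 \<and> t1 \<or> k \<and> q34 \<or> y \<and> p34"
   "p23 \<or> q23 \<or> s2 \<and> t3 \<or> s3 \<and> t2 \<or> k \<and> q41 \<or> y \<and> p41"
   "p34 \<or> q34 \<or> s3 \<and> t4 \<or> s4 \<and> t3 \<or> k \<and> q12 \<or> y \<and> p12"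
   "p41 \<or> q41 \<or> s4 \<and> t1 \<or> s1 \<and> t4 \<or> k \<and> q23 \<or> y \<and> p23"
  shows "p12 \<and> p23 \<and> p34 \<and> p41 \<or> q12 \<and> q23 \<and> q34 \<and> q41 \<or>
     k \<and> (q12 \<and> q23 \<or> q23 \<and> q34 \<or> q34 \<and> q41 \<or> q41 \<and> q12) \<or> y \<and> (p12 \<and> p23 \<or> p23 \<and> p34 \<or> p34 \<and> p41 \<or> p41 \<and> p12) \<or>
     s1 \<and> s3 \<and> t2 \<and> t4 \<or> s2 \<and> s4 \<and> t1 \<and> t3"
  using assms by argo

lemma edge_set_3: "edge_set [x, y, z] = {{x, y}, {y, z}, {z, x}}"
proof -
  have "{..<length [x, y, z]} = {0, 1, 2}" by auto
  then show ?thesis unfolding edge_set_def by simp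
qed

lemma edge_set_4: "edge_set [a, b, d, e] = {{a, b}, {b, d}, {d, e}, {e, a}}"
proof -
  have "{..<length [a, b, d, e]} = {0, 1, 2, 3}" by auto
  then show ?thesis unfolding edge_set_def by simp
qed

context cycle_core begin

text \<open>The edges of a triangle with a centre are the three splits of four columns into
  pairs.\<close>

lemma three_cycle_configuration:
  assumes "length ts = 3"
  shows "\<exists>N\<in>F_Dcirc_inf. contains_configuration M N"
proof -
  obtain x y z where t: "ts = [x, y, z]" using assms by (auto simp: length_Suc_conv numeral_3_eq_3)
  have d: "distinct [x, y, z, c]" using ts t by auto
  have X: "X = {x, y, z, c}" using X_eq t by auto
  have E: "edge_set ts = {{x, y}, {y, z}, {z, x}}" unfolding t by (rule edge_set_3)
  have g: "\<exists>g\<in>D_sets M. g \<inter> X = e" if "e \<in> edge_set ts" for e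
    using that obs X_eq unfolding cyc_obs_iff by simp
  obtain g1 where g1: "g1 \<in> D_sets M" "g1 \<inter> X = {x, y}" using g[of "{x, y}"] E by auto
  obtain g2 where g2: "g2 \<in> D_sets M" "g2 \<inter> X = {y, z}" using g[of "{y, z}"] E by auto
  obtain g3 where g3: "g3 \<in> D_sets M" "g3 \<inter> X = {x, z}" using g[of "{z, x}"] E by (auto simp: insert_commute)
  note p1 = pair_trace_cases[OF g1 d X]
  have p2: "row_trace M X {x, z} \<or> row_trace M X {y, c} \<or> row_trace M X {x} \<and> row_trace M X (X - {z}) \<or>
      row_trace M X {z} \<and> row_trace M X (X - {x}) \<or> row_trace M X {y} \<and> row_trace M X (X - {c}) \<or>
      row_trace M X {c} \<and> row_trace M X (X - {y})"
    by (rule pair_trace_cases[OF g3]) (use d X in auto)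
  have p3: "row_trace M X {y, z} \<or> row_trace M X {x, c} \<or> row_trace M X {y} \<and> row_trace M X (X - {z}) \<or>
      row_trace M X {z} \<and> row_trace M X (X - {y}) \<or> row_trace M X {x} \<and> row_trace M X (X - {c}) \<or>
      row_trace M X {c} \<and> row_trace M X (X - {x})"
    by (rule pair_trace_cases[OF g2]) (use d X in auto)
  let ?S = "\<lambda>x. row_trace M X {x}" and ?P = "\<lambda>x y. row_trace M X {x, y}" and ?Q = "\<lambda>x. row_trace M X (X - {x})"
  have sym: "?P a b = ?P b a" for a b by (simp add: insert_commute)
  have p3': "?P x c \<or> ?P y z \<or> ?S x \<and> ?Q c \<or> ?S c \<and> ?Q x \<or> ?S y \<and> ?Q z \<or> ?S z \<and> ?Q y" using p3 by argo
  obtain a b e f where "distinct [a, b, e, f]" "{a, b, e, f} = {x, y, z, c}" "four_obs ?S ?P ?Q a b e f"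
    using four_obs_complete[of ?P x y z c ?S ?Q, OF sym d p1 p2 p3'] by blast
  then show ?thesis using four_obs_configuration X cols by metis
qed

end

section \<open>Cycles with at least four vertices\<close>

lemma Z4_configuration:
  assumes "row_trace M X {p, q, c}" "row_trace M X {q, c, r}" "row_trace M X {c}"
    and d: "distinct [p, q, c, r, s]" and X: "X = {p, q, c, r, s}" "X \<subseteq> {..<dim_col M}"
  shows "\<exists>N\<in>F_Dcirc_inf. contains_configuration M N"
  by (rule configuration_in_list[OF _ F_Dcirc_explicit(4), where cs = "[p, q, c, r, s]"])
    (use assms in \<open>simp_all add: F_Dcirc_inf_def F_Dcirc_def\<close>)

lemma complement_Z4_configuration:
  assumes "row_trace M X {r, s}" "row_trace M X {p, s}" "row_trace M X {p, q, r, s}"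
    and d: "distinct [p, q, c, r, s]" and X: "X = {p, q, c, r, s}" "X \<subseteq> {..<dim_col M}"
  shows "\<exists>N\<in>F_Dcirc_inf. contains_configuration M N"
  by (rule configuration_in_list[OF _ F_Dcirc_explicit(12), where cs = "[p, q, c, r, s]"])
    (use assms in \<open>simp_all add: F_Dcirc_inf_def F_Dcirc_def\<close>)

lemma Z8_configuration:
  assumes "row_trace M X {p, c, r, u}" "row_trace M X {c, r, s, u}" "row_trace M X {r}" "row_trace M X {u}"
    and d: "distinct [p, c, r, s, u]" and X: "X = {p, c, r, s, u}" "X \<subseteq> {..<dim_col M}"
  shows "\<exists>N\<in>F_Dcirc_inf. contains_configuration M N"
  by (rule configuration_in_list[OF _ F_Dcirc_explicit(9), where cs = "[p, c, r, s, u]"])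
    (use assms in \<open>simp_all add: F_Dcirc_inf_def F_Dcirc_def\<close>)

context cycle_core begin

lemma all_edges_rows:
  assumes "\<And>e. e \<in> edge_set ts \<Longrightarrow> row_trace M X e"
  shows "\<exists>N\<in>F_Dcirc_inf. contains_configuration M N"
proof -
  have "contains_configuration M (star_mat (M_I (length ts)))"
    using contains_star_M_I[OF ts] cols assms unfolding X_eq by blast
  then show ?thesis using M_I_in_inf ts(2) by blast
qed

text \<open>In the complementary matrix the edges are rows.\<close>

lemma all_edges_corows:
  assumes "\<And>e. e \<in> edge_set ts \<Longrightarrow> row_trace M X (X - e)"
  shows "\<exists>N\<in>F_Dcirc_inf. contains_configuration M N"
proof -
  have "row_trace (complement_mat M) X e" if "e \<in> edge_set ts" for e
    using row_trace_complement[OF cols assms[OF that]] edge_set_subset[OF that] X_eq by blast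
  moreover have "insert c (set ts) \<subseteq> {..<dim_col (complement_mat M)}"
    using cols X_eq by (simp add: complement_mat_def)
  ultimately have "contains_configuration (complement_mat M) (star_mat (M_I (length ts)))"
    using contains_star_M_I[OF ts] X_eq by blast
  then have "contains_configuration M (complement_mat (star_mat (M_I (length ts))))" by (rule contains_complement)
  then show ?thesis using M_I_in_inf ts(2) by blast
qed

text \<open>The complement of an edge in the cycle is an edge here, so all alternatives of
  \<open>edge_realized\<close> are possible. Inadmissible are just the sets of two opposite vertices
  and of three vertices, and excluding them leaves the patterns of \<open>M_I 4\<close>,
  \<open>Z4\<close>, their complements, and \<open>Z8\<close>.\<close>

lemma four_cycle_configuration:
  assumes "length ts = 4"
  shows "\<exists>N\<in>F_Dcirc_inf. contains_configuration M N"
proof -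
  obtain a b d e where t: "ts = [a, b, d, e]" using assms by (auto simp: length_Suc_conv numeral_eq_Suc)
  have dist: "distinct [a, b, d, e, c]" using ts t by auto
  have X: "X = {a, b, d, e, c}" using X_eq t by auto
  have Y: "set ts = {a, b, d, e}" using t by simp
  have E: "edge_set ts = {{a, b}, {b, d}, {d, e}, {e, a}}" unfolding t by (rule edge_set_4)
  let ?T = "row_trace M X"
  have adm: "admissible A \<longleftrightarrow> A = {a, b, d, e} \<or> A \<subseteq> {a, b} \<or> A \<subseteq> {b, d} \<or> A \<subseteq> {d, e} \<or> A \<subseteq> {e, a}" for A
    unfolding admissible_def E Y by simp
  have bad: "\<not> admissible {a, d}" "\<not> admissible {b, e}" "\<not> admissible {a, b, d}" "\<not> admissible {b, d, e}"
    "\<not> admissible {a, d, e}" "\<not> admissible {a, b, e}"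
    unfolding adm using dist by auto
  have un: "\<not> (?T A \<and> ?T (X - B))" if "A \<subseteq> {a, b, d, e}" "B \<subseteq> {a, b, d, e}" "\<not> admissible (A \<union> B)" for A B
    using admissible_union[of A B] that Y by blast
  have sing: "\<not> (?T {x} \<and> ?T (X - {y}))" if "x \<in> {a, b, d, e}" "y \<in> {a, b, d, e}" "\<not> admissible {x, y}" for x y
    using un[of "{x}" "{y}"] that by (simp add: insert_commute)
  have tri: "\<not> (?T A \<and> ?T (X - B))" if "A \<subseteq> {a, b, d, e}" "B \<subseteq> {a, b, d, e}"
    "A \<union> B \<in> {{a, b, d}, {b, d, e}, {a, d, e}, {a, b, e}}" for A B
    using un[OF that(1,2)] that(3) bad by auto
  have u: "?T {a, b, d, e} \<Longrightarrow> ?T {x} \<Longrightarrow> x \<in> {a, b, d, e} \<Longrightarrow> False" for x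
    using admissible_diff[of "{x}" "{a, b, d, e}"] bad dist by (auto simp: insert_Diff_if insert_commute)
  have k: "?T {c} \<Longrightarrow> ?T (X - {x}) \<Longrightarrow> x \<in> {a, b, d, e} \<Longrightarrow> False" for x
  proof -
    assume *: "?T {c}" "?T (X - {x})" "x \<in> {a, b, d, e}"
    have "X - {x} - {c} = {a, b, d, e} - {x}" using X dist by auto
    then have "admissible ({a, b, d, e} - {x})" using admissible_diff[OF *(1,2)] dist by auto
    then show False using *(3) bad dist by (auto simp: insert_Diff_if insert_commute)
  qed
  have Q: "X - {a, b} = {d, e, c}" "X - {b, d} = {e, c, a}" "X - {d, e} = {a, c, b}" "X - {e, a} = {b, c, d}"
    using X dist by auto
  have co: "X - {a} = {b, d, e, c}" "X - {b} = {a, d, e, c}" "X - {d} = {a, b, e, c}" "X - {e} = {a, b, d, c}"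
    using X dist by auto
  have YE: "set ts - {a, b} = {d, e}" "set ts - {b, d} = {e, a}" "set ts - {d, e} = {a, b}" "set ts - {e, a} = {b, d}"
    unfolding Y using dist by auto
  have real: "?T {x, y} \<or> ?T (X - {x, y}) \<or> ?T {x} \<and> ?T (X - {y}) \<or> ?T {y} \<and> ?T (X - {x}) \<or>
      ?T {c} \<and> ?T (X - f) \<or> ?T {a, b, d, e} \<and> ?T f"
    if "{x, y} \<in> edge_set ts" "set ts - {x, y} = f" for x y f
  proof -
    have "?T {u} \<and> ?T (X - {v}) \<Longrightarrow> ?T {x} \<and> ?T (X - {y}) \<or> ?T {y} \<and> ?T (X - {x})" if "{x, y} = {u, v}" for u v
      using that by (auto simp: doubleton_eq_iff)
    then show ?thesis using edge_realized[OF that(1)] assms that(2) Y by auto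
  qed
  have "?T {a, b} \<and> ?T {b, d} \<and> ?T {d, e} \<and> ?T {e, a} \<or>
      ?T (X - {a, b}) \<and> ?T (X - {b, d}) \<and> ?T (X - {d, e}) \<and> ?T (X - {e, a}) \<or>
      ?T {c} \<and> (?T (X - {a, b}) \<and> ?T (X - {b, d}) \<or> ?T (X - {b, d}) \<and> ?T (X - {d, e}) \<or>
        ?T (X - {d, e}) \<and> ?T (X - {e, a}) \<or> ?T (X - {e, a}) \<and> ?T (X - {a, b})) \<or>
      ?T {a, b, d, e} \<and> (?T {a, b} \<and> ?T {b, d} \<or> ?T {b, d} \<and> ?T {d, e} \<or> ?T {d, e} \<and> ?T {e, a} \<or> ?T {e, a} \<and> ?T {a, b}) \<or>
      ?T {a} \<and> ?T {d} \<and> ?T (X - {b}) \<and> ?T (X - {e}) \<or> ?T {b} \<and> ?T {e} \<and> ?T (X - {a}) \<and> ?T (X - {d})"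
  proof (rule four_cycle_cases)
    show "\<not> (?T {a} \<and> ?T (X - {d}))" "\<not> (?T {d} \<and> ?T (X - {a}))" "\<not> (?T {b} \<and> ?T (X - {e}))" "\<not> (?T {e} \<and> ?T (X - {b}))"
      by (rule sing; use bad in \<open>simp add: insert_commute\<close>)+
    show "\<not> (?T {a, b, d, e} \<and> (?T {a} \<or> ?T {b} \<or> ?T {d} \<or> ?T {e}))" using u by blast
    show "\<not> (?T {c} \<and> (?T (X - {a}) \<or> ?T (X - {b}) \<or> ?T (X - {d}) \<or> ?T (X - {e})))" using k by blast
    show "?T {a, b} \<or> ?T (X - {a, b}) \<or> ?T {a} \<and> ?T (X - {b}) \<or> ?T {b} \<and> ?T (X - {a}) \<or>
      ?T {c} \<and> ?T (X - {d, e}) \<or> ?T {a, b, d, e} \<and> ?T {d, e}" by (rule real) (simp_all add: E YE)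
    show "?T {b, d} \<or> ?T (X - {b, d}) \<or> ?T {b} \<and> ?T (X - {d}) \<or> ?T {d} \<and> ?T (X - {b}) \<or>
      ?T {c} \<and> ?T (X - {e, a}) \<or> ?T {a, b, d, e} \<and> ?T {e, a}" by (rule real) (simp_all add: E YE)
    show "?T {d, e} \<or> ?T (X - {d, e}) \<or> ?T {d} \<and> ?T (X - {e}) \<or> ?T {e} \<and> ?T (X - {d}) \<or>
      ?T {c} \<and> ?T (X - {a, b}) \<or> ?T {a, b, d, e} \<and> ?T {a, b}" by (rule real) (simp_all add: E YE)
    show "?T {e, a} \<or> ?T (X - {e, a}) \<or> ?T {e} \<and> ?T (X - {a}) \<or> ?T {a} \<and> ?T (X - {e}) \<or>
      ?T {c} \<and> ?T (X - {b, d}) \<or> ?T {a, b, d, e} \<and> ?T {b, d}" by (rule real) (simp_all add: E YE)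
  qed (rule tri; simp add: insert_commute)+
  then consider
      "?T {a, b}" "?T {b, d}" "?T {d, e}" "?T {e, a}"
    | "?T (X - {a, b})" "?T (X - {b, d})" "?T (X - {d, e})" "?T (X - {e, a})"
    | "?T {c}" "?T (X - {a, b})" "?T (X - {b, d})" | "?T {c}" "?T (X - {b, d})" "?T (X - {d, e})"
    | "?T {c}" "?T (X - {d, e})" "?T (X - {e, a})" | "?T {c}" "?T (X - {e, a})" "?T (X - {a, b})"
    | "?T {a, b, d, e}" "?T {a, b}" "?T {b, d}" | "?T {a, b, d, e}" "?T {b, d}" "?T {d, e}"
    | "?T {a, b, d, e}" "?T {d, e}" "?T {e, a}" | "?T {a, b, d, e}" "?T {e, a}" "?T {a, b}"
    | "?T {a}" "?T {d}" "?T (X - {b})" "?T (X - {e})" | "?T {b}" "?T {e}" "?T (X - {a})" "?T (X - {d})"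
    by argo
  then show ?thesis
  proof cases
    case 1
    then show ?thesis using all_edges_rows E by auto
  next
    case 2
    then show ?thesis using all_edges_corows E by auto
  next
    case 3
    \<comment> \<open>The common vertex of the two edges becomes the zero column; the opposite
      vertex and \<open>c\<close> become the two columns shared by the long rows.\<close>
    show ?thesis by (rule Z4_configuration[of M X d e c a b]) (use 3 Q X dist cols in \<open>auto simp: insert_commute\<close>)
  next
    case 4
    show ?thesis by (rule Z4_configuration[of M X e a c b d]) (use 4 Q X dist cols in \<open>auto simp: insert_commute\<close>)
  next
    case 5
    show ?thesis by (rule Z4_configuration[of M X a b c d e]) (use 5 Q X dist cols in \<open>auto simp: insert_commute\<close>)
  next
    case 6
    show ?thesis by (rule Z4_configuration[of M X b d c e a]) (use 6 Q X dist cols in \<open>auto simp: insert_commute\<close>)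
  next
    case 7
    show ?thesis by (rule complement_Z4_configuration[of M X a b d e c]) (use 7 X dist cols in \<open>auto simp: insert_commute\<close>)
  next
    case 8
    show ?thesis by (rule complement_Z4_configuration[of M X b d e a c]) (use 8 X dist cols in \<open>auto simp: insert_commute\<close>)
  next
    case 9
    show ?thesis by (rule complement_Z4_configuration[of M X d e a b c]) (use 9 X dist cols in \<open>auto simp: insert_commute\<close>)
  next
    case 10
    show ?thesis by (rule complement_Z4_configuration[of M X e a b d c]) (use 10 X dist cols in \<open>auto simp: insert_commute\<close>)
  next
    case 11
    show ?thesis by (rule Z8_configuration[of M X e c a d b]) (use 11 co X dist cols in \<open>auto simp: insert_commute\<close>)
  next
    case 12
    show ?thesis by (rule Z8_configuration[of M X d c b e a]) (use 12 co X dist cols in \<open>auto simp: insert_commute\<close>)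
  qed
qed

text \<open>Unions with three or four vertices are inadmissible. If an edge is a row, so are all
  edges disjoint from it, and likewise for complemented rows; the property then spreads over the
  whole cycle. Otherwise every edge is shared by a singleton row and a complemented one. Two such
  edges at a distance combine into an inadmissible pair.\<close>

lemma long_cycle_configuration:
  assumes m: "5 \<le> length ts"
  shows "\<exists>N\<in>F_Dcirc_inf. contains_configuration M N"
proof -
  let ?T = "row_trace M X" and ?E = "edge_set ts" and ?m = "length ts"
  have not_adm: "\<not> admissible A" if A: "3 \<le> card A" "card A \<noteq> ?m" for A
  proof
    assume "admissible A"
    then obtain e where "e \<in> ?E" "A \<subseteq> e" using A(2) card_ts unfolding admissible_def by blast
    then have "card A \<le> 2" using edge_card[of e] by (metis card.infinite card_mono zero_neq_numeral)
    then show False using A(1) by simp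
  qed
  have sub: "e \<subseteq> set ts" "card e = 2" "finite e" if "e \<in> ?E" for e
    using edge_set_subset[OF that] edge_card[OF that] by (auto intro: card_ge_0_finite)
  \<comment> \<open>The complement of an edge in the cycle has at least three vertices and is not
    the whole cycle; this removes two alternatives of \<open>edge_realized\<close>.\<close>
  have real: "?T e \<or> ?T (X - e) \<or> (\<exists>u v. e = {u, v} \<and> ?T {u} \<and> ?T (X - {v}))" if e: "e \<in> ?E" for e
  proof -
    have cd: "card (set ts - e) = ?m - 2" using sub[OF e] card_ts by (simp add: card_Diff_subset)
    have "\<not> admissible (set ts - e)" by (rule not_adm) (use cd m in simp_all)
    then have "\<not> ?T (set ts - e)" "\<not> ?T (X - (set ts - e))"
      using admissible_row[of "set ts - e"] admissible_corow[of "set ts - e"] ts(3) by blast+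
    then show ?thesis using edge_realized[OF e] m by auto
  qed
  have no_union: False if "?T A" "?T (X - B)" "A \<subseteq> set ts" "B \<subseteq> set ts" "card (A \<union> B) \<in> {3, 4}" for A B
    using admissible_union[OF that(1-4)] not_adm[of "A \<union> B"] that(5) m by auto
  have row_spreads: "?T e'" if e: "e \<in> ?E" "e' \<in> ?E" "e \<inter> e' = {}" "?T e" for e e'
  proof -
    have "card (e \<union> e') = 4" using sub[OF e(1)] sub[OF e(2)] e(3) by (simp add: card_Un_disjoint)
    then have "\<not> ?T (X - e')" using no_union[of e e'] e sub by auto
    moreover have "\<not> ?T (X - {v})" if "v \<in> e'" for v
    proof
      assume "?T (X - {v})"
      moreover have "v \<notin> e" using that e(3) by blast
      then have "card (e \<union> {v}) = 3" using sub[OF e(1)] by simp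
      ultimately show False using no_union[of e "{v}"] e sub that by auto
    qed
    ultimately show ?thesis using real[OF e(2)] by auto
  qed
  have corow_spreads: "?T (X - e')" if e: "e \<in> ?E" "e' \<in> ?E" "e \<inter> e' = {}" "?T (X - e)" for e e'
  proof -
    have "card (e' \<union> e) = 4" using sub[OF e(1)] sub[OF e(2)] e(3) by (simp add: card_Un_disjoint inf_commute)
    then have "\<not> ?T e'" using no_union[of e' e] e sub by auto
    moreover have "\<not> ?T {u}" if "u \<in> e'" for u
    proof
      assume "?T {u}"
      moreover have "u \<notin> e" using that e(3) by blast
      then have "card ({u} \<union> e) = 3" using sub[OF e(1)] by simp
      ultimately show False using no_union[of "{u}" e] e sub that by auto
    qed
    ultimately show ?thesis using real[OF e(2)] by auto
  qed
  \<comment> \<open>Disjointness connects all edges of a cycle with five or more vertices: edge 0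
    reaches the edges 2 to \<open>?m - 2\<close>, edge 3 reaches edge 1, and edge 2 reaches the last
    one. On four vertices only opposite edges would be connected.\<close>
  have spread: "\<forall>e\<in>?E. R e" if e0: "e0 \<in> ?E" "R e0"
    and sp: "\<And>e e'. e \<in> ?E \<Longrightarrow> e' \<in> ?E \<Longrightarrow> e \<inter> e' = {} \<Longrightarrow> R e \<Longrightarrow> R e'" for R e0
  proof -
    obtain i where i: "i < ?m" "e0 = {ts ! i, ts ! (Suc i mod ?m)}" using e0(1) unfolding edge_set_def by auto
    define us where "us = rotate i ts"
    have us: "distinct us" "length us = ?m" "edge_set us = ?E" unfolding us_def using ts by (simp_all add: edge_set_rotate)
    define f where "f j = {us ! j, us ! (Suc j mod ?m)}" for j
    have f: "?E = f ` {..<?m}" using us(2,3) unfolding edge_set_def f_def by simp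
    have disj: "f j \<inter> f l = {}" if "j < ?m" "l < ?m" "l \<notin> {j, Suc j mod ?m}" "Suc l mod ?m \<notin> {j, Suc j mod ?m}" for j l
    proof -
      have "Suc j mod ?m < ?m" "Suc l mod ?m < ?m" using that(1,2) by (auto intro!: mod_less_divisor)
      then show ?thesis unfolding f_def using that us(1,2) by (auto simp: nth_eq_iff_index_eq)
    qed
    have "0 < ?m" "1 < ?m" using m by auto
    then have "us ! 0 = ts ! i" "us ! 1 = ts ! (Suc i mod ?m)" using i(1) unfolding us_def by (simp_all add: nth_rotate)
    then have "f 0 = e0" unfolding f_def i(2) using m by simp
    have step: "R (f l)" if "R (f j)" "j < ?m" "l < ?m" "l \<notin> {j, Suc j mod ?m}" "Suc l mod ?m \<notin> {j, Suc j mod ?m}" for j l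
      using sp[of "f j" "f l"] disj[OF that(2-5)] that(1-3) f by blast
    have far: "R (f l)" if "2 \<le> l" "Suc l < ?m" for l
      by (rule step[of 0]) (use that e0(2) \<open>f 0 = e0\<close> m in auto)
    have "R (f 1)" by (rule step[of 3]) (use far[of 3] m in auto)
    moreover have "R (f (?m - 1))"
    proof -
      have "Suc (?m - 1) = ?m" using m by linarith
      then have "Suc (?m - 1) mod ?m = 0" "Suc 2 mod ?m = 3" using m by simp_all
      moreover have "?m - 1 \<noteq> 2" "?m - 1 \<noteq> 3" "2 < ?m" "?m - 1 < ?m" using m by linarith+
      moreover have "R (f 2)" using far[of 2] m by simp
      ultimately show ?thesis using step[of 2 "?m - 1"] by simp
    qed
    moreover have "R (f 0)" using e0(2) \<open>f 0 = e0\<close> by simp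
    moreover have "l = 0 \<or> l = 1 \<or> l = ?m - 1 \<or> 2 \<le> l \<and> Suc l < ?m" if "l < ?m" for l using that by linarith
    ultimately show ?thesis unfolding f using far by auto
  qed
  show ?thesis
  proof (cases "\<exists>e\<in>?E. ?T e \<or> ?T (X - e)")
    case True
    then obtain e where e: "e \<in> ?E" "?T e \<or> ?T (X - e)" by blast
    then show ?thesis
    proof (elim disjE)
      assume "?T e"
      then have "\<forall>e\<in>?E. ?T e" using spread[OF e(1), of ?T] row_spreads by blast
      then show ?thesis using all_edges_rows by blast
    next
      assume "?T (X - e)"
      then have "\<forall>e\<in>?E. ?T (X - e)" using spread[OF e(1), of "\<lambda>e. ?T (X - e)"] corow_spreads by blast
      then show ?thesis using all_edges_corows by blast
    qed
  next
    case False
    have len: "0 < ?m" "1 < ?m" "2 < ?m" "3 < ?m" "4 < ?m" using m by auto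
    have "{ts ! 0, ts ! (Suc 0 mod ?m)} \<in> ?E" "{ts ! 2, ts ! (Suc 2 mod ?m)} \<in> ?E"
      unfolding edge_set_def using len by auto
    then have E: "{ts ! 0, ts ! 1} \<in> ?E" "{ts ! 2, ts ! 3} \<in> ?E" using m by (simp_all add: numeral_3_eq_3)
    obtain u v where uv: "{ts ! 0, ts ! 1} = {u, v}" "?T {u}" "?T (X - {v})" using real[OF E(1)] False E by blast
    obtain u' v' where uv': "{ts ! 2, ts ! 3} = {u', v'}" "?T {u'}" "?T (X - {v'})" using real[OF E(2)] False E by blast
    \<comment> \<open>The neighbours of vertex 0 are 1 and \<open>?m - 1\<close>, and the latter is
      at least 4.\<close>
    have far: "\<not> admissible {ts ! 0, ts ! j}" if j: "j = 2 \<or> j = 3" for j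
    proof
      assume adm: "admissible {ts ! 0, ts ! j}"
      have jm: "j < ?m" using j m by auto
      have "card {ts ! 0, ts ! j} \<le> 2" by (simp add: card_insert_if)
      then have "{ts ! 0, ts ! j} \<noteq> set ts" using card_ts m by auto
      then obtain i where i: "i < ?m" "{ts ! 0, ts ! j} \<subseteq> {ts ! i, ts ! (Suc i mod ?m)}"
        using adm unfolding admissible_def edge_set_def by auto
      have "Suc i mod ?m < ?m" using len by simp
      then have "0 \<in> {i, Suc i mod ?m}" "j \<in> {i, Suc i mod ?m}"
        using i jm len ts(1) by (auto simp: nth_eq_iff_index_eq)
      then show False using j m i(1) by (auto simp: mod_Suc split: if_splits)
    qed
    have pair: "admissible {x, y}" if "?T {x}" "?T (X - {y})" "x \<in> set ts" "y \<in> set ts" for x y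
      using admissible_union[OF that(1,2)] that(3,4) by (simp add: insert_commute)
    have mem: "u \<in> set ts" "v \<in> set ts" "u' \<in> set ts" "v' \<in> set ts"
      using uv(1) uv'(1) len by (metis insertI1 insertI2 insert_iff nth_mem singletonD)+
    have "v' = ts ! 2 \<or> v' = ts ! 3" "u' = ts ! 2 \<or> u' = ts ! 3" using uv'(1) by blast+
    moreover have "admissible {u, v'}" "admissible {v, u'}"
      using pair[OF uv(2) uv'(3) mem(1,4)] pair[OF uv'(2) uv(3) mem(3,2)] by (simp_all add: insert_commute)
    ultimately have "u \<noteq> ts ! 0" "v \<noteq> ts ! 0" using far by metis+
    moreover have "ts ! 0 \<in> {u, v}" using uv(1) by (metis insertI1)
    ultimately show ?thesis by simp
  qed
qed

end

section \<open>Symmetries of the six-column obstruction\<close>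

lemma matching_obsD:
  assumes "matching_obs G x1 y1 x2 y2 x3 y3"
  shows "distinct [x1, y1, x2, y2, x3, y3]"
    "\<exists>g\<in>G. g \<inter> {x1, y1, x2, y2, x3, y3} = {x1, y1}"
    "\<exists>g\<in>G. g \<inter> {x1, y1, x2, y2, x3, y3} = {x2, y2}"
    "\<exists>g\<in>G. g \<inter> {x1, y1, x2, y2, x3, y3} = {x3, y3}"
    "\<exists>g\<in>G. g \<inter> {x1, y1, x2, y2, x3, y3} = {x1, x2, x3}"
  using assms unfolding matching_obs_def by - (elim conjE, assumption)+

lemma matching_obs_permute:
  assumes "matching_obs G x1 y1 x2 y2 x3 y3"
  shows "matching_obs G x2 y2 x1 y1 x3 y3" "matching_obs G x1 y1 x3 y3 x2 y2"
proof -
  have "{x2, y2, x1, y1, x3, y3} = {x1, y1, x2, y2, x3, y3}" "{x1, y1, x3, y3, x2, y2} = {x1, y1, x2, y2, x3, y3}"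
    "{x2, x1, x3} = {x1, x2, x3}" "{x1, x3, x2} = {x1, x2, x3}" by blast+
  moreover have "distinct [x2, y2, x1, y1, x3, y3]" "distinct [x1, y1, x3, y3, x2, y2]"
    using assms unfolding matching_obs_def by auto
  ultimately show "matching_obs G x2 y2 x1 y1 x3 y3" "matching_obs G x1 y1 x3 y3 x2 y2"
    using assms unfolding matching_obs_def by simp_all
qed

lemma matching_obs_swap:
  assumes "\<And>g. g \<in> G \<Longrightarrow> - g \<in> G" "matching_obs G x1 y1 x2 y2 x3 y3"
  shows "matching_obs G y1 x1 y2 x2 y3 x3"
proof -
  have S: "{y1, x1, y2, x2, y3, x3} = {x1, y1, x2, y2, x3, y3}" by blast
  obtain g where g: "g \<in> G" "g \<inter> {x1, y1, x2, y2, x3, y3} = {x1, x2, x3}"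
    using matching_obsD(5)[OF assms(2)] by (elim bexE)
  have "(- g) \<inter> {x1, y1, x2, y2, x3, y3} = {x1, y1, x2, y2, x3, y3} - {x1, x2, x3}" using g(2) by blast
  also have "\<dots> = {y1, y2, y3}" using assms(2) unfolding matching_obs_def by auto
  finally have "\<exists>g\<in>G. g \<inter> {x1, y1, x2, y2, x3, y3} = {y1, y2, y3}" using assms(1)[OF g(1)] by blast
  moreover have "distinct [y1, x1, y2, x2, y3, x3]" using assms(2) unfolding matching_obs_def by auto
  ultimately show ?thesis using assms(2) unfolding matching_obs_def S by (simp add: insert_commute)
qed

section \<open>Rows cannot realize the six-column obstruction\<close>

text \<open>The arguments say which points of a six-column obstruction belong to a given member of the family;
  any excluded pattern would create a cyclic obstruction on fewer columns.\<close>

definition matching_core :: "bool \<Rightarrow> bool \<Rightarrow> bool \<Rightarrow> bool \<Rightarrow> bool \<Rightarrow> bool \<Rightarrow> bool" where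
  "matching_core a1 b1 a2 b2 a3 b3 \<longleftrightarrow> \<not> (a1 \<and> b2 \<and> \<not> b1 \<and> \<not> a2) \<and>
     \<not> (a1 \<and> \<not> b1 \<and> a2 \<and> b2 \<and> \<not> a3 \<and> \<not> b3) \<and> \<not> (a1 \<and> a2 \<and> \<not> b1 \<and> \<not> b2 \<and> \<not> a3)"

definition matching_perms :: "bool \<Rightarrow> bool \<Rightarrow> bool \<Rightarrow> bool \<Rightarrow> bool \<Rightarrow> bool \<Rightarrow> bool" where
  "matching_perms a1 b1 a2 b2 a3 b3 \<longleftrightarrow>
     matching_core a1 b1 a2 b2 a3 b3 \<and> matching_core a1 b1 a3 b3 a2 b2 \<and> matching_core a2 b2 a1 b1 a3 b3 \<and>
     matching_core a2 b2 a3 b3 a1 b1 \<and> matching_core a3 b3 a1 b1 a2 b2 \<and> matching_core a3 b3 a2 b2 a1 b1"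

text \<open>Closes the exclusions under the symmetries of the obstruction, which are permuting the
  pairs and exchanging the partners in all pairs, and under complement of the member.\<close>

definition matching_ok :: "bool \<Rightarrow> bool \<Rightarrow> bool \<Rightarrow> bool \<Rightarrow> bool \<Rightarrow> bool \<Rightarrow> bool" where
  "matching_ok a1 b1 a2 b2 a3 b3 \<longleftrightarrow> matching_perms a1 b1 a2 b2 a3 b3 \<and> matching_perms b1 a1 b2 a2 b3 a3 \<and>
     matching_perms (\<not> a1) (\<not> b1) (\<not> a2) (\<not> b2) (\<not> a3) (\<not> b3) \<and>
     matching_perms (\<not> b1) (\<not> a1) (\<not> b2) (\<not> a2) (\<not> b3) (\<not> a3)"

text \<open>The letters \<open>a\<close>, \<open>b\<close> describe a row \<open>B\<close> and the
  letters \<open>c\<close>, \<open>d\<close> a row \<open>A\<close> such that \<open>B - A\<close>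
  is the triple.\<close>

lemma matching_ok_triple:
  assumes "matching_ok a1 b1 a2 b2 a3 b3" "a1" "a2" "a3" "matching_ok c1 d1 c2 d2 c3 d3" "\<not> c1" "\<not> c2" "\<not> c3"
    and "b1 \<longrightarrow> d1" "b2 \<longrightarrow> d2" "b3 \<longrightarrow> d3"
  shows "\<not> b1 \<and> \<not> b2 \<and> \<not> b3 \<or> d1 \<and> d2 \<and> d3"
  using assms unfolding matching_ok_def matching_perms_def matching_core_def by (smt (verit))

text \<open>The letters describe a row; the second and third hypotheses concern its two differences
  with a row that is the triple.\<close>

lemma matching_ok_rows:
  assumes "matching_ok a1 b1 a2 b2 a3 b3" "matching_ok (\<not> a1) False (\<not> a2) False (\<not> a3) False"
    "matching_ok False b1 False b2 False b3"
  shows "\<not> a1 \<and> \<not> a2 \<and> \<not> a3 \<and> (\<not> b1 \<and> \<not> b2 \<or> \<not> b1 \<and> \<not> b3 \<or> \<not> b2 \<and> \<not> b3 \<or> b1 \<and> b2 \<and> b3) \<or>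
    a1 \<and> a2 \<and> a3 \<and> (\<not> b1 \<and> \<not> b2 \<and> \<not> b3 \<or> b1 \<and> b2 \<and> b3) \<or>
    b1 \<and> b2 \<and> b3 \<and> (a1 \<and> a2 \<or> a1 \<and> a3 \<or> a2 \<and> a3)"
  using assms unfolding matching_ok_def matching_perms_def matching_core_def by (smt (verit))

context minimal_noncircular begin

text \<open>Each excluded pattern would complete a cyclic obstruction on at most five of the six
  columns, against minimality: a triangle around \<open>x2\<close>, a triangle around
  \<open>y1\<close>, and a four-cycle around \<open>x3\<close> with the edges
  \<open>{y1, y2}\<close>, \<open>{y2, x2}\<close>, \<open>{x2, x1}\<close>,
  \<open>{x1, y1}\<close>.\<close>

lemma matching_core_mem:
  assumes m: "matching_obs G x1 y1 x2 y2 x3 y3" and sub: "{x1, y1, x2, y2, x3, y3} \<subseteq> X" and h: "h \<in> G"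
  shows "matching_core (x1 \<in> h) (y1 \<in> h) (x2 \<in> h) (y2 \<in> h) (x3 \<in> h) (y3 \<in> h)"
proof -
  let ?S = "{x1, y1, x2, y2, x3, y3}"
  have d: "distinct [x1, y1, x2, y2, x3, y3]" by (rule matching_obsD(1)[OF m])
  have small: "\<not> cyc_obs G w ts" if "insert w (set ts) \<subset> X" for w ts
    using cyc_obs_not_circular[of G w ts] minimal[OF that] by blast
  have mem: "x \<in> g \<longleftrightarrow> x \<in> T" if "g \<inter> ?S = T" "x \<in> ?S" for x g T using that by blast
  obtain g1 where g1: "g1 \<in> G" "g1 \<inter> ?S = {x1, y1}" using matching_obsD(2)[OF m] by (elim bexE)
  obtain g2 where g2: "g2 \<in> G" "g2 \<inter> ?S = {x2, y2}" using matching_obsD(3)[OF m] by (elim bexE)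
  obtain t where t: "t \<in> G" "t \<inter> ?S = {x1, x2, x3}" using matching_obsD(5)[OF m] by (elim bexE)
  have g1m: "x1 \<in> g1" "y1 \<in> g1" "x2 \<notin> g1" "y2 \<notin> g1" "x3 \<notin> g1" "y3 \<notin> g1"
    using mem[OF g1(2)] d by auto
  have g2m: "x1 \<notin> g2" "y1 \<notin> g2" "x2 \<in> g2" "y2 \<in> g2" "x3 \<notin> g2" "y3 \<notin> g2"
    using mem[OF g2(2)] d by auto
  have tm: "x1 \<in> t" "y1 \<notin> t" "x2 \<in> t" "y2 \<notin> t" "x3 \<in> t" "y3 \<notin> t"
    using mem[OF t(2)] d by auto
  have compl': "sep G z w x y \<Longrightarrow> sep G x y z w" for x y z w using sep_rotate[OF compl] .
  have "\<not> (x1 \<in> h \<and> y2 \<in> h \<and> y1 \<notin> h \<and> x2 \<notin> h)"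
  proof
    assume *: "x1 \<in> h \<and> y2 \<in> h \<and> y1 \<notin> h \<and> x2 \<notin> h"
    have "sep G x1 y2 y1 x2" unfolding sep_def using * h by blast
    moreover have "sep G y2 y1 x1 x2" by (rule compl') (use t tm in \<open>auto simp: sep_def\<close>)
    moreover have "sep G y1 x1 y2 x2" unfolding sep_def using g1 g1m by blast
    ultimately have "cyc_obs G x2 [x1, y2, y1]" by (intro cyc_obs_triangle) (use d in auto)
    moreover have "insert x2 (set [x1, y2, y1]) \<subset> X" using sub d by auto
    ultimately show False using small by blast
  qed
  moreover have "\<not> (x1 \<in> h \<and> y1 \<notin> h \<and> x2 \<in> h \<and> y2 \<in> h \<and> x3 \<notin> h \<and> y3 \<notin> h)"
  proof
    assume *: "x1 \<in> h \<and> y1 \<notin> h \<and> x2 \<in> h \<and> y2 \<in> h \<and> x3 \<notin> h \<and> y3 \<notin> h"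
    have "sep G x3 y2 x1 y1" by (rule compl') (use g1 g1m in \<open>auto simp: sep_def\<close>)
    moreover have "sep G y2 x1 x3 y1" unfolding sep_def using * h by blast
    moreover have "sep G x1 x3 y2 y1" unfolding sep_def using t tm by blast
    ultimately have "cyc_obs G y1 [x3, y2, x1]" by (intro cyc_obs_triangle) (use d in auto)
    moreover have "insert y1 (set [x3, y2, x1]) \<subset> X" using sub d by auto
    ultimately show False using small by blast
  qed
  moreover have "\<not> (x1 \<in> h \<and> x2 \<in> h \<and> y1 \<notin> h \<and> y2 \<notin> h \<and> x3 \<notin> h)"
  proof
    assume *: "x1 \<in> h \<and> x2 \<in> h \<and> y1 \<notin> h \<and> y2 \<notin> h \<and> x3 \<notin> h"
    let ?ts = "[y1, y2, x2, x1]"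
    have "(- t) \<inter> insert x3 (set ?ts) = {y1, y2}" "g2 \<inter> insert x3 (set ?ts) = {y2, x2}"
      "h \<inter> insert x3 (set ?ts) = {x2, x1}" "g1 \<inter> insert x3 (set ?ts) = {x1, y1}"
      using tm g2m g1m * by auto
    then have "\<forall>e\<in>edge_set ?ts. \<exists>g\<in>G. g \<inter> insert x3 (set ?ts) = e"
      unfolding edge_set_4 using compl[OF t(1)] g1(1) g2(1) h by blast
    then have "cyc_obs G x3 ?ts" unfolding cyc_obs_iff using d by auto
    moreover have "insert x3 (set ?ts) \<subset> X" using sub d by auto
    ultimately show False using small by blast
  qed
  ultimately show ?thesis unfolding matching_core_def by blast
qed

lemma matching_perms_mem:
  assumes m: "matching_obs G x1 y1 x2 y2 x3 y3" and sub: "{x1, y1, x2, y2, x3, y3} \<subseteq> X" and h: "h \<in> G"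
  shows "matching_perms (x1 \<in> h) (y1 \<in> h) (x2 \<in> h) (y2 \<in> h) (x3 \<in> h) (y3 \<in> h)"
proof -
  note p = matching_obs_permute
  have m2: "matching_obs G x1 y1 x3 y3 x2 y2" "matching_obs G x2 y2 x1 y1 x3 y3" "matching_obs G x2 y2 x3 y3 x1 y1"
    "matching_obs G x3 y3 x1 y1 x2 y2" "matching_obs G x3 y3 x2 y2 x1 y1"
    using p(1)[OF m] p(2)[OF m] p(2)[OF p(1)[OF m]] p(1)[OF p(2)[OF m]] p(1)[OF p(2)[OF p(1)[OF m]]] by blast+
  show ?thesis unfolding matching_perms_def
    by (intro conjI matching_core_mem[OF _ _ h] m m2) (use sub in auto)
qed

lemma matching_ok_mem:
  assumes m: "matching_obs G x1 y1 x2 y2 x3 y3" and sub: "{x1, y1, x2, y2, x3, y3} \<subseteq> X" and h: "h \<in> G"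
  shows "matching_ok (x1 \<in> h) (y1 \<in> h) (x2 \<in> h) (y2 \<in> h) (x3 \<in> h) (y3 \<in> h)"
proof -
  have m': "matching_obs G y1 x1 y2 x2 y3 x3" by (rule matching_obs_swap[OF compl m])
  have sub': "{y1, x1, y2, x2, y3, x3} \<subseteq> X" using sub by blast
  show ?thesis unfolding matching_ok_def
    using matching_perms_mem[OF m sub h] matching_perms_mem[OF m' sub' h]
      matching_perms_mem[OF m sub compl[OF h]] matching_perms_mem[OF m' sub' compl[OF h]] by simp
qed

end

locale matching_core_rows = minimal_noncircular "D_sets M" X
  for M :: "bool mat" and X :: "nat set" +
  fixes x1 y1 x2 y2 x3 y3 :: nat
  assumes match: "matching_obs (D_sets M) x1 y1 x2 y2 x3 y3" and sub: "{x1, y1, x2, y2, x3, y3} \<subseteq> X"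
begin

lemma dist: "distinct [x1, y1, x2, y2, x3, y3]"
  by (rule matching_obsD(1)[OF match])

lemma dist_rev: "distinct [y3, x3, y2, x2, y1, x1]"
  using dist by auto

text \<open>Traces are taken on the six columns, as \<open>X\<close> is only known to include
  them.\<close>

definition S :: "nat set" where "S = {x1, y1, x2, y2, x3, y3}"

definition ok :: "nat set \<Rightarrow> bool" where
  "ok A \<longleftrightarrow> matching_ok (x1 \<in> A) (y1 \<in> A) (x2 \<in> A) (y2 \<in> A) (x3 \<in> A) (y3 \<in> A)"

lemma ok_trace:
  assumes "g \<in> D_sets M" "g \<inter> S = A"
  shows "ok A"
proof -
  have "x \<in> g \<longleftrightarrow> x \<in> A" if "x \<in> S" for x using assms(2) that by blast
  then show ?thesis using matching_ok_mem[OF match sub assms(1)] unfolding ok_def S_def by simp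
qed

lemma ok_row: "row_trace M S A \<Longrightarrow> ok A"
  using row_trace_in(1) ok_trace by blast

lemma ok_diff: "row_trace M S A \<Longrightarrow> row_trace M S B \<Longrightarrow> ok (B - A)"
  using row_trace_diff_in(1) ok_trace by blast

lemma diff_mem:
  assumes "B - A = C"
  shows "x1 \<in> B \<and> x1 \<notin> A \<longleftrightarrow> x1 \<in> C" "y1 \<in> B \<and> y1 \<notin> A \<longleftrightarrow> y1 \<in> C" "x2 \<in> B \<and> x2 \<notin> A \<longleftrightarrow> x2 \<in> C"
    "y2 \<in> B \<and> y2 \<notin> A \<longleftrightarrow> y2 \<in> C" "x3 \<in> B \<and> x3 \<notin> A \<longleftrightarrow> x3 \<in> C" "y3 \<in> B \<and> y3 \<notin> A \<longleftrightarrow> y3 \<in> C"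
  using assms by blast+

lemma eq_S: "A = B" if "A \<subseteq> S" "B \<subseteq> S" "x1 \<in> A \<longleftrightarrow> x1 \<in> B" "y1 \<in> A \<longleftrightarrow> y1 \<in> B" "x2 \<in> A \<longleftrightarrow> x2 \<in> B"
    "y2 \<in> A \<longleftrightarrow> y2 \<in> B" "x3 \<in> A \<longleftrightarrow> x3 \<in> B" "y3 \<in> A \<longleftrightarrow> y3 \<in> B"
  using that unfolding S_def by blast

text \<open>The exclusions leave nothing in between: \<open>B\<close> contains none of the partners
  \<open>y1\<close>, \<open>y2\<close>, \<open>y3\<close>, or \<open>A\<close> contains all of
  them.\<close>

lemma diff_triple:
  assumes A: "row_trace M S A" and B: "row_trace M S B" and BA: "B - A = {x1, x2, x3}"
  shows "row_trace M S {x1, x2, x3} \<or> row_trace M S {y1, y2, y3}"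
proof -
  have mem: "x1 \<in> B" "x2 \<in> B" "x3 \<in> B" "x1 \<notin> A" "x2 \<notin> A" "x3 \<notin> A"
    "y1 \<in> B \<longrightarrow> y1 \<in> A" "y2 \<in> B \<longrightarrow> y2 \<in> A" "y3 \<in> B \<longrightarrow> y3 \<in> A" using diff_mem[OF BA] dist dist_rev by simp_all
  then have "y1 \<notin> B \<and> y2 \<notin> B \<and> y3 \<notin> B \<or> y1 \<in> A \<and> y2 \<in> A \<and> y3 \<in> A"
    using matching_ok_triple[OF ok_row[OF B, unfolded ok_def] _ _ _ ok_row[OF A, unfolded ok_def]] by blast
  moreover have "B = {x1, x2, x3}" if "y1 \<notin> B \<and> y2 \<notin> B \<and> y3 \<notin> B"
    by (rule eq_S) (use that mem dist row_trace_subset[OF B] in \<open>auto simp: S_def\<close>)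
  moreover have "A = {y1, y2, y3}" if "y1 \<in> A \<and> y2 \<in> A \<and> y3 \<in> A"
    by (rule eq_S) (use that mem dist row_trace_subset[OF A] in \<open>auto simp: S_def\<close>)
  ultimately show ?thesis using A B by blast
qed

text \<open>If the triple is a row, its differences with any other row must respect the exclusions,
  and few rows remain. They do not yield the pair \<open>{x1, y1}\<close> as a row, a complement or
  a difference. Only the complement of a difference is left, and it fixes both rows on the first two
  pairs.\<close>

lemma triple_row_pair:
  assumes T: "row_trace M S {x1, x2, x3}"
  obtains A B where "row_trace M S A" "row_trace M S B" "x1 \<notin> A" "y1 \<in> A" "x2 \<notin> A" "y2 \<notin> A"
    "x1 \<notin> B" "y1 \<in> B" "x2 \<in> B" "y2 \<in> B"
proof -
  have rows: "x1 \<notin> A \<and> x2 \<notin> A \<and> x3 \<notin> A \<and> (y1 \<notin> A \<and> y2 \<notin> A \<or> y1 \<notin> A \<and> y3 \<notin> A \<or> y2 \<notin> A \<and> y3 \<notin> A \<or> y1 \<in> A \<and> y2 \<in> A \<and> y3 \<in> A) \<or>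
      x1 \<in> A \<and> x2 \<in> A \<and> x3 \<in> A \<and> (y1 \<notin> A \<and> y2 \<notin> A \<and> y3 \<notin> A \<or> y1 \<in> A \<and> y2 \<in> A \<and> y3 \<in> A) \<or>
      y1 \<in> A \<and> y2 \<in> A \<and> y3 \<in> A \<and> (x1 \<in> A \<and> x2 \<in> A \<or> x1 \<in> A \<and> x3 \<in> A \<or> x2 \<in> A \<and> x3 \<in> A)"
    if A: "row_trace M S A" for A
  proof (rule matching_ok_rows)
    show "matching_ok (x1 \<in> A) (y1 \<in> A) (x2 \<in> A) (y2 \<in> A) (x3 \<in> A) (y3 \<in> A)"
      using ok_row[OF A] unfolding ok_def .
    show "matching_ok (x1 \<notin> A) False (x2 \<notin> A) False (x3 \<notin> A) False"
      using ok_diff[OF A T] dist dist_rev unfolding ok_def by simp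
    show "matching_ok False (y1 \<in> A) False (y2 \<in> A) False (y3 \<in> A)"
      using ok_diff[OF T A] dist dist_rev unfolding ok_def by simp
  qed
  obtain g where g: "g \<in> D_sets M" "g \<inter> S = {x1, y1}" using matching_obsD(2)[OF match] unfolding S_def by (elim bexE)
  have "S - g = S - {x1, y1}" using g(2) by blast
  also have "\<dots> = {x2, y2, x3, y3}" unfolding S_def using dist dist_rev by auto
  finally have Sg: "S - g = {x2, y2, x3, y3}" .
  from g(1) show thesis
  proof (cases rule: trace_cases[where X = S])
    case 1
    then show ?thesis using rows[OF 1] g(2) dist by auto
  next
    case 2
    then show ?thesis using rows[OF 2] Sg dist by auto
  next
    case (3 A B)
    have BA: "B - A = {x1, y1}" using 3(3) g(2) by simp
    have "x1 \<in> B" "y1 \<in> B" "x1 \<notin> A" "y1 \<notin> A" "x2 \<in> B \<longrightarrow> x2 \<in> A" "y2 \<in> B \<longrightarrow> y2 \<in> A"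
      "x3 \<in> B \<longrightarrow> x3 \<in> A" "y3 \<in> B \<longrightarrow> y3 \<in> A" using diff_mem[OF BA] dist dist_rev by simp_all
    then show ?thesis using rows[OF 3(1)] rows[OF 3(2)] by (smt (verit))
  next
    case (4 A B)
    have BA: "B - A = {x2, y2, x3, y3}" using 4(3) Sg by simp
    have "x2 \<in> B" "y2 \<in> B" "x3 \<in> B" "y3 \<in> B" "x2 \<notin> A" "y2 \<notin> A" "x3 \<notin> A" "y3 \<notin> A"
      "x1 \<in> B \<longrightarrow> x1 \<in> A" "y1 \<in> B \<longrightarrow> y1 \<in> A" using diff_mem[OF BA] dist dist_rev by simp_all
    then have "x1 \<notin> A \<and> y1 \<in> A \<and> x2 \<notin> A \<and> y2 \<notin> A \<and> x1 \<notin> B \<and> y1 \<in> B \<and> x2 \<in> B \<and> y2 \<in> B"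
      using rows[OF 4(1)] rows[OF 4(2)] by (smt (verit))
    then show ?thesis using that 4(1,2) by blast
  qed
qed

end

text \<open>By \<open>diff_triple\<close>, the triple or its complement in the six columns is a row,
  and the obstruction is symmetric in the two. Applying \<open>triple_row_pair\<close> to two of the
  pairs then supplies rows whose difference is excluded.\<close>

lemma D_family_no_matching_obs:
  assumes min: "minimal_noncircular (D_sets M) X"
    and m: "matching_obs (D_sets M) x1 y1 x2 y2 x3 y3" and sub: "{x1, y1, x2, y2, x3, y3} \<subseteq> X"
  shows False
proof -
  interpret minimal_noncircular "D_sets M" X by (rule min)
  have core: "matching_core_rows M X a1 b1 a2 b2 a3 b3"
    if "matching_obs (D_sets M) a1 b1 a2 b2 a3 b3" "{a1, b1, a2, b2, a3, b3} \<subseteq> X" for a1 b1 a2 b2 a3 b3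
    by unfold_locales (rule that)+
  let ?S = "{x1, y1, x2, y2, x3, y3}"
  have no_triple: "\<not> row_trace M ?S {a1, a2, a3}"
    if o: "matching_obs (D_sets M) a1 b1 a2 b2 a3 b3" and S: "{a1, b1, a2, b2, a3, b3} = ?S" for a1 b1 a2 b2 a3 b3
  proof
    assume T: "row_trace M ?S {a1, a2, a3}"
    have S': "{a2, b2, a1, b1, a3, b3} = ?S" "{a2, a1, a3} = {a1, a2, a3}" using S by blast+
    interpret a: matching_core_rows M X a1 b1 a2 b2 a3 b3 by (rule core[OF o]) (use S sub in simp)
    interpret b: matching_core_rows M X a2 b2 a1 b1 a3 b3
      by (rule core[OF matching_obs_permute(1)[OF o]]) (use S' sub in simp)
    obtain B where B: "row_trace M ?S B" "a1 \<notin> B" "b1 \<in> B" "a2 \<in> B" "b2 \<in> B"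
      using a.triple_row_pair T unfolding a.S_def S by metis
    obtain A where A: "row_trace M ?S A" "a2 \<notin> A" "b2 \<in> A" "a1 \<notin> A" "b1 \<notin> A"
      using b.triple_row_pair T unfolding b.S_def S' by metis
    \<comment> \<open>The difference contains \<open>b1\<close> and \<open>a2\<close> but neither
      \<open>a1\<close> nor \<open>b2\<close>: one point from each of two pairs, from opposite
      triples.\<close>
    have "a.ok (B - A)" using a.ok_diff A(1) B(1) unfolding a.S_def S by blast
    then show False using A B unfolding a.ok_def matching_ok_def matching_perms_def matching_core_def by auto
  qed
  have m': "matching_obs (D_sets M) y1 x1 y2 x2 y3 x3" by (rule matching_obs_swap[OF compl m])
  have S': "{y1, x1, y2, x2, y3, x3} = ?S" by blast
  interpret a: matching_core_rows M X x1 y1 x2 y2 x3 y3 by (rule core[OF m sub])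
  interpret b: matching_core_rows M X y1 x1 y2 x2 y3 x3 by (rule core[OF m']) (use S' sub in simp)
  have no: "\<not> row_trace M ?S {x1, x2, x3}" "\<not> row_trace M ?S {y1, y2, y3}"
    using no_triple[OF m refl] no_triple[OF m' S'] by blast+
  obtain g where g: "g \<in> D_sets M" "g \<inter> ?S = {x1, x2, x3}" using matching_obsD(5)[OF m] by (elim bexE)
  have "?S - g = ?S - {x1, x2, x3}" using g(2) by blast
  also have "\<dots> = {y1, y2, y3}" using a.dist a.dist_rev by auto
  finally have Sg: "?S - g = {y1, y2, y3}" .
  from g(1) show False
  proof (cases rule: trace_cases[where X = ?S])
    case (3 A B)
    then show False using a.diff_triple[of A B] no g(2) unfolding a.S_def by simp
  next
    case (4 A B)
    then show False using b.diff_triple[of A B] no Sg unfolding b.S_def S' by simp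
  qed (use g(2) Sg no in simp_all)
qed

section \<open>From minimal obstructions to the equivalence of the three conditions\<close>

lemma forbidden_configuration_if_not_D_circular:
  assumes "\<not> D_circular_property M"
  shows "\<exists>N\<in>F_Dcirc_inf. contains_configuration M N"
proof -
  let ?G = "D_sets M"
  define P where "P X \<longleftrightarrow> X \<subseteq> {..<dim_col M} \<and> \<not> circular ?G X" for X
  have "P {..<dim_col M}" using assms unfolding P_def D_circular_iff by simp
  then obtain X where X: "P X" "\<And>Y. P Y \<Longrightarrow> card X \<le> card Y" using ex_has_least_nat[of P _ card] by blast
  have cols: "X \<subseteq> {..<dim_col M}" using X(1) unfolding P_def by blast
  then have fin: "finite X" using finite_subset by blast
  interpret minimal_noncircular ?G X
  proof
    show "\<not> circular ?G X" using X(1) unfolding P_def by blast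
    fix S assume S: "S \<subset> X"
    then have "card S < card X" using fin by (rule psubset_card_mono[rotated])
    then show "circular ?G S" using X(2)[of S] S cols unfolding P_def by force
  qed (use two_sided_compl fin in auto)
  show ?thesis
  proof (rule minimal_obstruction)
    fix c ts assume o: "cyc_obs ?G c ts" and Xc: "X = insert c (set ts)"
    interpret cycle_core M X c ts by unfold_locales (use cols o Xc in auto)
    have "length ts = 3 \<or> length ts = 4 \<or> 5 \<le> length ts" using ts(2) by linarith
    then show ?thesis using three_cycle_configuration four_cycle_configuration long_cycle_configuration by blast
  next
    fix x1 y1 x2 y2 x3 y3
    assume "matching_obs ?G x1 y1 x2 y2 x3 y3" "{x1, y1, x2, y2, x3, y3} \<subseteq> X"
    then show ?thesis using D_family_no_matching_obs[OF minimal_noncircular_axioms] by blast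
  qed
qed

lemma F_Dcirc_inf_not_circular:
  assumes "N \<in> F_Dcirc_inf" "N \<notin> F_Dcirc"
  shows "\<not> circular_ones_property N"
proof -
  obtain k where "3 \<le> k" "N = star_mat (M_I k) \<or> N = complement_mat (star_mat (M_I k))"
    using assms unfolding F_Dcirc_inf_def by auto
  then show ?thesis using star_M_I_not_circular_ones circular_ones_complement by blast
qed

lemma D_circular_imp_circular_ones: "D_circular_property M \<Longrightarrow> circular_ones_property M"
  unfolding D_circular_property_def circular_ones_property_def by blast

theorem theorem15:
  fixes M :: "bool mat"
  shows "(D_circular_property M \<longleftrightarrow>
            circular_ones_property M \<and> (\<forall>N\<in>F_Dcirc. \<not> contains_configuration M N)) \<and>
         (circular_ones_property M \<and> (\<forall>N\<in>F_Dcirc. \<not> contains_configuration M N) \<longleftrightarrow>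
            (\<forall>N\<in>F_Dcirc_inf. \<not> contains_configuration M N))"
proof -
  have 1: "circular_ones_property M \<and> (\<forall>N\<in>F_Dcirc. \<not> contains_configuration M N)" if "D_circular_property M"
    using that D_circular_imp_circular_ones F_Dcirc_not_D_circular configuration_D_circular by blast
  have 2: "\<forall>N\<in>F_Dcirc_inf. \<not> contains_configuration M N"
    if "circular_ones_property M" "\<forall>N\<in>F_Dcirc. \<not> contains_configuration M N"
    using that F_Dcirc_inf_not_circular configuration_circular_ones by blast
  have 3: "D_circular_property M" if "\<forall>N\<in>F_Dcirc_inf. \<not> contains_configuration M N"
    using that forbidden_configuration_if_not_D_circular by blast
  show ?thesis using 1 2 3 by blast
qed

end
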